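(* Let $A$ be a homogeneous matrix, $w$ a generic direction, $v$ a fake exponent of $H_A(\beta)$ in the direction $w$, $\mathcal N$ a negative support family for $v$, and $B$ a Gale dual. For every $i\ge0$ there is an inclusion $V^{\mathrm{intr}}_{\mathcal N,i}\subseteq V^{\mathrm{amb}}_{\mathcal N,i}$, and the pairing $\langle\cdot,\cdot\rangle_s$ induces a perfect pairing $$\left(\frac{J_{\mathcal N}^{\mathrm{intr}}}{J_{\mathcal N}^{\mathrm{amb}}}\right)_i\times\frac{V^{\mathrm{amb}}_{\mathcal N,i}}{V^{\mathrm{intr}}_{\mathcal N,i}}\longrightarrow\mathbb C .$$ In particular, $$\left(\frac{J_{\mathcal N}^{\mathrm{intr}}}{J_{\mathcal N}^{\mathrm{amb}}}\right)_i\simeq\left(\frac{V^{\mathrm{amb}}_{\mathcal N,i}}{V^{\mathrm{intr}}_{\mathcal N,i}}\right)^\vee .$$ If $\mathcal N$ is ordered, then (under the identification of $q(\partial_s)$ with the polynomial $q(\partial_s)\exp(\sum_j(Bs)_j\log x_j)|_{s=0}$ in $\log x$) $V^{\mathrm{amb}}_{\mathcal N,i}$ and $V^{\mathrm{intr}}_{\mathcal N,i}$ are the degree-$i$ ambient and intrinsic coefficient spaces at $v$ for $\mathcal N$, respectively.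
   Context: System. $\mathbb N=\{0,1,2,\dots\}$. $A=(a_{ij})\in\mathbb Z^{d\times n}$ has rank $d$ and its columns lie in an affine hyperplane not containing the origin ("homogeneous"). $L=\ker_{\mathbb Z}(A)$, $r=\operatorname{rank}L=n-d$. For $u\in L$ write $u=u_+-u_-$ with $u_\pm\in\mathbb N^n$ of disjoint support. $I_A=\langle\partial^{u_+}-\partial^{u_-}\mid u\in L\rangle\subseteq\mathbb C[\partial_1,\dots,\partial_n]$. For $\beta\in\mathbb C^d$, $H_A(\beta)$ is the left ideal of the Weyl algebra in $x_1,\dots,x_n$ generated by $I_A$ and $\sum_j a_{ij}x_j\partial_j-\beta_i$ $(1\le i\le d)$. $\operatorname{in}_w$ takes terms of largest $w$-weight; $\operatorname{in}_{(-w,w)}$ is the initial ideal in the Weyl algebra for weights $-w$ on $x$, $w$ on $\partial$. A direction $w\in\mathbb R^n$ is generic if $\operatorname{in}_w(I_A)$ is a monomial ideal and $w$ lies in the interior of a full-dimensional cone of the small Gröbner fan of $H_A(\beta)$ (so $\operatorname{in}_{(-w',w')}(H_A(\beta))$ is constant for $w'$ in that interior). For $z\in\mathbb C^n$, $p\in\mathbb N^n$: $[z]_p=\prod_j z_j(z_j-1)\cdots(z_j-p_j+1)$. A fake exponent of $H_A(\beta)$ in the direction $w$ is $v\in\mathbb C^n$ with $Av=\beta$ and $[v]_p=0$ for every monomial $\partial^p\in\operatorname{in}_w(I_A)$. Negative supports. $\operatorname{nsupp}(z)=\{j\mid z_j\in\mathbb Z_{<0}\}$. For $u\in L$, $I_u=\operatorname{nsupp}(v+u)$;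 $I_0=\operatorname{nsupp}(v)$; $\mathcal S(v)=\{I_u\mid u\in L\}$. $\mathcal N_v=\{I\in\mathcal S(v)\mid w\cdot u\ge0\text{ for every }u\in L\text{ with }I_u=I\}$. A negative support family for $v$ is a set $\mathcal N$ with $I_0\in\mathcal N\subseteq\mathcal N_v$; it is ordered if $I\in\mathcal N$, $J\in\mathcal S(v)$, $J\subseteq I$ imply $J\in\mathcal N$. $K_{\mathcal N}=\bigcap_{I\in\mathcal N}I$. The two ideals. A Gale dual $B$ is an $n\times r$ integer matrix whose columns form a $\mathbb Z$-basis of $L$. $S_0=\mathbb C[s_1,\dots,s_r]$, standard graded; $\ell_j=(Bs)_j$, $\ell^Y=\prod_{j\in Y}\ell_j$ ($\ell^\varnothing=1$), $E=I_0\setminus K_{\mathcal N}$. Let $\{G_1,\dots,G_g\}$ be the inclusion-minimal members of $\{I\setminus K_{\mathcal N}\mid I\in\mathcal N\}$ and $\{H_1,\dots,H_h\}$ the inclusion-minimal members of $\{(I\cup J)\setminus K_{\mathcal N}\mid I\in\mathcal N,\ J\in\mathcal S(v)\setminus\mathcal N\}$. Each $H_a$ contains some $G_i$; choose such an index $\iota(a)$. $F_{\mathcal N}=\bigoplus_{i}S_0(-|G_i|)\eta_i$, and $Z_{\mathcal N}\subseteq F_{\mathcal N}$ is generated by $\ell^{G_j\setminus G_i}\eta_i-\ell^{G_i\setminus G_j}\eta_j$ $(i<j)$ and $\ell^{H_a\setminus G_{\iota(a)}}\eta_{\iota(a)}$ $(1\le a\le h)$. Choose $i$ with $G_i\subseteq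 E$ and put $\epsilon_{\mathcal N}=\ell^{E\setminus G_i}\overline{\eta_i}\in F_{\mathcal N}/Z_{\mathcal N}$ (independent of the choices). $J_{\mathcal N}^{\mathrm{amb}}=\operatorname{Ann}_{S_0}(\epsilon_{\mathcal N})$, $J_{\mathcal N}^{\mathrm{intr}}=\langle\ell^{H_1},\dots,\ell^{H_h}\rangle:\ell^E$. Pairing. For $f\in\mathbb C[s]$, $q(\partial_s)\in\mathbb C[\partial_{s_1},\dots,\partial_{s_r}]$: $\langle f,q(\partial_s)\rangle_s=(q(\partial_s)f)|_{s=0}$. For a subspace $W\subseteq S_{0,i}$, $W^\perp\subseteq\mathbb C[\partial_s]_i$ is its orthogonal complement; $V^{\mathrm{amb}}_{\mathcal N,i}=(J_{\mathcal N}^{\mathrm{amb}})_i^\perp$, $V^{\mathrm{intr}}_{\mathcal N,i}=(J_{\mathcal N}^{\mathrm{intr}})_i^\perp$. For a homogeneous ideal $I\subseteq\mathbb C[s]$, $I^\perp=\{q(\partial_s)\mid\langle f,q(\partial_s)\rangle_s=0\ \forall f\in I\}$. Coefficient spaces (for $\mathcal N$ ordered). The ambient coefficient space at $v$ for $\mathcal N$ (the coefficients of $x^v$ obtained by the Okuyama–Saito ambient perturbation) is the full coefficient space: all polynomials $p_0(\log x)$ for which there is a formal series $\sum_{u\in L}x^{v+u}p_u(\log x)$, $p_u\in\mathbb C[y_1,\dots,y_n]$, annihilated by $H_A(\beta)$, with $I_u\in\mathcal N$ whenever $p_u\ne0$. For the intrinsic one, put $m_{v,\mathcal N}(s)=\ell^{E}$,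 $a_u(s)=[v+Bs]_{u_-}/[v+Bs+u]_{u_+}$ and $\Psi_{\mathcal N}(x,s)=m_{v,\mathcal N}(s)\sum_{u\in L,\,I_u\in\mathcal N}a_u(s)x^{v+Bs+u}$; the intrinsic coefficient space at $v$ for $\mathcal N$ is the space of coefficients of $x^v$ in the series $q(\partial_s)\Psi_{\mathcal N}(x,s)|_{s=0}$ with $q\in\langle\ell^{H_1},\dots,\ell^{H_h}\rangle^\perp$. *)

theory Defs
  imports "HOL-Analysis.Analysis" "HOL-Library.Poly_Mapping" "HOL-Library.FuncSet"
begin

section \<open>Polynomials, submodules and initial forms\<close>

type_synonym 'k mono = "'k \<Rightarrow>\<^sub>0 nat"
type_synonym 'k cpoly = "('k \<Rightarrow>\<^sub>0 nat) \<Rightarrow>\<^sub>0 complex"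

abbreviation coef :: "('k \<Rightarrow>\<^sub>0 'a::zero) \<Rightarrow> 'k \<Rightarrow> 'a"
  where "coef \<equiv> Poly_Mapping.lookup"

abbreviation supp :: "('k \<Rightarrow>\<^sub>0 'a::zero) \<Rightarrow> 'k set"
  where "supp \<equiv> Poly_Mapping.keys"

abbreviation monom1 :: "'k \<Rightarrow> 'a \<Rightarrow> 'k \<Rightarrow>\<^sub>0 'a::zero"
  where "monom1 \<equiv> Poly_Mapping.single"

definition Const :: "'a::zero \<Rightarrow> ('k mono) \<Rightarrow>\<^sub>0 'a"
  where "Const c = monom1 0 c"

definition Var :: "'k \<Rightarrow> ('k mono) \<Rightarrow>\<^sub>0 'a::zero_neq_one"
  where "Var j = monom1 (monom1 j 1) 1"

definition tdeg :: "'k mono \<Rightarrow> nat"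
  where "tdeg m = (\<Sum>j\<in>supp m. coef m j)"

definition homog :: "nat \<Rightarrow> 'k cpoly \<Rightarrow> bool"
  where "homog i f \<longleftrightarrow> (\<forall>m\<in>supp f. tdeg m = i)"

definition degree_part :: "nat \<Rightarrow> 'k cpoly set \<Rightarrow> 'k cpoly set"
  where "degree_part i M = {f \<in> M. homog i f}"

text \<open>Submodules of an additive group on which a set \<open>R\<close> of scalars acts from the left by \<open>scl\<close>.
  With \<open>scl = (*)\<close> these are the ideals of \<open>R\<close> (when contained in \<open>R\<close>); with the product of the
  Weyl algebra they are its left ideals.\<close>

definition is_submodule :: "'a set \<Rightarrow> ('a \<Rightarrow> 'm \<Rightarrow> 'm) \<Rightarrow> 'm::ab_group_add set \<Rightarrow> bool"
  where "is_submodule R scl M \<longleftrightarrow>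
    0 \<in> M \<and> (\<forall>x\<in>M. \<forall>y\<in>M. x + y \<in> M) \<and> (\<forall>a\<in>R. \<forall>x\<in>M. scl a x \<in> M)"

definition generated_by :: "'a set \<Rightarrow> ('a \<Rightarrow> 'm \<Rightarrow> 'm) \<Rightarrow> 'm::ab_group_add set \<Rightarrow> 'm set"
  where "generated_by R scl G = (is_submodule R scl) hull G"

text \<open>Sum of the terms of largest weight (and \<open>0\<close> for \<open>f = 0\<close>).\<close>

definition initial_form :: "('k \<Rightarrow> real) \<Rightarrow> ('k \<Rightarrow>\<^sub>0 complex) \<Rightarrow> ('k \<Rightarrow>\<^sub>0 complex)"
  where "initial_form wt f =
    (\<Sum>m \<in> {m \<in> supp f. wt m = Max (wt ` supp f)}. monom1 m (coef f m))"

text \<open>\<open>[z]\<^sub>p = \<Prod>\<^sub>j z\<^sub>j (z\<^sub>j - 1) \<cdots> (z\<^sub>j - p\<^sub>j + 1)\<close>, with \<open>z\<^sub>j\<close> in any commutative ring.\<close>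

definition bracket :: "('k \<Rightarrow> 'a::comm_ring_1) \<Rightarrow> 'k mono \<Rightarrow> 'a"
  where "bracket z p = (\<Prod>j\<in>supp p. \<Prod>i<coef p j. z j - of_nat i)"

text \<open>The action of constant-coefficient differential operators on polynomials, determined by
  \<open>\<partial>\<^sup>m s\<^sup>k = [k]\<^sub>m s\<^sup>k\<^sup>-\<^sup>m\<close>; the truncated subtraction is harmless because \<open>[k]\<^sub>m = 0\<close>
  unless \<open>m \<le> k\<close> componentwise. The operator \<open>q(\<partial>)\<close> is represented by the polynomial \<open>q\<close>.\<close>

definition diff_mono :: "'k mono \<Rightarrow> 'k cpoly \<Rightarrow> 'k cpoly"
  where "diff_mono m f =
    (\<Sum>k\<in>supp f. monom1 (k - m) (bracket (\<lambda>j. of_nat (coef k j)) m * coef f k))"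

definition diff_op :: "'k cpoly \<Rightarrow> 'k cpoly \<Rightarrow> 'k cpoly"
  where "diff_op q f = (\<Sum>m\<in>supp q. Const (coef q m) * diff_mono m f)"

text \<open>\<open>\<langle>f, q(\<partial>)\<rangle>\<close>; the value of a polynomial at \<open>0\<close> is its constant coefficient.\<close>

definition pairing :: "'k cpoly \<Rightarrow> 'k cpoly \<Rightarrow> complex"
  where "pairing f q = coef (diff_op q f) 0"


section \<open>Quotients of vector spaces of polynomials and perfect pairings\<close>

definition coset :: "'k cpoly set \<Rightarrow> 'k cpoly \<Rightarrow> 'k cpoly set"
  where "coset W x = (+) x ` W"

definition quotient_space :: "'k cpoly set \<Rightarrow> 'k cpoly set \<Rightarrow> 'k cpoly set set"
  where "quotient_space U W = coset W ` U"

definition quotient_dual :: "'k cpoly set \<Rightarrow> 'k cpoly set \<Rightarrow> ('k cpoly set \<Rightarrow> complex) set"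
  where "quotient_dual U W = {\<phi> \<in> extensional (quotient_space U W).
    (\<forall>x\<in>U. \<forall>y\<in>U. \<phi> (coset W (x + y)) = \<phi> (coset W x) + \<phi> (coset W y)) \<and>
    (\<forall>c. \<forall>x\<in>U. \<phi> (coset W (Const c * x)) = c * \<phi> (coset W x))}"

text \<open>The bilinear form \<open>b\<close> on \<open>U \<times> X\<close> descends to \<open>U/W \<times> X/Y\<close>, and both maps from one
  quotient to the dual of the other are bijective.\<close>

definition induces_perfect_pairing ::
    "('k cpoly \<Rightarrow> 'l cpoly \<Rightarrow> complex) \<Rightarrow> 'k cpoly set \<Rightarrow> 'k cpoly set \<Rightarrow>
     'l cpoly set \<Rightarrow> 'l cpoly set \<Rightarrow> bool"
  where "induces_perfect_pairing b U W X Y \<longleftrightarrow> W \<subseteq> U \<and> Y \<subseteq> X \<and>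
    (\<exists>b'. (\<forall>x\<in>U. \<forall>y\<in>X. b' (coset W x) (coset Y y) = b x y) \<and>
      bij_betw (\<lambda>\<alpha>. restrict (b' \<alpha>) (quotient_space X Y))
        (quotient_space U W) (quotient_dual X Y) \<and>
      bij_betw (\<lambda>\<xi>. restrict (\<lambda>\<alpha>. b' \<alpha> \<xi>) (quotient_space U W))
        (quotient_space X Y) (quotient_dual U W))"

definition quotient_iso_dual ::
    "'k cpoly set \<Rightarrow> 'k cpoly set \<Rightarrow> 'l cpoly set \<Rightarrow> 'l cpoly set \<Rightarrow> bool"
  where "quotient_iso_dual U W X Y \<longleftrightarrow>
    (\<exists>T. bij_betw T (quotient_space U W) (quotient_dual X Y) \<and>
      (\<forall>x\<in>U. \<forall>y\<in>U. \<forall>\<xi>\<in>quotient_space X Y.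
        T (coset W (x + y)) \<xi> = T (coset W x) \<xi> + T (coset W y) \<xi>) \<and>
      (\<forall>c. \<forall>x\<in>U. \<forall>\<xi>\<in>quotient_space X Y. T (coset W (Const c * x)) \<xi> = c * T (coset W x) \<xi>))"


section \<open>The hypergeometric system\<close>

definition homogeneous_matrix :: "int ^ 'n ^ 'd \<Rightarrow> bool"
  where "homogeneous_matrix A \<longleftrightarrow>
    (let A' = (\<chi> i j. real_of_int (A $ i $ j)) :: real ^ 'n ^ 'd in
      rank A' = CARD('d) \<and>
      (\<exists>h b. h \<noteq> 0 \<and> b \<noteq> 0 \<and> (\<forall>j. h \<bullet> column j A' = b)))"

definition ker_lattice :: "int ^ 'n ^ 'd \<Rightarrow> (int ^ 'n) set"
  where "ker_lattice A = {u. A *v u = 0}"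

definition pos_part :: "int ^ 'n \<Rightarrow> 'n mono"
  where "pos_part u = Abs_poly_mapping (\<lambda>j. nat (u $ j))"

definition neg_part :: "int ^ 'n \<Rightarrow> 'n mono"
  where "neg_part u = pos_part (- u)"

definition toric_ideal :: "int ^ 'n ^ 'd \<Rightarrow> 'n cpoly set"
  where "toric_ideal A = generated_by UNIV (*)
    {monom1 (pos_part u) 1 - monom1 (neg_part u) 1 | u. u \<in> ker_lattice A}"

definition weight :: "real ^ 'n \<Rightarrow> 'n mono \<Rightarrow> real"
  where "weight w p = (\<Sum>j\<in>UNIV. w $ j * real (coef p j))"

definition initial_ideal :: "real ^ 'n \<Rightarrow> 'n cpoly set \<Rightarrow> 'n cpoly set"
  where "initial_ideal w I = generated_by UNIV (*) (initial_form (weight w) ` I)"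

definition is_monomial_ideal :: "'n cpoly set \<Rightarrow> bool"
  where "is_monomial_ideal I \<longleftrightarrow> (\<exists>M. I = generated_by UNIV (*) ((\<lambda>p. monom1 p 1) ` M))"

text \<open>Elements of the Weyl algebra in normal form \<open>\<Sum> c\<^sub>a\<^sub>b x\<^sup>a \<partial>\<^sup>b\<close>, as coefficient families indexed
  by \<open>(a, b)\<close>. The product is the bilinear extension of
  \<open>\<partial>\<^sup>b x\<^sup>a = \<Sum>\<^sub>k k! binom(b,k) binom(a,k) x\<^sup>a\<^sup>-\<^sup>k \<partial>\<^sup>b\<^sup>-\<^sup>k\<close> (multi-index notation). The
  multiplication that type class instances provide on this type is the commutative one and is not
  used.\<close>

type_synonym 'n weyl = "('n mono \<times> 'n mono) \<Rightarrow>\<^sub>0 complex"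

definition weyl_mult :: "'n weyl \<Rightarrow> 'n weyl \<Rightarrow> 'n weyl"
  where "weyl_mult P Q =
    (\<Sum>(a, b)\<in>supp P. \<Sum>(a', b')\<in>supp Q.
      \<Sum>k \<in> {k. \<forall>j. coef k j \<le> coef b j \<and> coef k j \<le> coef a' j}.
        monom1 (a + (a' - k), (b - k) + b')
          (coef P (a, b) * coef Q (a', b') *
            of_nat (\<Prod>j\<in>supp k. fact (coef k j) * (coef b j choose coef k j) *
              (coef a' j choose coef k j))))"

definition left_ideal_by :: "'n weyl set \<Rightarrow> 'n weyl set"
  where "left_ideal_by G = generated_by UNIV weyl_mult G"

definition weyl_of_partial :: "'n cpoly \<Rightarrow> 'n weyl"
  where "weyl_of_partial f = (\<Sum>p\<in>supp f. monom1 (0, p) (coef f p))"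

definition euler_op :: "int ^ 'n ^ 'd \<Rightarrow> complex ^ 'd \<Rightarrow> 'd \<Rightarrow> 'n weyl"
  where "euler_op A \<beta> i =
    (\<Sum>j\<in>UNIV. monom1 (monom1 j 1, monom1 j 1) (of_int (A $ i $ j))) - monom1 (0, 0) (\<beta> $ i)"

definition hypergeometric_ideal :: "int ^ 'n ^ 'd \<Rightarrow> complex ^ 'd \<Rightarrow> 'n weyl set"
  where "hypergeometric_ideal A \<beta> =
    left_ideal_by (weyl_of_partial ` toric_ideal A \<union> range (euler_op A \<beta>))"

definition weyl_weight :: "real ^ 'n \<Rightarrow> 'n mono \<times> 'n mono \<Rightarrow> real"
  where "weyl_weight w = (\<lambda>(a, b). weight (- w) a + weight w b)"

definition weyl_initial_ideal :: "real ^ 'n \<Rightarrow> 'n weyl set \<Rightarrow> 'n weyl set"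
  where "weyl_initial_ideal w J = left_ideal_by (initial_form (weyl_weight w) ` J)"

text \<open>The small Groebner fan of \<open>J\<close> subdivides the weight space according to the initial ideal
  with respect to \<open>(-w, w)\<close>. A weight is in the interior of a full-dimensional cone iff it is an
  interior point of its own cell.\<close>

definition small_groebner_cell :: "'n weyl set \<Rightarrow> real ^ 'n \<Rightarrow> (real ^ 'n) set"
  where "small_groebner_cell J w = {w'. weyl_initial_ideal w' J = weyl_initial_ideal w J}"

definition generic_direction :: "int ^ 'n ^ 'd \<Rightarrow> complex ^ 'd \<Rightarrow> real ^ 'n \<Rightarrow> bool"
  where "generic_direction A \<beta> w \<longleftrightarrow>
    is_monomial_ideal (initial_ideal w (toric_ideal A)) \<and>
    w \<in> interior (small_groebner_cell (hypergeometric_ideal A \<beta>) w)"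

definition fake_exponent ::
    "int ^ 'n ^ 'd \<Rightarrow> complex ^ 'd \<Rightarrow> real ^ 'n \<Rightarrow> complex ^ 'n \<Rightarrow> bool"
  where "fake_exponent A \<beta> w v \<longleftrightarrow>
    (\<forall>i. (\<Sum>j\<in>UNIV. of_int (A $ i $ j) * v $ j) = \<beta> $ i) \<and>
    (\<forall>p. monom1 p 1 \<in> initial_ideal w (toric_ideal A) \<longrightarrow> bracket (\<lambda>j. v $ j) p = 0)"


section \<open>Negative supports\<close>

definition shift :: "complex ^ 'n \<Rightarrow> int ^ 'n \<Rightarrow> complex ^ 'n"
  where "shift v u = (\<chi> j. v $ j + of_int (u $ j))"

definition nsupp :: "complex ^ 'n \<Rightarrow> 'n set"
  where "nsupp z = {j. \<exists>k::int. k < 0 \<and> z $ j = of_int k}"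

definition nsupps :: "int ^ 'n ^ 'd \<Rightarrow> complex ^ 'n \<Rightarrow> 'n set set"
  where "nsupps A v = {nsupp (shift v u) | u. u \<in> ker_lattice A}"

definition nonneg_nsupps :: "int ^ 'n ^ 'd \<Rightarrow> real ^ 'n \<Rightarrow> complex ^ 'n \<Rightarrow> 'n set set"
  where "nonneg_nsupps A w v = {I \<in> nsupps A v.
    \<forall>u\<in>ker_lattice A. nsupp (shift v u) = I \<longrightarrow> 0 \<le> (\<Sum>j\<in>UNIV. w $ j * real_of_int (u $ j))}"

definition negative_support_family ::
    "int ^ 'n ^ 'd \<Rightarrow> real ^ 'n \<Rightarrow> complex ^ 'n \<Rightarrow> 'n set set \<Rightarrow> bool"
  where "negative_support_family A w v N \<longleftrightarrow> nsupp v \<in> N \<and> N \<subseteq> nonneg_nsupps A w v"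

definition ordered_family :: "int ^ 'n ^ 'd \<Rightarrow> complex ^ 'n \<Rightarrow> 'n set set \<Rightarrow> bool"
  where "ordered_family A v N \<longleftrightarrow> (\<forall>I\<in>N. \<forall>J\<in>nsupps A v. J \<subseteq> I \<longrightarrow> J \<in> N)"

definition minimal_members :: "'a set set \<Rightarrow> 'a set set"
  where "minimal_members F = {X \<in> F. \<forall>Y\<in>F. Y \<subseteq> X \<longrightarrow> Y = X}"

definition Gsets :: "'n set set \<Rightarrow> 'n set set"
  where "Gsets N = minimal_members {I - \<Inter>N | I. I \<in> N}"

definition Hsets :: "int ^ 'n ^ 'd \<Rightarrow> complex ^ 'n \<Rightarrow> 'n set set \<Rightarrow> 'n set set"
  where "Hsets A v N = minimal_members {(I \<union> J) - \<Inter>N | I J. I \<in> N \<and> J \<in> nsupps A v - N}"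

definition Eset :: "complex ^ 'n \<Rightarrow> 'n set set \<Rightarrow> 'n set"
  where "Eset v N = nsupp v - \<Inter>N"


section \<open>The two ideals\<close>

text \<open>The rank \<open>r\<close> of the lattice may be \<open>0\<close>, so the columns of a Gale dual and the variables
  \<open>s\<close> are indexed by the numbers below \<open>r\<close> instead of a type. \<open>B k\<close> is the \<open>k\<close>-th column, and
  \<open>Sring r\<close> is the polynomial ring in the variables with index below \<open>r\<close>.\<close>

definition gale_dual :: "int ^ 'n ^ 'd \<Rightarrow> nat \<Rightarrow> (nat \<Rightarrow> int ^ 'n) \<Rightarrow> bool"
  where "gale_dual A r B \<longleftrightarrow> r = CARD('n) - CARD('d) \<and> inj_on B {..<r} \<and>
    \<not> module.dependent (*s) (B ` {..<r}) \<and> module.span (*s) (B ` {..<r}) = ker_lattice A"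

definition Sring :: "nat \<Rightarrow> nat cpoly set"
  where "Sring r = {f. \<forall>m\<in>supp f. supp m \<subseteq> {..<r}}"

definition ell :: "nat \<Rightarrow> (nat \<Rightarrow> int ^ 'n) \<Rightarrow> 'n \<Rightarrow> nat cpoly"
  where "ell r B j = (\<Sum>k<r. Const (of_int (B k $ j)) * Var k)"

definition ellp :: "nat \<Rightarrow> (nat \<Rightarrow> int ^ 'n) \<Rightarrow> 'n set \<Rightarrow> nat cpoly"
  where "ellp r B Y = (\<Prod>j\<in>Y. ell r B j)"

text \<open>The free module has one basis vector for each set \<open>G\<close> in \<open>Gsets N\<close>, and its elements are
  finitely supported families of polynomials indexed by these sets. \<open>eta G f\<close> is \<open>f\<close> times the
  basis vector of \<open>G\<close>. The degree shifts play no role for annihilators.\<close>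

abbreviation eta :: "'n set \<Rightarrow> nat cpoly \<Rightarrow> 'n set \<Rightarrow>\<^sub>0 nat cpoly"
  where "eta \<equiv> Poly_Mapping.single"

definition free_scale :: "nat cpoly \<Rightarrow> ('n set \<Rightarrow>\<^sub>0 nat cpoly) \<Rightarrow> ('n set \<Rightarrow>\<^sub>0 nat cpoly)"
  where "free_scale f x = Poly_Mapping.map ((*) f) x"

text \<open>\<open>\<iota>\<close> is the choice of a member of \<open>Gsets N\<close> below each member of \<open>Hsets A v N\<close>. The first
  family of generators is listed for all ordered pairs, which only repeats generators up to sign.\<close>

definition Zmod :: "int ^ 'n ^ 'd \<Rightarrow> nat \<Rightarrow> (nat \<Rightarrow> int ^ 'n) \<Rightarrow> complex ^ 'n \<Rightarrow> 'n set set \<Rightarrow>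
    ('n set \<Rightarrow> 'n set) \<Rightarrow> ('n set \<Rightarrow>\<^sub>0 nat cpoly) set"
  where "Zmod A r B v N \<iota> = generated_by (Sring r) free_scale
    ({eta G (ellp r B (G' - G)) - eta G' (ellp r B (G - G')) | G G'. G \<in> Gsets N \<and> G' \<in> Gsets N} \<union>
     {eta (\<iota> H) (ellp r B (H - \<iota> H)) | H. H \<in> Hsets A v N})"

text \<open>The annihilator of the class of \<open>eta G (ellp r B (E - G))\<close> modulo \<open>Zmod\<close>, for a choice of
  \<open>G\<close> in \<open>Gsets N\<close> with \<open>G \<subseteq> E\<close>.\<close>

definition J_amb :: "int ^ 'n ^ 'd \<Rightarrow> nat \<Rightarrow> (nat \<Rightarrow> int ^ 'n) \<Rightarrow> complex ^ 'n \<Rightarrow> 'n set set \<Rightarrow>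
    ('n set \<Rightarrow> 'n set) \<Rightarrow> 'n set \<Rightarrow> nat cpoly set"
  where "J_amb A r B v N \<iota> G = {f \<in> Sring r.
    free_scale f (eta G (ellp r B (Eset v N - G))) \<in> Zmod A r B v N \<iota>}"

definition ellH_ideal ::
    "int ^ 'n ^ 'd \<Rightarrow> nat \<Rightarrow> (nat \<Rightarrow> int ^ 'n) \<Rightarrow> complex ^ 'n \<Rightarrow> 'n set set \<Rightarrow> nat cpoly set"
  where "ellH_ideal A r B v N = generated_by (Sring r) (*) (ellp r B ` Hsets A v N)"

definition J_intr ::
    "int ^ 'n ^ 'd \<Rightarrow> nat \<Rightarrow> (nat \<Rightarrow> int ^ 'n) \<Rightarrow> complex ^ 'n \<Rightarrow> 'n set set \<Rightarrow> nat cpoly set"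
  where "J_intr A r B v N = {f \<in> Sring r. f * ellp r B (Eset v N) \<in> ellH_ideal A r B v N}"

definition perp :: "nat \<Rightarrow> nat cpoly set \<Rightarrow> nat cpoly set"
  where "perp r I = {q \<in> Sring r. \<forall>f\<in>I. pairing f q = 0}"

text \<open>Orthogonal complement, within the operators of degree \<open>i\<close>, of a space of forms of degree
  \<open>i\<close>.\<close>

definition perp_deg :: "nat \<Rightarrow> nat \<Rightarrow> nat cpoly set \<Rightarrow> nat cpoly set"
  where "perp_deg r i W = {q \<in> degree_part i (Sring r). \<forall>f\<in>W. pairing f q = 0}"

definition V_amb :: "int ^ 'n ^ 'd \<Rightarrow> nat \<Rightarrow> (nat \<Rightarrow> int ^ 'n) \<Rightarrow> complex ^ 'n \<Rightarrow> 'n set set \<Rightarrow>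
    ('n set \<Rightarrow> 'n set) \<Rightarrow> 'n set \<Rightarrow> nat \<Rightarrow> nat cpoly set"
  where "V_amb A r B v N \<iota> G i = perp_deg r i (degree_part i (J_amb A r B v N \<iota> G))"

definition V_intr :: "int ^ 'n ^ 'd \<Rightarrow> nat \<Rightarrow> (nat \<Rightarrow> int ^ 'n) \<Rightarrow> complex ^ 'n \<Rightarrow> 'n set set \<Rightarrow>
    nat \<Rightarrow> nat cpoly set"
  where "V_intr A r B v N i = perp_deg r i (degree_part i (J_intr A r B v N))"


section \<open>Coefficient spaces\<close>

text \<open>A family \<open>\<phi>\<close> stands for the formal series \<open>\<Sum>\<^sub>u x\<^sup>v\<^sup>+\<^sup>u \<phi>\<^sub>u(log x)\<close> over all integer vectors \<open>u\<close>;
  the variables of \<open>\<phi>\<^sub>u\<close> are \<open>y\<^sub>j = log x\<^sub>j\<close>. Since \<open>\<partial>\<^sup>b (x\<^sup>z p(log x)) = x\<^sup>z\<^sup>-\<^sup>b ([z + \<partial>\<^sub>y]\<^sub>b p)(log x)\<close>,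
  the term \<open>x\<^sup>a \<partial>\<^sup>b\<close> contributes to \<open>x\<^sup>v\<^sup>+\<^sup>u\<close> through \<open>\<phi>\<close> at \<open>u - a + b\<close>.\<close>

type_synonym 'n log_series = "int ^ 'n \<Rightarrow> 'n cpoly"

definition weyl_act :: "complex ^ 'n \<Rightarrow> 'n weyl \<Rightarrow> 'n log_series \<Rightarrow> 'n log_series"
  where "weyl_act v P \<phi> u = (\<Sum>(a, b)\<in>supp P.
    let u' = (\<chi> j. u $ j - int (coef a j) + int (coef b j)) in
      Const (coef P (a, b)) * diff_op (bracket (\<lambda>j. Const (shift v u' $ j) + Var j) b) (\<phi> u'))"

definition ambient_coeff_space ::
    "int ^ 'n ^ 'd \<Rightarrow> complex ^ 'd \<Rightarrow> complex ^ 'n \<Rightarrow> 'n set set \<Rightarrow> 'n cpoly set"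
  where "ambient_coeff_space A \<beta> v N = {\<phi> 0 | \<phi>.
    (\<forall>u. \<phi> u \<noteq> 0 \<longrightarrow> u \<in> ker_lattice A \<and> nsupp (shift v u) \<in> N) \<and>
    (\<forall>P\<in>hypergeometric_ideal A \<beta>. \<forall>u. weyl_act v P \<phi> u = 0)}"

text \<open>A formal power series in \<open>s\<close> is the function giving its coefficients; \<open>prod_fun\<close> is then the
  product. \<open>at_zero q \<Phi>\<close> is \<open>q(\<partial>\<^sub>s) \<Phi>\<close> at \<open>s = 0\<close>, where \<open>\<Phi>\<close> has coefficients in \<open>\<complex>[y]\<close>: the value of
  \<open>\<partial>\<^sup>m \<Phi>\<close> at \<open>0\<close> is \<open>m! \<Phi>\<^sub>m\<close>.\<close>

definition at_zero :: "nat cpoly \<Rightarrow> (nat mono \<Rightarrow> 'n cpoly) \<Rightarrow> 'n cpoly"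
  where "at_zero q \<Phi> =
    (\<Sum>m\<in>supp q. Const (coef q m * (\<Prod>i\<in>supp m. fact (coef m i))) * \<Phi> m)"

text \<open>\<open>\<Sum>\<^sub>j (Bs)\<^sub>j y\<^sub>j\<close> as a polynomial in \<open>s\<close> over \<open>\<complex>[y]\<close>, and the coefficients in \<open>s\<close> of its
  exponential. Its powers beyond \<open>tdeg m\<close> do not contribute to the coefficient of \<open>s\<^sup>m\<close>.\<close>

definition log_form :: "nat \<Rightarrow> (nat \<Rightarrow> int ^ 'n) \<Rightarrow> (nat mono) \<Rightarrow>\<^sub>0 'n cpoly"
  where "log_form r B = (\<Sum>j\<in>UNIV. \<Sum>k<r. Const (Const (of_int (B k $ j)) * Var j) * Var k)"

definition exp_series :: "nat \<Rightarrow> (nat \<Rightarrow> int ^ 'n) \<Rightarrow> nat mono \<Rightarrow> 'n cpoly"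
  where "exp_series r B m = (\<Sum>t\<le>tdeg m. Const (1 / fact t) * coef (log_form r B ^ t) m)"

text \<open>The identification of \<open>q(\<partial>\<^sub>s)\<close> with a polynomial in \<open>log x\<close>.\<close>

definition log_poly :: "nat \<Rightarrow> (nat \<Rightarrow> int ^ 'n) \<Rightarrow> nat cpoly \<Rightarrow> 'n cpoly"
  where "log_poly r B q = at_zero q (exp_series r B)"

definition shifted_bracket ::
    "nat \<Rightarrow> (nat \<Rightarrow> int ^ 'n) \<Rightarrow> complex ^ 'n \<Rightarrow> 'n mono \<Rightarrow> nat cpoly"
  where "shifted_bracket r B z p = bracket (\<lambda>j. Const (z $ j) + ell r B j) p"

text \<open>The Taylor expansion at \<open>s = 0\<close> of \<open>\<ell>\<^sup>E [v+Bs]\<^bsub>u-\<^esub> / [v+Bs+u]\<^bsub>u+\<^esub>\<close>. For \<open>u\<close> in the lattice with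
  \<open>I\<^sub>u \<in> N\<close> the poles of \<open>a\<^sub>u\<close> at \<open>s = 0\<close> cancel against \<open>\<ell>\<^sup>E\<close>, and the quotient is the unique power
  series solving the equation.\<close>

definition ma_series :: "nat \<Rightarrow> (nat \<Rightarrow> int ^ 'n) \<Rightarrow> complex ^ 'n \<Rightarrow> 'n set set \<Rightarrow> int ^ 'n \<Rightarrow>
    nat mono \<Rightarrow> complex"
  where "ma_series r B v N u = (THE c.
    prod_fun (coef (shifted_bracket r B (shift v u) (pos_part u))) c =
      coef (ellp r B (Eset v N) * shifted_bracket r B v (neg_part u)))"

text \<open>The coefficient of \<open>x\<^sup>v\<^sup>+\<^sup>u\<close> in \<open>\<Psi>(x,s)\<close>, using
  \<open>x\<^sup>v\<^sup>+\<^sup>B\<^sup>s\<^sup>+\<^sup>u = x\<^sup>v\<^sup>+\<^sup>u exp(\<Sum>\<^sub>j (Bs)\<^sub>j log x\<^sub>j)\<close>.\<close>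

definition Psi :: "int ^ 'n ^ 'd \<Rightarrow> nat \<Rightarrow> (nat \<Rightarrow> int ^ 'n) \<Rightarrow> complex ^ 'n \<Rightarrow> 'n set set \<Rightarrow>
    int ^ 'n \<Rightarrow> nat mono \<Rightarrow> 'n cpoly"
  where "Psi A r B v N u =
    (if u \<in> ker_lattice A \<and> nsupp (shift v u) \<in> N
     then prod_fun (\<lambda>m. Const (ma_series r B v N u m)) (exp_series r B)
     else (\<lambda>m. 0))"

definition intrinsic_series :: "int ^ 'n ^ 'd \<Rightarrow> nat \<Rightarrow> (nat \<Rightarrow> int ^ 'n) \<Rightarrow> complex ^ 'n \<Rightarrow>
    'n set set \<Rightarrow> nat cpoly \<Rightarrow> 'n log_series"
  where "intrinsic_series A r B v N q u = at_zero q (Psi A r B v N u)"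

definition intrinsic_coeff_space :: "int ^ 'n ^ 'd \<Rightarrow> nat \<Rightarrow> (nat \<Rightarrow> int ^ 'n) \<Rightarrow> complex ^ 'n \<Rightarrow>
    'n set set \<Rightarrow> 'n cpoly set"
  where "intrinsic_coeff_space A r B v N =
    {intrinsic_series A r B v N q 0 | q. q \<in> perp r (ellH_ideal A r B v N)}"

end

theory Submission
  imports Defs
begin

text \<open>Let polynomials act on polynomials in dual variables as differential operators; this action is
  transpose to multiplication for the pairing. Sending the basis vector of \<open>G\<close> to \<open>\<ell>\<^sup>G\<close> maps the
  relations \<open>Z\<close> into \<open>\<langle>\<ell>\<^sup>H\<rangle>\<close> and \<open>\<epsilon>\<close> to \<open>\<ell>\<^sup>E\<close>, which gives the inclusion of the ideals, and the
  perfect pairing is biorthogonality in the space of forms of one degree.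

  For the coefficient spaces, \<open>q \<mapsto> log_poly q\<close> is transpose to \<open>y\<^sub>j \<mapsto> \<ell>\<^sub>j\<close>, and its image consists of the
  polynomials killed by the Euler operators. The toric equations between the coefficients of
  \<open>x\<^sup>v\<^sup>+\<^sup>a\<close> and \<open>x\<^sup>v\<^sup>+\<^sup>b\<close> read \<open>\<partial>\<^sup>Y p\<^sub>b = \<partial>\<^sup>X p\<^sub>a\<close> with \<open>Y = I\<^sub>a - I\<^sub>b\<close>, \<open>X = I\<^sub>b - I\<^sub>a\<close>, up to
  operators \<open>c + \<partial>\<^sub>j\<close> with \<open>c \<noteq> 0\<close>, which are invertible on polynomials and satisfy a cocycle
  identity. After absorbing these units a solution is a family indexed by negative supports, that is,
  a homomorphism from \<open>F/Z\<close> to the module of polynomials, evaluated at \<open>\<epsilon>\<close>. By duality such values are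
  exactly the forms orthogonal to the annihilator of \<open>\<epsilon>\<close>; the same duality for the ideal
  \<open>\<langle>\<ell>\<^sup>H\<rangle>\<close> and \<open>\<ell>\<^sup>E\<close> describes the intrinsic space.\<close>

section \<open>Polynomials and the apolar pairing\<close>

text \<open>The duality argument needs finite dimension, while the toric equations link infinitely
  many coefficients and the module of relations is infinite-dimensional. Two reductions repair this.
  The units record how far \<open>v + u\<close> has moved; once they are absorbed, the normalised
  coefficient depends on \<open>u\<close> only through the negative support I_u, so finitely many
  unknowns remain. Giving the basis vector of \<open>G\<close> the degree \<open>card G\<close>
  makes all relations homogeneous, so that an orthogonality condition in degree \<open>i\<close>
  involves only finitely many monomial coordinates.

  The sets \<open>H\<close> encode the boundary of \<open>N\<close>. The coefficient of a support
  \<open>J\<close> outside \<open>N\<close> is 0, so its relation with \<open>I\<close> in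
  \<open>N\<close> degenerates to the condition that ell^(J - I) kills the coefficient of
  \<open>I\<close>. Only differences of supports occur in the relations; hence the common part
  \<open>\<Inter>N\<close> can be removed, and a family on \<open>N\<close> is determined by its
  values at the supports coming from the sets \<open>G\<close>.\<close>

lemma coef_monom1_mult_add:
  fixes p :: "('k mono) \<Rightarrow>\<^sub>0 'a::comm_semiring_1"
  shows "coef (monom1 m c * p) (m + k) = c * coef p k"
proof -
  have "coef (monom1 m c * p) (m + k)
      = (\<Sum>l. coef (monom1 m c) l * (\<Sum>q. coef p q when m + k = l + q))"
    by (simp add: lookup_mult)
  also have "\<dots> = (\<Sum>l. (c * (\<Sum>q. coef p q when m + k = l + q)) when l = m)"
    by (rule arg_cong[where f = Sum_any], rule ext) (auto simp: lookup_single when_def)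
  also have "\<dots> = c * (\<Sum>q. coef p q when m + k = m + q)"
    by simp
  also have "(\<Sum>q. coef p q when m + k = m + q) = (\<Sum>q. coef p q when q = k)"
    by (rule arg_cong[where f = Sum_any], rule ext) (auto simp: when_def)
  finally show ?thesis by simp
qed

lemma coef_monom1_mult_outside:
  fixes p :: "('k mono) \<Rightarrow>\<^sub>0 'a::comm_semiring_1"
  assumes "\<And>k. n \<noteq> m + k"
  shows "coef (monom1 m c * p) n = 0"
proof -
  have "n \<notin> supp (monom1 m c * p)"
  proof
    assume "n \<in> supp (monom1 m c * p)"
    then obtain a b where "n = a + b" "a \<in> supp (monom1 m c)"
      using keys_mult[of "monom1 m c" p] by blast
    then show False using assms[of b] by (simp split: if_splits)
  qed
  then show ?thesis
    by (simp add: in_keys_iff)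
qed

lemma mono_le_iff: "(\<exists>k. n = m + k) \<longleftrightarrow> (\<forall>j. coef m j \<le> coef n j)" for m n :: "'k mono"
proof
  assume "\<forall>j. coef m j \<le> coef n j"
  then have "n = m + (n - m)"
    by (intro poly_mapping_eqI) (simp add: lookup_add lookup_minus)
  then show "\<exists>k. n = m + k" ..
qed (auto simp: lookup_add)

lemma coef_Const_mult [simp]: "coef (Const c * p) k = c * coef p k"
  for p :: "('k mono) \<Rightarrow>\<^sub>0 'a::comm_semiring_1"
  using coef_monom1_mult_add[of 0 c p k] by (simp add: Const_def)

lemma Const_0 [simp]: "Const 0 = 0" and Const_1 [simp]: "Const 1 = 1"
  by (simp_all add: Const_def)

lemma Const_add: "Const (a + b) = Const a + Const b"
  by (simp add: Const_def single_add)

lemma Const_uminus: "Const (- a) = - Const (a::'a::ab_group_add)"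
  by (simp add: Const_def single_uminus)

lemma Const_diff: "Const (a - b) = Const a - Const (b::'a::ab_group_add)"
  by (simp add: Const_def single_diff)

lemma Const_mult: "Const (a * b) = Const a * Const (b::'a::comm_semiring_1)"
  by (simp add: Const_def mult_single)

lemma Const_sum: "Const (sum f S) = (\<Sum>i\<in>S. Const (f i))"
  by (induction S rule: infinite_finite_induct) (simp_all add: Const_add)

lemma Const_of_nat: "Const (of_nat n) = of_nat n"
  by (simp add: Const_def)

lemma poly_eq_sum_monom1: "p = (\<Sum>m\<in>supp p. monom1 m (coef p m))"
proof (rule poly_mapping_eqI)
  fix k
  have "coef (\<Sum>m\<in>supp p. monom1 m (coef p m)) k = (\<Sum>m\<in>supp p. if m = k then coef p k else 0)"
    unfolding lookup_sum by (rule sum.cong) (auto simp: lookup_single when_def)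
  also have "\<dots> = (if k \<in> supp p then coef p k else 0)"
    by (rule sum.delta) simp
  finally show "coef p k = coef (\<Sum>m\<in>supp p. monom1 m (coef p m)) k"
    by (auto simp: in_keys_iff)
qed

section \<open>Degrees and homogeneous polynomials\<close>

lemma tdeg_superset: "finite S \<Longrightarrow> supp m \<subseteq> S \<Longrightarrow> tdeg m = (\<Sum>j\<in>S. coef m j)"
  unfolding tdeg_def by (rule sum.mono_neutral_left) (auto simp: in_keys_iff)

lemma tdeg_add: "tdeg (m + n) = tdeg m + tdeg n"
proof -
  let ?S = "supp m \<union> supp n"
  have "supp (m + n) \<subseteq> ?S" by (rule keys_add)
  then show ?thesis
    by (simp add: tdeg_superset[of ?S] lookup_add sum.distrib)
qed

lemma tdeg_0 [simp]: "tdeg 0 = 0"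
  by (simp add: tdeg_def)

lemma tdeg_monom1 [simp]: "tdeg (monom1 j c) = c"
  by (simp add: tdeg_def)

lemma coef_le_tdeg: "coef m j \<le> tdeg m"
proof (cases "j \<in> supp m")
  case True
  then show ?thesis unfolding tdeg_def by (intro member_le_sum) auto
qed (simp add: in_keys_iff)

lemma tdeg_eq_0_iff: "tdeg m = 0 \<longleftrightarrow> m = 0"
proof
  assume "tdeg m = 0"
  then have "coef m j = coef 0 j" for j using coef_le_tdeg[of m j] by simp
  then show "m = 0" by (rule poly_mapping_eqI)
qed simp

lemma supp_add_mono: "supp (m + n) = supp m \<union> supp n" for m n :: "'k mono"
  by (auto simp: in_keys_iff lookup_add)

text \<open>Exponents are bounded by the degree, so restriction to \<open>S\<close> embeds these
  monomials into a finite function space. All finite-dimensionality used later comes from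
  here.\<close>

lemma finite_bounded_monos:
  assumes "finite S"
  shows "finite {m. supp m \<subseteq> S \<and> tdeg m \<le> i}"
proof (rule finite_imageD)
  have "(\<lambda>m. restrict (coef m) S) ` {m. supp m \<subseteq> S \<and> tdeg m \<le> i} \<subseteq> S \<rightarrow>\<^sub>E {..i}"
    by (auto simp: PiE_iff intro: le_trans[OF coef_le_tdeg])
  then show "finite ((\<lambda>m. restrict (coef m) S) ` {m. supp m \<subseteq> S \<and> tdeg m \<le> i})"
    using assms by (meson finite_PiE finite_atMost finite_subset)
  show "inj_on (\<lambda>m. restrict (coef m) S) {m. supp m \<subseteq> S \<and> tdeg m \<le> i}"
  proof (rule inj_onI)
    fix m n assume H: "m \<in> {m. supp m \<subseteq> S \<and> tdeg m \<le> i}" "n \<in> {m. supp m \<subseteq> S \<and> tdeg m \<le> i}"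
      and eq: "restrict (coef m) S = restrict (coef n) S"
    show "m = n"
    proof (rule poly_mapping_eqI)
      fix k
      show "coef m k = coef n k"
      proof (cases "k \<in> S")
        case True
        then show ?thesis using fun_cong[OF eq, of k] by simp
      next
        case False
        then have "k \<notin> supp m" "k \<notin> supp n" using H by auto
        then show ?thesis by (simp add: in_keys_iff)
      qed
    qed
  qed
qed

lemma finite_homogeneous_monos:
  "finite S \<Longrightarrow> finite {m. supp m \<subseteq> S \<and> tdeg m = i}"
  by (rule finite_subset[OF _ finite_bounded_monos[of S i]]) auto

lemma homogD: "homog i f \<Longrightarrow> coef f m \<noteq> 0 \<Longrightarrow> tdeg m = i"
  by (simp add: homog_def in_keys_iff)

lemma homogI: "(\<And>m. coef f m \<noteq> 0 \<Longrightarrow> tdeg m = i) \<Longrightarrow> homog i f"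
  by (simp add: homog_def in_keys_iff)

lemma homog_0 [simp]: "homog i 0"
  by (simp add: homog_def)

lemma homog_add: "homog i f \<Longrightarrow> homog i g \<Longrightarrow> homog i (f + g)"
  using keys_add[of f g] by (auto simp: homog_def)

lemma homog_Const_mult: "homog i f \<Longrightarrow> homog i (Const c * f)"
  by (auto simp: homog_def in_keys_iff)

lemma homog_sum: "(\<And>x. x \<in> S \<Longrightarrow> homog i (f x)) \<Longrightarrow> homog i (sum f S)"
  by (induction S rule: infinite_finite_induct) (auto intro: homog_add)

lemma homog_mult: "homog i f \<Longrightarrow> homog j g \<Longrightarrow> homog (i + j) (f * g)"
  unfolding homog_def
proof
  fix m assume "\<forall>m\<in>supp f. tdeg m = i" "\<forall>m\<in>supp g. tdeg m = j" "m \<in> supp (f * g)"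
  then show "tdeg m = i + j" using keys_mult[of f g] by (auto simp: tdeg_add)
qed

lemma homog_1: "homog 0 1"
  by (simp add: homog_def)

lemma homog_power: "homog i f \<Longrightarrow> homog (i * n) (f ^ n)"
proof (induction n)
  case (Suc n)
  then show ?case using homog_mult[of i f "i * n" "f ^ n"] by simp
qed (simp add: homog_1)

lemma homog_prod_linear:
  "(\<And>x. x \<in> S \<Longrightarrow> homog 1 (f x)) \<Longrightarrow> homog (card S) (prod f S)"
proof (induction S rule: infinite_finite_induct)
  case (insert x F)
  then show ?case using homog_mult[of 1 "f x" "card F" "prod f F"] by simp
qed (auto simp: homog_1)

lemma homog_Var [simp]: "homog (Suc 0) (Var j)"
  by (simp add: homog_def Var_def)

section \<open>Factorials, differential operators and the symmetric pairing\<close>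

definition mfact :: "'k mono \<Rightarrow> complex"
  where "mfact m = (\<Prod>j\<in>supp m. fact (coef m j))"

lemma mfact_superset: "finite S \<Longrightarrow> supp m \<subseteq> S \<Longrightarrow> mfact m = (\<Prod>j\<in>S. fact (coef m j))"
  unfolding mfact_def by (rule prod.mono_neutral_left) (auto simp: in_keys_iff)

lemma mfact_nonzero [simp]: "mfact m \<noteq> 0"
  by (simp add: mfact_def)

lemma mfact_0 [simp]: "mfact 0 = 1"
  by (simp add: mfact_def)

lemma bracket_superset:
  "finite S \<Longrightarrow> supp p \<subseteq> S \<Longrightarrow> bracket z p = (\<Prod>j\<in>S. \<Prod>i<coef p j. z j - of_nat i)"
  unfolding bracket_def by (rule prod.mono_neutral_left) (auto simp: in_keys_iff)

text \<open>The last factor of the product is a + 1, which \<open>fact a\<close> absorbs; the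
  induction therefore has to move \<open>a\<close> to \<open>Suc a\<close>. Writing the identity as
  a product avoids division and truncated subtraction.\<close>

lemma fact_prod_falling:
  "(\<Prod>i<b. of_nat (a + b) - of_nat i) * fact a = (fact (a + b) :: 'a::field_char_0)"
proof (induction b arbitrary: a)
  case (Suc b)
  have "(\<Prod>i<Suc b. of_nat (a + Suc b) - of_nat i) * fact a
      = (\<Prod>i<b. of_nat (Suc a + b) - of_nat i) * (of_nat (Suc a) * fact a :: 'a)"
    by (simp add: algebra_simps del: fact_Suc)
  also have "of_nat (Suc a) * fact a = (fact (Suc a) :: 'a)"
    by (simp only: fact_Suc)
  also have "(\<Prod>i<b. of_nat (Suc a + b) - of_nat i) * fact (Suc a) = (fact (a + Suc b) :: 'a)"
    using Suc.IH[of "Suc a"] by (simp only: add_Suc_shift)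
  finally show ?case .
qed simp

lemma bracket_of_nat_add:
  "bracket (\<lambda>j. of_nat (coef (k + m) j)) m * mfact k = (mfact (k + m) :: complex)"
proof -
  let ?S = "supp k \<union> supp m"
  have "bracket (\<lambda>j. of_nat (coef (k + m) j)) m * mfact k
     = (\<Prod>j\<in>?S. (\<Prod>i<coef m j. of_nat (coef k j + coef m j) - of_nat i) * fact (coef k j))"
    by (simp add: bracket_superset[of ?S] mfact_superset[of ?S] prod.distrib lookup_add)
  also have "\<dots> = mfact (k + m)"
    by (simp only: fact_prod_falling mfact_superset[of ?S "k + m"] supp_add_mono
        finite_Un finite_keys lookup_add order_refl simp_thms)
  finally show ?thesis .
qed

lemma bracket_of_nat_outside:
  assumes "\<And>l. k \<noteq> m + l"
  shows "bracket (\<lambda>j. of_nat (coef k j)) m = (0::complex)"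
proof -
  from assms obtain j where j: "coef k j < coef m j"
    using mono_le_iff[of k m] by (auto simp: not_le)
  then have "(\<Prod>i<coef m j. of_nat (coef k j) - of_nat i :: complex) = 0"
    by (intro prod_zero) auto
  moreover have "j \<in> supp m" using j by (auto simp: in_keys_iff)
  ultimately show ?thesis
    unfolding bracket_def by (intro prod_zero) auto
qed

text \<open>The closed form makes the pairing diagonal on monomials, with weights
  \<open>mfact m\<close>; its symmetry and nondegeneracy follow from that.\<close>

lemma coef_diff_mono: "coef (diff_mono m f) k = mfact (k + m) / mfact k * coef f (k + m)"
proof -
  have "coef (diff_mono m f) k = (\<Sum>l\<in>supp f.
     bracket (\<lambda>j. of_nat (coef l j)) m * coef f l when l - m = k)"
    unfolding diff_mono_def by (simp add: lookup_sum lookup_single)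
  also have "\<dots> = (\<Sum>l\<in>supp f. mfact (k + m) / mfact k * coef f (k + m) when l = k + m)"
  proof (rule sum.cong)
    fix l assume "l \<in> supp f"
    show "(bracket (\<lambda>j. of_nat (coef l j)) m * coef f l when l - m = k)
        = (mfact (k + m) / mfact k * coef f (k + m) when l = k + m)"
    \<comment> \<open>Where the subtraction \<open>l - m\<close> is genuinely truncated the falling
      factorial vanishes, so only l = k + m survives.\<close>
    proof (cases "\<exists>l'. l = m + l'")
      case True
      then obtain l' where l: "l = l' + m" by (auto simp: add.commute)
      have "bracket (\<lambda>j. of_nat (coef (l' + m) j)) m = mfact (l' + m) / mfact l'"
        by (simp add: bracket_of_nat_add[symmetric])
      then show ?thesis by (auto simp: l when_def)
    next
      case False
      then have "l \<noteq> k + m" by (auto simp: add.commute)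
      with False show ?thesis by (simp add: bracket_of_nat_outside when_def)
    qed
  qed simp
  also have "\<dots> = mfact (k + m) / mfact k * coef f (k + m)"
    by (cases "k + m \<in> supp f") (auto simp: when_def in_keys_iff sum.delta')
  finally show ?thesis .
qed

lemma coef_diff_op:
  "coef (diff_op q f) k = (\<Sum>m\<in>supp q. coef q m * (mfact (k + m) / mfact k * coef f (k + m)))"
  by (simp add: diff_op_def lookup_sum coef_diff_mono)

lemma pairing_eq: "pairing f q = (\<Sum>m\<in>supp q. coef q m * mfact m * coef f m)"
  by (simp add: pairing_def coef_diff_op mult.assoc)

lemma pairing_superset_right:
  "finite S \<Longrightarrow> supp q \<subseteq> S \<Longrightarrow> pairing f q = (\<Sum>m\<in>S. coef q m * mfact m * coef f m)"
  unfolding pairing_eq by (rule sum.mono_neutral_left) (auto simp: in_keys_iff)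

lemma pairing_commute: "pairing f q = pairing q f"
proof -
  have "pairing f q = (\<Sum>m\<in>supp q \<union> supp f. coef q m * mfact m * coef f m)"
    by (rule pairing_superset_right) auto
  also have "\<dots> = (\<Sum>m\<in>supp q \<union> supp f. coef f m * mfact m * coef q m)"
    by (simp add: mult_ac)
  also have "\<dots> = pairing q f"
    by (rule pairing_superset_right[symmetric]) auto
  finally show ?thesis .
qed

lemma pairing_add_left: "pairing (f + g) q = pairing f q + pairing g q"
  by (simp add: pairing_eq lookup_add algebra_simps sum.distrib)

lemma pairing_add_right: "pairing f (q + q') = pairing f q + pairing f q'"
  by (metis pairing_add_left pairing_commute)

lemma pairing_0_left [simp]: "pairing 0 q = 0" and pairing_0_right [simp]: "pairing q 0 = 0"
  by (simp_all add: pairing_eq)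

lemma pairing_Const_left: "pairing (Const c * f) q = c * pairing f q"
  by (simp add: pairing_eq sum_distrib_left mult.assoc mult.left_commute[of _ c])

lemma pairing_Const_right: "pairing f (Const c * q) = c * pairing f q"
  by (metis pairing_Const_left pairing_commute)

lemma pairing_diff_left: "pairing (f - g) q = pairing f q - pairing g q"
  by (simp add: pairing_eq lookup_minus algebra_simps sum_subtractf)

lemma pairing_diff_right: "pairing f (q - q') = pairing f q - pairing f q'"
  by (metis pairing_diff_left pairing_commute)

lemma pairing_sum_left: "pairing (sum f S) q = (\<Sum>x\<in>S. pairing (f x) q)"
  by (induction S rule: infinite_finite_induct) (simp_all add: pairing_add_left)

lemma pairing_sum_right: "pairing q (sum f S) = (\<Sum>x\<in>S. pairing q (f x))"
  by (induction S rule: infinite_finite_induct) (simp_all add: pairing_add_right)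

lemma pairing_monom1_left: "pairing (monom1 m c) q = c * mfact m * coef q m"
  by (subst pairing_commute) (simp add: pairing_eq)

lemma pairing_1_left: "pairing 1 q = coef q 0"
  using pairing_monom1_left[of 0 1 q] by simp

text \<open>Pairing with a monomial returns its coefficient times a nonzero factorial, so testing on
  monomials suffices.\<close>

lemma pairing_eqI:
  assumes "\<And>m. pairing (monom1 m 1) p = pairing (monom1 m 1) q"
  shows "p = q"
  using assms by (intro poly_mapping_eqI) (simp add: pairing_monom1_left)

text \<open>The operators act as the transposes of multiplications; all algebraic properties of
  \<open>diff_op\<close> follow from this and the nondegeneracy of the pairing.\<close>

lemma pairing_diff_op: "pairing h (diff_op q f) = pairing (h * q) f"
proof -
  have monom: "pairing (monom1 k c) (diff_op q f) = pairing (monom1 k c * q) f" for k c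
  proof -
    have "monom1 k c * q = (\<Sum>m\<in>supp q. monom1 (k + m) (c * coef q m))"
      by (subst poly_eq_sum_monom1[of q]) (simp add: sum_distrib_left mult_single)
    then have "pairing (monom1 k c * q) f = (\<Sum>m\<in>supp q. c * coef q m * mfact (k + m) * coef f (k + m))"
      by (simp add: pairing_sum_left pairing_monom1_left)
    then show ?thesis
      by (simp add: pairing_monom1_left coef_diff_op sum_distrib_left mult_ac)
  qed
  have "pairing h (diff_op q f) = (\<Sum>m\<in>supp h. pairing (monom1 m (coef h m)) (diff_op q f))"
    by (subst poly_eq_sum_monom1[of h]) (simp only: pairing_sum_left)
  also have "\<dots> = pairing (\<Sum>m\<in>supp h. monom1 m (coef h m) * q) f"
    by (simp add: monom pairing_sum_left)
  also have "(\<Sum>m\<in>supp h. monom1 m (coef h m) * q) = h * q"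
    by (simp only: sum_distrib_right[symmetric] poly_eq_sum_monom1[symmetric])
  finally show ?thesis .
qed

lemma diff_op_mult: "diff_op (p * q) f = diff_op p (diff_op q f)"
  by (rule pairing_eqI) (simp add: pairing_diff_op mult_ac)

lemma diff_op_commute: "diff_op p (diff_op q f) = diff_op q (diff_op p f)"
  by (metis diff_op_mult mult.commute)

lemma diff_op_1 [simp]: "diff_op 1 f = f"
  by (rule pairing_eqI) (simp add: pairing_diff_op)

lemma diff_op_0_left [simp]: "diff_op 0 f = 0" and diff_op_0_right [simp]: "diff_op q 0 = 0"
  by (rule pairing_eqI, simp add: pairing_diff_op)+

lemma diff_op_add_left: "diff_op (p + q) f = diff_op p f + diff_op q f"
  by (rule pairing_eqI) (simp add: pairing_diff_op pairing_add_left pairing_add_right distrib_left)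

lemma diff_op_add_right: "diff_op p (f + g) = diff_op p f + diff_op p g"
  by (rule pairing_eqI) (simp add: pairing_diff_op pairing_add_right)

lemma diff_op_diff_left: "diff_op (p - q) f = diff_op p f - diff_op q f"
  by (rule pairing_eqI) (simp add: pairing_diff_op pairing_diff_left pairing_diff_right right_diff_distrib)

lemma diff_op_diff_right: "diff_op p (f - g) = diff_op p f - diff_op p g"
  by (rule pairing_eqI) (simp add: pairing_diff_op pairing_diff_right)

lemma diff_op_Const [simp]: "diff_op (Const c) f = Const c * f"
  by (rule pairing_eqI) (simp add: pairing_diff_op pairing_Const_left pairing_Const_right mult.commute[of _ "Const c"])

lemma diff_op_Const_mult_left: "diff_op (Const c * q) f = Const c * diff_op q f"
  by (simp add: diff_op_mult)

lemma diff_op_Const_mult_right: "diff_op q (Const c * f) = Const c * diff_op q f"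
  by (metis diff_op_Const diff_op_commute)

lemma diff_op_sum_left: "diff_op (sum p S) f = (\<Sum>x\<in>S. diff_op (p x) f)"
  by (induction S rule: infinite_finite_induct) (simp_all add: diff_op_add_left)

lemma diff_op_sum_right: "diff_op q (sum f S) = (\<Sum>x\<in>S. diff_op q (f x))"
  by (induction S rule: infinite_finite_induct) (simp_all add: diff_op_add_right)

lemma pairing_homog_neq:
  assumes "homog i f" "homog j q" "i \<noteq> j"
  shows "pairing f q = 0"
  unfolding pairing_eq
proof (rule sum.neutral, rule ballI)
  fix m assume "m \<in> supp q"
  then have "m \<notin> supp f" using assms by (auto simp: homog_def)
  then show "coef q m * mfact m * coef f m = 0" by (simp add: in_keys_iff)
qed

definition hcomp :: "nat \<Rightarrow> 'k cpoly \<Rightarrow> 'k cpoly"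
  where "hcomp i f = (\<Sum>m\<in>{m\<in>supp f. tdeg m = i}. monom1 m (coef f m))"

lemma coef_hcomp: "coef (hcomp i f) m = (if tdeg m = i then coef f m else 0)"
proof -
  have "coef (hcomp i f) m = (\<Sum>n\<in>{n\<in>supp f. tdeg n = i}. if n = m then coef f m else 0)"
    unfolding hcomp_def lookup_sum by (rule sum.cong) (auto simp: lookup_single when_def)
  also have "\<dots> = (if m \<in> {n\<in>supp f. tdeg n = i} then coef f m else 0)"
    by (rule sum.delta) simp
  finally show ?thesis by (auto simp: in_keys_iff)
qed

lemma homog_hcomp [simp]: "homog i (hcomp i f)"
proof (rule homogI)
  fix m assume "coef (hcomp i f) m \<noteq> 0"
  then show "tdeg m = i" by (cases "tdeg m = i") (simp_all add: coef_hcomp)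
qed

lemma pairing_hcomp_left:
  assumes "homog i q"
  shows "pairing (hcomp i f) q = pairing f q"
  unfolding pairing_eq using assms by (intro sum.cong) (simp_all add: coef_hcomp homog_def)


section \<open>Finite-dimensional duality\<close>

text \<open>The vector space is a closed set \<open>W\<close> with unspecified operations so that
  no quotients or function spaces have to be formed.\<close>

lemma functional_in_span:
  fixes add :: "'v \<Rightarrow> 'v \<Rightarrow> 'v" and scl :: "'f::field \<Rightarrow> 'v \<Rightarrow> 'v" and coord :: "'i \<Rightarrow> 'v \<Rightarrow> 'f"
  assumes "finite I"
    and "\<And>x y. x \<in> W \<Longrightarrow> y \<in> W \<Longrightarrow> add x y \<in> W" and "\<And>c x. x \<in> W \<Longrightarrow> scl c x \<in> W"
    and "\<And>i x y. i \<in> I \<Longrightarrow> x \<in> W \<Longrightarrow> y \<in> W \<Longrightarrow> coord i (add x y) = coord i x + coord i y"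
    and "\<And>i c x. i \<in> I \<Longrightarrow> x \<in> W \<Longrightarrow> coord i (scl c x) = c * coord i x"
    and "\<And>x y. x \<in> W \<Longrightarrow> y \<in> W \<Longrightarrow> \<psi> (add x y) = \<psi> x + \<psi> y"
    and "\<And>c x. x \<in> W \<Longrightarrow> \<psi> (scl c x) = c * \<psi> x"
    and "\<And>x. x \<in> W \<Longrightarrow> (\<And>i. i \<in> I \<Longrightarrow> coord i x = 0) \<Longrightarrow> \<psi> x = 0"
  shows "\<exists>c. \<forall>x\<in>W. \<psi> x = (\<Sum>i\<in>I. c i * coord i x)"
  using assms
proof (induction I arbitrary: W rule: finite_induct)
  case empty
  then show ?case by auto
next
  case (insert a I)
  show ?case
  \<comment> \<open>A pivot \<open>y\<close>, seen by \<open>coord a\<close> alone, splits off: the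
    induction hypothesis is applied to the kernel of \<open>coord a\<close> in \<open>W\<close>, and
    \<open>y\<close> fixes the coefficient of \<open>coord a\<close>. Without a pivot
    \<open>coord a\<close> is redundant and receives the coefficient 0.\<close>
  proof (cases "\<exists>y\<in>W. (\<forall>i\<in>I. coord i y = 0) \<and> coord a y \<noteq> 0")
    case True
    then obtain y where y: "y \<in> W" "\<And>i. i \<in> I \<Longrightarrow> coord i y = 0" "coord a y \<noteq> 0"
      by blast
    have "\<exists>c. \<forall>x\<in>{x \<in> W. coord a x = 0}. \<psi> x = (\<Sum>i\<in>I. c i * coord i x)"
    proof (rule insert.IH)
      fix x assume "x \<in> {x \<in> W. coord a x = 0}" "\<And>i. i \<in> I \<Longrightarrow> coord i x = 0"
      then show "\<psi> x = 0" by (intro insert.prems(7)) auto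
    qed (use insert.prems(1-6) in auto)
    then obtain c where c: "\<And>x. x \<in> W \<Longrightarrow> coord a x = 0 \<Longrightarrow> \<psi> x = (\<Sum>i\<in>I. c i * coord i x)"
      by auto
    have "\<psi> x = \<psi> y / coord a y * coord a x + (\<Sum>i\<in>I. c i * coord i x)" if x: "x \<in> W" for x
    proof -
      \<comment> \<open>This multiple of \<open>y\<close> moves \<open>x\<close> into the kernel of
        \<open>coord a\<close> and leaves the coordinates in \<open>I\<close> unchanged.\<close>
      let ?t = "- (coord a x / coord a y)"
      let ?x = "add x (scl ?t y)"
      have ty: "scl ?t y \<in> W"
        using insert.prems(2)[OF y(1)] .
      then have xW: "?x \<in> W"
        using insert.prems(1)[OF x] by blast
      have co: "coord i ?x = coord i x + ?t * coord i y" if "i \<in> insert a I" for i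
        using insert.prems(3)[OF that x ty] insert.prems(4)[OF that y(1)] by simp
      have "\<psi> x + ?t * \<psi> y = \<psi> ?x"
        using insert.prems(5)[OF x ty] insert.prems(6)[OF y(1)] by simp
      also have "\<dots> = (\<Sum>i\<in>I. c i * coord i ?x)"
        using c[OF xW] co[of a] y(3) by simp
      also have "\<dots> = (\<Sum>i\<in>I. c i * coord i x)"
        by (rule sum.cong) (simp_all add: co y(2))
      finally show ?thesis
        by (simp add: algebra_simps)
    qed
    then have "\<forall>x\<in>W. \<psi> x = (\<Sum>i\<in>insert a I. (c(a := \<psi> y / coord a y)) i * coord i x)"
      using insert.hyps by (auto intro!: sum.cong)
    then show ?thesis by blast
  next
    case False
    have "\<exists>c. \<forall>x\<in>W. \<psi> x = (\<Sum>i\<in>I. c i * coord i x)"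
    proof (rule insert.IH)
      fix x assume "x \<in> W" "\<And>i. i \<in> I \<Longrightarrow> coord i x = 0"
      then show "\<psi> x = 0" using False by (intro insert.prems(7)) auto
    qed (use insert.prems(1-6) in auto)
    then obtain c where c: "\<forall>x\<in>W. \<psi> x = (\<Sum>i\<in>I. c i * coord i x)"
      by blast
    have "\<forall>x\<in>W. \<psi> x = (\<Sum>i\<in>insert a I. (c(a := 0)) i * coord i x)"
      using c insert.hyps by (auto intro!: sum.cong)
    then show ?thesis by blast
  qed
qed

section \<open>Subspaces of forms and biorthogonality\<close>

definition lin_subspace :: "'k cpoly set \<Rightarrow> bool"
  where "lin_subspace U \<longleftrightarrow>
    0 \<in> U \<and> (\<forall>x\<in>U. \<forall>y\<in>U. x + y \<in> U) \<and> (\<forall>c. \<forall>x\<in>U. Const c * x \<in> U)"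

lemma lin_subspaceD:
  assumes "lin_subspace U"
  shows "0 \<in> U" "x \<in> U \<Longrightarrow> y \<in> U \<Longrightarrow> x + y \<in> U" "x \<in> U \<Longrightarrow> Const c * x \<in> U"
    and "x \<in> U \<Longrightarrow> y \<in> U \<Longrightarrow> x - y \<in> U"
proof -
  show *: "0 \<in> U" "x \<in> U \<Longrightarrow> y \<in> U \<Longrightarrow> x + y \<in> U" "x \<in> U \<Longrightarrow> Const c * x \<in> U" for x y c
    using assms by (auto simp: lin_subspace_def)
  have "x - y = x + Const (-1) * y"
    by (simp add: Const_uminus)
  then show "x \<in> U \<Longrightarrow> y \<in> U \<Longrightarrow> x - y \<in> U"
    using * by metis
qed

abbreviation forms :: "nat \<Rightarrow> nat \<Rightarrow> nat cpoly set"
  where "forms r i \<equiv> degree_part i (Sring r)"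

lemma formsI: "(\<And>m. coef f m \<noteq> 0 \<Longrightarrow> supp m \<subseteq> {..<r} \<and> tdeg m = i) \<Longrightarrow> f \<in> forms r i"
  by (auto simp: degree_part_def Sring_def homog_def in_keys_iff subset_iff)

lemma Sring_coef: "f \<in> Sring r \<Longrightarrow> coef f m \<noteq> 0 \<Longrightarrow> supp m \<subseteq> {..<r}"
  by (auto simp: Sring_def in_keys_iff)

lemma SringI: "(\<And>m. coef f m \<noteq> 0 \<Longrightarrow> supp m \<subseteq> {..<r}) \<Longrightarrow> f \<in> Sring r"
  by (auto simp: Sring_def in_keys_iff subset_iff)

lemma forms_coef: "f \<in> forms r i \<Longrightarrow> coef f m \<noteq> 0 \<Longrightarrow> supp m \<subseteq> {..<r} \<and> tdeg m = i"
  by (auto simp: degree_part_def Sring_coef homogD dest: Sring_coef)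

lemma Sring_0 [simp]: "0 \<in> Sring r" and Sring_1 [simp]: "1 \<in> Sring r"
  and Sring_Const [simp]: "Const c \<in> Sring r"
  by (auto simp: Sring_def Const_def split: if_splits)

lemma Sring_monom1: "supp m \<subseteq> {..<r} \<Longrightarrow> monom1 m c \<in> Sring r"
  by (auto simp: Sring_def split: if_splits)

lemma Sring_Var: "k < r \<Longrightarrow> Var k \<in> Sring r"
  by (auto simp: Var_def intro!: Sring_monom1)

lemma Sring_add: "f \<in> Sring r \<Longrightarrow> g \<in> Sring r \<Longrightarrow> f + g \<in> Sring r"
  using keys_add[of f g] by (fastforce simp: Sring_def)

lemma Sring_mult: "f \<in> Sring r \<Longrightarrow> g \<in> Sring r \<Longrightarrow> f * g \<in> Sring r"
  unfolding Sring_def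
proof safe
  fix m x assume *: "\<forall>m\<in>supp f. supp m \<subseteq> {..<r}" "\<forall>m\<in>supp g. supp m \<subseteq> {..<r}"
    "m \<in> supp (f * g)" "x \<in> supp m"
  then obtain a b where "a \<in> supp f" "b \<in> supp g" "m = a + b"
    using keys_mult[of f g] by blast
  with * show "x < r" by (auto simp: supp_add_mono)
qed

lemma Sring_sum: "(\<And>x. x \<in> S \<Longrightarrow> f x \<in> Sring r) \<Longrightarrow> sum f S \<in> Sring r"
  by (induction S rule: infinite_finite_induct) (auto intro: Sring_add)

lemma Sring_prod: "(\<And>x. x \<in> S \<Longrightarrow> f x \<in> Sring r) \<Longrightarrow> prod f S \<in> Sring r"
  by (induction S rule: infinite_finite_induct) (auto intro: Sring_mult)

lemma Sring_diff_op: "f \<in> Sring r \<Longrightarrow> diff_op q f \<in> Sring r"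
proof (rule SringI)
  fix k assume f: "f \<in> Sring r" and "coef (diff_op q f) k \<noteq> 0"
  then obtain m where "coef f (k + m) \<noteq> 0"
    unfolding coef_diff_op by (metis (no_types, lifting) mult_zero_right sum.neutral)
  then have "supp (k + m) \<subseteq> {..<r}"
    by (rule Sring_coef[OF f])
  then show "supp k \<subseteq> {..<r}"
    by (simp add: supp_add_mono)
qed

lemma Sring_hcomp: "f \<in> Sring r \<Longrightarrow> hcomp i f \<in> Sring r"
  by (rule SringI) (auto simp: coef_hcomp dest: Sring_coef split: if_splits)

lemma lin_subspace_degree_part: "lin_subspace M \<Longrightarrow> lin_subspace (degree_part i M)"
  by (auto simp: lin_subspace_def degree_part_def homog_add homog_Const_mult)

lemma lin_subspace_Sring: "lin_subspace (Sring r)"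
  by (auto simp: lin_subspace_def Sring_add Sring_mult)

lemmas lin_subspace_forms = lin_subspace_degree_part[OF lin_subspace_Sring]

lemma Sring_eqI:
  assumes "p \<in> Sring r" "q \<in> Sring r" "\<And>h. h \<in> Sring r \<Longrightarrow> pairing h p = pairing h q"
  shows "p = q"
proof (rule poly_mapping_eqI)
  fix m
  show "coef p m = coef q m"
  proof (cases "supp m \<subseteq> {..<r}")
    case True
    then show ?thesis
      using assms(3)[OF Sring_monom1[OF True, of 1]] by (simp add: pairing_monom1_left)
  next
    case False
    then show ?thesis using assms(1,2) Sring_coef by metis
  qed
qed

text \<open>A functional on a space of forms is a combination of the finitely many coefficient
  functionals, and each of these is the pairing with a monomial divided by its factorial.\<close>

lemma form_functional_represented:
  assumes "lin_subspace X" "X \<subseteq> forms r i"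
    and "\<And>x y. x \<in> X \<Longrightarrow> y \<in> X \<Longrightarrow> \<psi> (x + y) = \<psi> x + \<psi> y"
    and "\<And>c x. x \<in> X \<Longrightarrow> \<psi> (Const c * x) = c * \<psi> x"
  shows "\<exists>q\<in>forms r i. \<forall>x\<in>X. \<psi> x = pairing x q"
proof -
  let ?M = "{m. supp m \<subseteq> {..<r} \<and> tdeg m = i}"
  have fin: "finite ?M" by (rule finite_homogeneous_monos) simp
  have \<psi>0: "\<psi> 0 = 0"
    using assms(4)[of 0 0] lin_subspaceD(1)[OF assms(1)] by simp
  have "\<exists>c. \<forall>x\<in>X. \<psi> x = (\<Sum>m\<in>?M. c m * coef x m)"
  proof (rule functional_in_span[where add = "(+)" and scl = "\<lambda>c x. Const c * x" and coord = "\<lambda>m x. coef x m"])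
    fix x assume x: "x \<in> X" "\<And>m. m \<in> ?M \<Longrightarrow> coef x m = 0"
    have "x = 0"
    proof (rule poly_mapping_eqI)
      fix m
      have "x \<in> forms r i" using x(1) assms(2) by blast
      then show "coef x m = coef 0 m"
        using x(2)[of m] forms_coef[of x i r m] by (cases "coef x m = 0") auto
    qed
    then show "\<psi> x = 0" by (simp add: \<psi>0)
  qed (use fin assms lin_subspaceD[OF assms(1)] in \<open>auto simp: lookup_add\<close>)
  then obtain c where c: "\<forall>x\<in>X. \<psi> x = (\<Sum>m\<in>?M. c m * coef x m)" by blast
  define q where "q = (\<Sum>m\<in>?M. monom1 m (c m / mfact m))"
  have q: "coef q m = (if m \<in> ?M then c m / mfact m else 0)" for m
  proof -
    have "coef q m = (\<Sum>n\<in>?M. if n = m then c m / mfact m else 0)"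
      unfolding q_def lookup_sum by (rule sum.cong) (auto simp: lookup_single when_def)
    also have "\<dots> = (if m \<in> ?M then c m / mfact m else 0)"
      by (rule sum.delta[OF fin])
    finally show ?thesis .
  qed
  have "q \<in> forms r i"
  proof (rule formsI)
    fix m assume "coef q m \<noteq> 0"
    then have "m \<in> ?M" using q[of m] by presburger
    then show "supp m \<subseteq> {..<r} \<and> tdeg m = i" by simp
  qed
  moreover have "pairing x q = (\<Sum>m\<in>?M. c m * coef x m)" for x
  proof -
    have "supp q \<subseteq> ?M"
    proof
      fix m assume "m \<in> supp q"
      then have "coef q m \<noteq> 0" by (simp add: in_keys_iff)
      then show "m \<in> ?M" using q[of m] by presburger
    qed
    then show ?thesis
      by (simp add: pairing_superset_right[OF fin] q)
  qed
  ultimately show ?thesis using c by (intro bexI[of _ q]) simp_all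
qed

text \<open>If \<open>x\<close> lies outside \<open>W\<close>, the coefficient \<open>t\<close> in y
  + t x with \<open>y\<close> in \<open>W\<close> is well defined, hence a linear functional of the
  coordinates of that sum, hence the pairing with some form \<open>q\<close>. This \<open>q\<close>
  is orthogonal to \<open>W\<close> but pairs to 1 with \<open>x\<close>. The pairs in
  \<open>W \<times> UNIV\<close> stand for such sums.\<close>

lemma pairing_separates:
  assumes "lin_subspace W" "W \<subseteq> forms r i" "x \<in> forms r i"
    and "\<And>q. q \<in> perp_deg r i W \<Longrightarrow> pairing x q = 0"
  shows "x \<in> W"
proof (rule ccontr)
  assume x: "x \<notin> W"
  let ?M = "{m. supp m \<subseteq> {..<r} \<and> tdeg m = i}"
  have fin: "finite ?M" by (rule finite_homogeneous_monos) simp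
  have "\<exists>c. \<forall>y\<in>W \<times> UNIV. snd y = (\<Sum>m\<in>?M. c m * coef (fst y + Const (snd y) * x) m)"
  proof (rule functional_in_span[where add = "(+)" and scl = "\<lambda>c y. (Const c * fst y, c * snd y)"
        and coord = "\<lambda>m y. coef (fst y + Const (snd y) * x) m"])
    fix y assume y: "y \<in> W \<times> (UNIV::complex set)"
      and z: "\<And>m. m \<in> ?M \<Longrightarrow> coef (fst y + Const (snd y) * x) m = 0"
    have in_forms: "fst y + Const (snd y) * x \<in> forms r i"
      using y assms(2,3) lin_subspaceD[OF lin_subspace_forms] by auto
    then have z': "fst y + Const (snd y) * x = 0"
    proof (intro poly_mapping_eqI)
      fix m
      show "coef (fst y + Const (snd y) * x) m = coef 0 m"
        using z[of m] forms_coef[OF in_forms, of m]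
        by (cases "coef (fst y + Const (snd y) * x) m = 0") simp_all
    qed
    show "snd y = 0"
    proof (rule ccontr)
      assume n: "snd y \<noteq> 0"
      have "x = Const (- 1 / snd y) * fst y"
      proof -
        have "Const (1 / snd y) * (fst y + Const (snd y) * x) = 0" using z' by simp
        then have "Const (1 / snd y) * fst y + x = 0"
          using n by (simp add: distrib_left mult.assoc[symmetric] Const_mult[symmetric])
        then show ?thesis
          by (metis Const_uminus add.commute add_eq_0_iff minus_divide_left mult_minus_left)
      qed
      then show False using x y lin_subspaceD(3)[OF assms(1)] by (metis mem_Times_iff)
    qed
  qed (use fin assms(1) lin_subspaceD in \<open>auto simp: lookup_add Const_add Const_mult distrib_left distrib_right add_ac mult.assoc\<close>)
  then obtain c where c: "\<And>y t. y \<in> W \<Longrightarrow> t = (\<Sum>m\<in>?M. c m * coef (y + Const t * x) m)"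
    by auto
  have "\<exists>q\<in>forms r i. \<forall>y\<in>forms r i. (\<Sum>m\<in>?M. c m * coef y m) = pairing y q"
    by (rule form_functional_represented[OF lin_subspace_forms])
      (simp_all add: lookup_add distrib_left sum.distrib sum_distrib_left mult.left_commute[where 'a = complex])
  then obtain q where q: "q \<in> forms r i" "\<And>y. y \<in> forms r i \<Longrightarrow> (\<Sum>m\<in>?M. c m * coef y m) = pairing y q"
    by blast
  have "q \<in> perp_deg r i W"
    unfolding perp_deg_def
  proof (intro CollectI conjI ballI)
    fix y assume y: "y \<in> W"
    then have "y \<in> forms r i" using assms(2) by blast
    then show "pairing y q = 0" using q(2)[of y] c[OF y, of 0] by simp
  qed (rule q(1))
  moreover have "pairing x q = 1"
    using q(2)[OF assms(3)] c[OF lin_subspaceD(1)[OF assms(1)], of 1] by simp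
  ultimately show False using assms(4) by force
qed

lemma perp_deg_antimono: "W \<subseteq> U \<Longrightarrow> perp_deg r i U \<subseteq> perp_deg r i W"
  by (auto simp: perp_deg_def)

lemma lin_subspace_perp_deg: "lin_subspace (perp_deg r i W)"
  using lin_subspaceD[OF lin_subspace_forms[where r = r and i = i]]
  by (auto simp: lin_subspace_def perp_deg_def pairing_add_right pairing_Const_right)

lemma coset_eq_iff:
  assumes "lin_subspace W"
  shows "coset W x = coset W y \<longleftrightarrow> x - y \<in> W"
proof
  assume "coset W x = coset W y"
  moreover have "x \<in> coset W x"
    using lin_subspaceD(1)[OF assms] by (force simp: coset_def)
  ultimately obtain z where "z \<in> W" "x = y + z"
    by (auto simp: coset_def)
  then show "x - y \<in> W" by simp
next
  have sub: "coset W x \<subseteq> coset W y" if "x - y \<in> W" for x y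
  proof
    fix t assume "t \<in> coset W x"
    then obtain z where z: "z \<in> W" "t = x + z" by (auto simp: coset_def)
    then have "t = y + ((x - y) + z)" by simp
    then show "t \<in> coset W y"
      using lin_subspaceD(2)[OF assms that z(1)] by (simp only: coset_def) (rule imageI)
  qed
  assume *: "x - y \<in> W"
  then have "y - x \<in> W"
    using lin_subspaceD(4)[OF assms lin_subspaceD(1)[OF assms] *] by simp
  with * show "coset W x = coset W y" using sub by blast
qed

lemma quotient_dual_zero:
  assumes "lin_subspace U" "\<phi> \<in> quotient_dual U W"
  shows "\<phi> (coset W 0) = 0"
proof -
  have "\<phi> (coset W (Const c * x)) = c * \<phi> (coset W x)" if "x \<in> U" for c x
    using assms(2) that by (simp add: quotient_dual_def)
  from this[of 0 0] show ?thesis using lin_subspaceD(1)[OF assms(1)] by simp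
qed

text \<open>Both dualities below use only that a functional on a quotient is represented by a form,
  and that a space of forms is its own biorthogonal.\<close>

lemma perfect_pairing_perp:
  assumes U: "lin_subspace U" "U \<subseteq> forms r i" and W: "lin_subspace W" and WU: "W \<subseteq> U"
  defines "X \<equiv> perp_deg r i W" and "Y \<equiv> perp_deg r i U"
  shows "induces_perfect_pairing pairing U W X Y \<and> quotient_iso_dual U W X Y"
proof -
  have YX: "Y \<subseteq> X" unfolding X_def Y_def by (rule perp_deg_antimono[OF WU])
  have X: "lin_subspace X" and Y: "lin_subspace Y"
    by (simp_all add: X_def Y_def lin_subspace_perp_deg)
  have Xf: "X \<subseteq> forms r i" by (auto simp: X_def perp_deg_def)
  have Wf: "W \<subseteq> forms r i" using WU U(2) by blast
  \<comment> \<open>Elements of a quotient are cosets as sets, so the induced form picks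
    representatives. The choice does not matter because \<open>X\<close> is orthogonal to
    \<open>W\<close> and \<open>Y\<close> is orthogonal to \<open>U\<close>.\<close>
  define b' where "b' \<alpha> \<xi> = pairing (SOME x. x \<in> U \<and> \<alpha> = coset W x) (SOME y. y \<in> X \<and> \<xi> = coset Y y)" for \<alpha> \<xi>
  have b': "b' (coset W x) (coset Y y) = pairing x y" if xy: "x \<in> U" "y \<in> X" for x y
  proof -
    define x' where "x' = (SOME x'. x' \<in> U \<and> coset W x = coset W x')"
    define y' where "y' = (SOME y'. y' \<in> X \<and> coset Y y = coset Y y')"
    have x': "x' \<in> U \<and> coset W x = coset W x'"
      unfolding x'_def by (rule someI[where P = "\<lambda>x'. x' \<in> U \<and> coset W x = coset W x'" and x = x]) (simp add: xy)
    have y': "y' \<in> X \<and> coset Y y = coset Y y'"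
      unfolding y'_def by (rule someI[where P = "\<lambda>y'. y' \<in> X \<and> coset Y y = coset Y y'" and x = y]) (simp add: xy)
    have "pairing (x - x') y = 0"
      using x' xy coset_eq_iff[OF W] by (auto simp: X_def perp_deg_def)
    moreover have "pairing x' (y - y') = 0"
      using x' y' xy coset_eq_iff[OF Y] by (auto simp: Y_def perp_deg_def)
    ultimately show ?thesis
      by (simp add: b'_def x'_def[symmetric] y'_def[symmetric] pairing_diff_left pairing_diff_right)
  qed
  have in_dual: "restrict (b' \<alpha>) (quotient_space X Y) \<in> quotient_dual X Y" if \<alpha>: "\<alpha> \<in> quotient_space U W" for \<alpha>
  proof -
    obtain x where x: "x \<in> U" "\<alpha> = coset W x" using \<alpha> by (auto simp: quotient_space_def)
    show ?thesis
      using lin_subspaceD[OF X] x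
      by (auto simp: quotient_dual_def quotient_space_def b' pairing_add_right pairing_Const_right)
  qed
  have bij1: "bij_betw (\<lambda>\<alpha>. restrict (b' \<alpha>) (quotient_space X Y)) (quotient_space U W) (quotient_dual X Y)"
  proof (rule bij_betwI')
    fix \<alpha> \<alpha>' assume "\<alpha> \<in> quotient_space U W" "\<alpha>' \<in> quotient_space U W"
    then obtain x x' where x: "x \<in> U" "\<alpha> = coset W x" "x' \<in> U" "\<alpha>' = coset W x'"
      by (auto simp: quotient_space_def)
    have "\<alpha> = \<alpha>'" if eq: "restrict (b' \<alpha>) (quotient_space X Y) = restrict (b' \<alpha>') (quotient_space X Y)"
    proof -
      have "pairing (x - x') y = 0" if "y \<in> X" for y
        using fun_cong[OF eq, of "coset Y y"] that x by (simp add: quotient_space_def b' pairing_diff_left)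
      moreover have "x - x' \<in> forms r i"
        using x U lin_subspaceD(4)[OF U(1)] by blast
      ultimately have "x - x' \<in> W"
        using pairing_separates[OF W Wf] by (simp add: X_def)
      then show ?thesis using x coset_eq_iff[OF W] by simp
    qed
    then show "(restrict (b' \<alpha>) (quotient_space X Y) = restrict (b' \<alpha>') (quotient_space X Y)) = (\<alpha> = \<alpha>')"
      by auto
  next
    fix \<phi> assume \<phi>: "\<phi> \<in> quotient_dual X Y"
    have "\<exists>x\<in>forms r i. \<forall>y\<in>X. \<phi> (coset Y y) = pairing y x"
      by (rule form_functional_represented[OF X Xf]) (use \<phi> in \<open>auto simp: quotient_dual_def\<close>)
    then obtain x where x: "x \<in> forms r i" "\<And>y. y \<in> X \<Longrightarrow> \<phi> (coset Y y) = pairing y x" by blast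
    have \<phi>0: "\<phi> (coset Y 0) = 0"
      by (rule quotient_dual_zero[OF X \<phi>])
    \<comment> \<open>A functional on the quotient by \<open>Y\<close> vanishes on \<open>Y\<close>,
      so its representing form is orthogonal to the orthogonal complement of
      \<open>U\<close>.\<close>
    have "x \<in> U"
    proof (rule pairing_separates[OF U x(1)])
      fix q assume q: "q \<in> perp_deg r i U"
      then have "q \<in> Y" "q \<in> X" using YX by (auto simp: Y_def)
      then have "coset Y q = coset Y 0" using coset_eq_iff[OF Y] by simp
      then show "pairing x q = 0" using x(2)[OF \<open>q \<in> X\<close>] \<phi>0 by (simp add: pairing_commute)
    qed
    moreover have "\<phi> = restrict (b' (coset W x)) (quotient_space X Y)"
    proof (rule extensionalityI[of _ "quotient_space X Y"])
      show "\<phi> \<in> extensional (quotient_space X Y)" using \<phi> by (simp add: quotient_dual_def)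
      fix \<xi> assume "\<xi> \<in> quotient_space X Y"
      then show "\<phi> \<xi> = restrict (b' (coset W x)) (quotient_space X Y) \<xi>"
        using b'[OF \<open>x \<in> U\<close>] x(2) by (auto simp: quotient_space_def pairing_commute)
    qed simp
    ultimately show "\<exists>\<alpha>\<in>quotient_space U W. \<phi> = restrict (b' \<alpha>) (quotient_space X Y)"
      by (auto simp: quotient_space_def)
  qed (rule in_dual)
  have bij2: "bij_betw (\<lambda>\<xi>. restrict (\<lambda>\<alpha>. b' \<alpha> \<xi>) (quotient_space U W)) (quotient_space X Y) (quotient_dual U W)"
  proof (rule bij_betwI')
    fix \<xi> \<xi>' assume "\<xi> \<in> quotient_space X Y" "\<xi>' \<in> quotient_space X Y"
    then obtain y y' where y: "y \<in> X" "\<xi> = coset Y y" "y' \<in> X" "\<xi>' = coset Y y'"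
      by (auto simp: quotient_space_def)
    have "\<xi> = \<xi>'" if eq: "restrict (\<lambda>\<alpha>. b' \<alpha> \<xi>) (quotient_space U W) = restrict (\<lambda>\<alpha>. b' \<alpha> \<xi>') (quotient_space U W)"
    proof -
      have "pairing x (y - y') = 0" if "x \<in> U" for x
        using fun_cong[OF eq, of "coset W x"] that y by (simp add: quotient_space_def b' pairing_diff_right)
      moreover have "y - y' \<in> forms r i"
        using y Xf lin_subspaceD(4)[OF X] by blast
      ultimately have "y - y' \<in> Y" by (simp add: Y_def perp_deg_def)
      then show ?thesis using y coset_eq_iff[OF Y] by simp
    qed
    then show "(restrict (\<lambda>\<alpha>. b' \<alpha> \<xi>) (quotient_space U W) = restrict (\<lambda>\<alpha>. b' \<alpha> \<xi>') (quotient_space U W)) = (\<xi> = \<xi>')"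
      by auto
  next
    fix \<xi> assume "\<xi> \<in> quotient_space X Y"
    then obtain y where y: "y \<in> X" "\<xi> = coset Y y" by (auto simp: quotient_space_def)
    then show "restrict (\<lambda>\<alpha>. b' \<alpha> \<xi>) (quotient_space U W) \<in> quotient_dual U W"
      using lin_subspaceD[OF U(1)]
      by (auto simp: quotient_dual_def quotient_space_def b' pairing_add_left pairing_Const_left)
  next
    fix \<phi> assume \<phi>: "\<phi> \<in> quotient_dual U W"
    have "\<exists>y\<in>forms r i. \<forall>x\<in>U. \<phi> (coset W x) = pairing x y"
      by (rule form_functional_represented[OF U]) (use \<phi> in \<open>auto simp: quotient_dual_def\<close>)
    then obtain y where y: "y \<in> forms r i" "\<And>x. x \<in> U \<Longrightarrow> \<phi> (coset W x) = pairing x y" by blast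
    have \<phi>0: "\<phi> (coset W 0) = 0"
      by (rule quotient_dual_zero[OF U(1) \<phi>])
    have "pairing x y = 0" if x: "x \<in> W" for x
    proof -
      have "coset W x = coset W 0" using coset_eq_iff[OF W] x by simp
      then show ?thesis using y(2)[of x] WU x \<phi>0 by auto
    qed
    then have yX: "y \<in> X" using y(1) by (simp add: X_def perp_deg_def)
    moreover have "\<phi> = restrict (\<lambda>\<alpha>. b' \<alpha> (coset Y y)) (quotient_space U W)"
    proof (rule extensionalityI[of _ "quotient_space U W"])
      show "\<phi> \<in> extensional (quotient_space U W)" using \<phi> by (simp add: quotient_dual_def)
      fix \<alpha> assume "\<alpha> \<in> quotient_space U W"
      then show "\<phi> \<alpha> = restrict (\<lambda>\<alpha>. b' \<alpha> (coset Y y)) (quotient_space U W) \<alpha>"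
        using b'[OF _ yX] y(2) by (auto simp: quotient_space_def)
    qed simp
    ultimately show "\<exists>\<xi>\<in>quotient_space X Y. \<phi> = restrict (\<lambda>\<alpha>. b' \<alpha> \<xi>) (quotient_space U W)"
      by (auto simp: quotient_space_def)
  qed
  have "induces_perfect_pairing pairing U W X Y"
    unfolding induces_perfect_pairing_def
    using WU YX b' bij1 bij2 by blast
  moreover have "quotient_iso_dual U W X Y"
    unfolding quotient_iso_dual_def
  proof (intro exI conjI)
    show "\<forall>x\<in>U. \<forall>y\<in>U. \<forall>\<xi>\<in>quotient_space X Y.
        restrict (b' (coset W (x + y))) (quotient_space X Y) \<xi>
        = restrict (b' (coset W x)) (quotient_space X Y) \<xi> + restrict (b' (coset W y)) (quotient_space X Y) \<xi>"
      using lin_subspaceD[OF U(1)] by (auto simp: quotient_space_def b' pairing_add_left)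
    show "\<forall>c. \<forall>x\<in>U. \<forall>\<xi>\<in>quotient_space X Y.
        restrict (b' (coset W (Const c * x))) (quotient_space X Y) \<xi>
        = c * restrict (b' (coset W x)) (quotient_space X Y) \<xi>"
      using lin_subspaceD[OF U(1)] by (auto simp: quotient_space_def b' pairing_Const_left)
  qed (rule bij1)
  ultimately show ?thesis ..
qed


section \<open>Transposes of linear substitutions\<close>

text \<open>The image of the monomial \<open>m\<close> under the substitution of \<open>f j\<close>
  for the variable \<open>j\<close>.\<close>

definition mon :: "('k \<Rightarrow> 'a::comm_semiring_1) \<Rightarrow> 'k mono \<Rightarrow> 'a"
  where "mon f m = (\<Prod>j\<in>supp m. f j ^ coef m j)"

lemma mon_superset: "finite S \<Longrightarrow> supp m \<subseteq> S \<Longrightarrow> mon f m = (\<Prod>j\<in>S. f j ^ coef m j)"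
  unfolding mon_def by (rule prod.mono_neutral_left) (auto simp: in_keys_iff)

lemma mon_0 [simp]: "mon f 0 = 1"
  by (simp add: mon_def)

lemma mon_monom1 [simp]: "mon f (monom1 j (Suc 0)) = f j"
  by (simp add: mon_def)

lemma mon_add: "mon f (m + n) = mon f m * mon f n"
proof -
  let ?S = "supp m \<union> supp n"
  show ?thesis
    by (simp add: mon_superset[of ?S] supp_add_mono lookup_add power_add prod.distrib)
qed

text \<open>Both conditions serve the finite support of the transpose \<open>adjm\<close>: degrees
  are preserved, and only finitely many variables survive the substitution even if the index type is
  infinite.\<close>

definition linear_forms :: "('k \<Rightarrow> 'l cpoly) \<Rightarrow> bool"
  where "linear_forms f \<longleftrightarrow> (\<forall>j. homog 1 (f j)) \<and> finite {j. f j \<noteq> 0}"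

lemma homog_prod:
  "(\<And>x. x \<in> S \<Longrightarrow> homog (d x) (f x)) \<Longrightarrow> homog (sum d S) (prod f S)"
  by (induction S rule: infinite_finite_induct) (auto simp: homog_1 intro: homog_mult)

lemma homog_mon:
  assumes "linear_forms f"
  shows "homog (tdeg k) (mon f k)"
  unfolding mon_def tdeg_def using assms homog_power[of 1]
  by (intro homog_prod) (auto simp: linear_forms_def)

text \<open>The transpose, for the pairing, of the substitution of the linear forms \<open>f\<close> for the
  variables.\<close>

definition adjm :: "('k \<Rightarrow> 'l cpoly) \<Rightarrow> 'l cpoly \<Rightarrow> 'k cpoly"
  where "adjm f q = Abs_poly_mapping (\<lambda>k. pairing (mon f k) q / mfact k)"

text \<open>A nonzero value forces \<open>k\<close> to have the degree of some monomial of
  \<open>q\<close> and to involve only variables with \<open>f j \<noteq> 0\<close>; this leaves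
  finitely many \<open>k\<close>, so the abstraction to a polynomial is legitimate.\<close>

lemma coef_adjm:
  assumes f: "linear_forms f"
  shows "coef (adjm f q) k = pairing (mon f k) q / mfact k"
proof -
  let ?S = "{j. f j \<noteq> 0}"
  have "{k. pairing (mon f k) q / mfact k \<noteq> 0} \<subseteq> (\<Union>d\<in>tdeg ` supp q. {k. supp k \<subseteq> ?S \<and> tdeg k = d})"
  proof
    fix k assume "k \<in> {k. pairing (mon f k) q / mfact k \<noteq> 0}"
    then have nz: "pairing (mon f k) q \<noteq> 0" by auto
    then obtain m where m: "m \<in> supp q" "coef (mon f k) m \<noteq> 0"
      unfolding pairing_eq by (metis (no_types, lifting) mult_zero_right sum.neutral)
    have "tdeg k = tdeg m" using homogD[OF homog_mon[OF f] m(2)] by simp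
    moreover have "supp k \<subseteq> ?S"
    proof
      fix j assume j: "j \<in> supp k"
      have "mon f k \<noteq> 0" using nz by auto
      then have "f j ^ coef k j \<noteq> 0"
        unfolding mon_def using j by (metis finite_keys prod_zero)
      then show "j \<in> ?S" using j by (auto simp: in_keys_iff zero_power)
    qed
    ultimately show "k \<in> (\<Union>d\<in>tdeg ` supp q. {k. supp k \<subseteq> ?S \<and> tdeg k = d})"
      using m(1) by blast
  qed
  moreover have "finite (\<Union>d\<in>tdeg ` supp q. {k. supp k \<subseteq> ?S \<and> tdeg k = d})"
    using f by (auto simp: linear_forms_def intro: finite_homogeneous_monos)
  ultimately have "finite {k. pairing (mon f k) q / mfact k \<noteq> 0}"
    by (rule finite_subset)
  then show ?thesis by (simp add: adjm_def)
qed

lemma pairing_adjm: "linear_forms f \<Longrightarrow> pairing (monom1 k 1) (adjm f q) = pairing (mon f k) q"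
  by (simp add: pairing_monom1_left coef_adjm)

lemma adjm_add: "linear_forms f \<Longrightarrow> adjm f (p + q) = adjm f p + adjm f q"
  by (rule pairing_eqI) (simp add: pairing_adjm pairing_add_right)

lemma adjm_Const_mult: "linear_forms f \<Longrightarrow> adjm f (Const c * q) = Const c * adjm f q"
  by (rule pairing_eqI) (simp add: pairing_adjm pairing_Const_right)

lemma adjm_0 [simp]: "linear_forms f \<Longrightarrow> adjm f 0 = 0"
  by (rule pairing_eqI) (simp add: pairing_adjm)

lemma coef_adjm_0: "linear_forms f \<Longrightarrow> coef (adjm f q) 0 = coef q 0"
  using pairing_monom1_left[of 0 1 q] by (simp add: coef_adjm)

lemma adjm_homog:
  assumes "linear_forms f" "homog i q"
  shows "homog i (adjm f q)"
proof (rule homogI)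
  fix k assume "coef (adjm f q) k \<noteq> 0"
  then have "pairing (mon f k) q \<noteq> 0" by (simp add: coef_adjm[OF assms(1)])
  then show "tdeg k = i"
    using pairing_homog_neq[OF homog_mon[OF assms(1)] assms(2)] by blast
qed

text \<open>This is the transpose of the multiplicativity of substitution: raising the exponent of
  \<open>j\<close> by one multiplies the substituted monomial by \<open>f j\<close>.\<close>

lemma diff_op_Var_adjm:
  assumes "linear_forms f"
  shows "diff_op (Var j) (adjm f q) = adjm f (diff_op (f j) q)"
proof (rule pairing_eqI)
  fix m
  have "monom1 m 1 * Var j = (monom1 (m + monom1 j 1) 1 :: 'a cpoly)"
    by (simp add: Var_def mult_single)
  then show "pairing (monom1 m 1) (diff_op (Var j) (adjm f q)) = pairing (monom1 m 1) (adjm f (diff_op (f j) q))"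
    by (simp add: pairing_diff_op pairing_adjm[OF assms] mon_add)
qed

lemma diff_op_linear_adjm:
  assumes "linear_forms f"
  shows "diff_op (\<Sum>j\<in>S. Const (c j) * Var j) (adjm f q) = adjm f (diff_op (\<Sum>j\<in>S. Const (c j) * f j) q)"
  by (induction S rule: infinite_finite_induct)
    (simp_all add: assms diff_op_add_left adjm_add adjm_Const_mult diff_op_Const_mult_left diff_op_Var_adjm)

lemma diff_op_prod_adjm:
  assumes "linear_forms f"
  shows "diff_op (\<Prod>j\<in>S. Var j) (adjm f q) = adjm f (diff_op (\<Prod>j\<in>S. f j) q)"
  by (induction S rule: infinite_finite_induct)
    (simp_all add: assms diff_op_mult diff_op_Var_adjm)

text \<open>A polynomial is determined by the constant terms of all its derivatives, and the
  hypotheses let derivatives pass through \<open>T\<close>. It is applied to the two composites of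
  \<open>log_poly\<close> with its inverse, whose coefficients would be awkward to compare
  directly.\<close>

lemma eq_if_commutes_with_derivatives:
  fixes T :: "'k cpoly \<Rightarrow> 'k cpoly"
  assumes "q \<in> Q" and closed: "\<And>j q. q \<in> Q \<Longrightarrow> diff_op (Var j) q \<in> Q"
    and comm: "\<And>j q. q \<in> Q \<Longrightarrow> diff_op (Var j) (T q) = T (diff_op (Var j) q)"
    and zero: "\<And>q. q \<in> Q \<Longrightarrow> coef (T q) 0 = coef q 0"
  shows "T q = q"
proof -
  have "\<forall>m q. q \<in> Q \<longrightarrow> tdeg m = d \<longrightarrow> pairing (monom1 m 1) (T q) = pairing (monom1 m 1) q" for d
  proof (induction d)
    case 0
    then show ?case by (simp add: tdeg_eq_0_iff pairing_1_left zero)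
  next
    case (Suc d)
    show ?case
    proof (intro allI impI)
      fix m :: "'k mono" and q assume q: "q \<in> Q" and m: "tdeg m = Suc d"
      then have "m \<noteq> 0" by auto
      then obtain j where "coef m j \<noteq> 0"
        by (metis lookup_zero poly_mapping_eqI)
      \<comment> \<open>Splitting off one variable turns the pairing with \<open>m\<close> into the
        pairing of the \<open>j\<close>-th derivative with a monomial of degree
        \<open>d\<close>.\<close>
      then obtain n where n: "m = monom1 j 1 + n"
        using mono_le_iff[where m = "monom1 j 1" and n = m] by (auto simp: lookup_single when_def)
      have "monom1 m (1::complex) = monom1 n 1 * Var j"
        by (simp add: n Var_def mult_single add.commute)
      moreover have "tdeg n = d" using m by (simp add: n tdeg_add)
      ultimately show "pairing (monom1 m 1) (T q) = pairing (monom1 m 1) q"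
        using Suc.IH q closed by (simp add: pairing_diff_op[symmetric] comm)
    qed
  qed
  then show ?thesis using \<open>q \<in> Q\<close> by (intro pairing_eqI) blast
qed

section \<open>The exponential series as a generating function\<close>

lemma coef_Var_mult:
  fixes p :: "('k mono) \<Rightarrow>\<^sub>0 'a::comm_semiring_1"
  shows "coef (Var j * p) m = (if coef m j = 0 then 0 else coef p (m - monom1 j 1))"
proof (cases "coef m j = 0")
  case True
  then have "m \<noteq> monom1 j 1 + k" for k by (auto simp: lookup_add)
  then show ?thesis using True by (simp add: Var_def coef_monom1_mult_outside)
next
  case False
  then obtain n where n: "m = monom1 j 1 + n"
    using mono_le_iff[where m = "monom1 j 1" and n = m] by (auto simp: lookup_single when_def)
  then show ?thesis
    using False by (simp add: Var_def coef_monom1_mult_add)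
qed

lemma linear_forms_ell: "linear_forms (ell r B :: 'n::finite \<Rightarrow> nat cpoly)"
  by (auto simp: linear_forms_def ell_def intro!: homog_sum homog_Const_mult)

lemma ell_Sring: "ell r B j \<in> Sring r"
  by (auto simp: ell_def intro!: Sring_sum Sring_mult Sring_Var)

lemma ellp_Sring: "ellp r B Y \<in> Sring r"
  by (auto simp: ellp_def intro!: Sring_prod ell_Sring)

lemma homog_ellp: "homog (card Y) (ellp r B (Y :: 'n::finite set))"
  using linear_forms_ell[of r B] unfolding ellp_def
  by (intro homog_prod_linear) (auto simp: linear_forms_def)

lemma mfact_add_monom1: "mfact (monom1 j 1 + n) = of_nat (coef n j + 1) * mfact n"
proof -
  let ?S = "insert j (supp n)"
  have "mfact (monom1 j 1 + n) = (\<Prod>i\<in>?S. fact (coef (monom1 j 1 + n) i))"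
    by (rule mfact_superset) (auto simp: supp_add_mono)
  also have "\<dots> = (\<Prod>i\<in>?S. (if i = j then of_nat (coef n j + 1) else 1) * fact (coef n i))"
    by (rule prod.cong) (auto simp: lookup_add lookup_single when_def)
  also have "\<dots> = of_nat (coef n j + 1) * mfact n"
    unfolding prod.distrib mfact_superset[OF _ subset_insertI[of "supp n" j], simplified]
    by (simp add: prod.delta)
  finally show ?thesis .
qed

text \<open>The multinomial theorem for \<open>(\<Sum>\<^sub>j y\<^sub>j \<ell>\<^sub>j)\<^sup>t\<close>.\<close>

lemma coef_log_form_power:
  fixes B :: "nat \<Rightarrow> int ^ 'n"
  shows "coef (coef (log_form r B ^ t) m) k
    = (if tdeg k = t then fact t / mfact k * coef (mon (ell r B) k) m else 0)"
proof (induction t arbitrary: m k)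
  case 0
  then show ?case by (auto simp: tdeg_eq_0_iff lookup_one when_def)
next
  case (Suc t)
  let ?X = "log_form r B ^ t"
  have "coef (coef (log_form r B * ?X) m) k
    = (\<Sum>j\<in>UNIV. \<Sum>i<r. coef (Const (of_int (B i $ j)) * (Var j * coef (Var i * ?X) m)) k)"
    by (simp add: log_form_def sum_distrib_right lookup_sum mult.assoc)
  also have "\<dots> = (\<Sum>j\<in>UNIV. if coef k j = 0 then 0 else
      if tdeg k = Suc t then fact t * of_nat (coef k j) / mfact k * coef (mon (ell r B) k) m else 0)"
  proof (rule sum.cong[OF refl])
    fix j :: 'n
    show "(\<Sum>i<r. coef (Const (of_int (B i $ j)) * (Var j * coef (Var i * ?X) m)) k)
      = (if coef k j = 0 then 0 else
         if tdeg k = Suc t then fact t * of_nat (coef k j) / mfact k * coef (mon (ell r B) k) m else 0)"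
    proof (cases "coef k j = 0")
      case False
      then obtain n where n: "k = monom1 j 1 + n"
        using mono_le_iff[where m = "monom1 j 1" and n = k] by (auto simp: lookup_single when_def)
      have mf: "mfact k = of_nat (coef k j) * mfact n"
        unfolding n mfact_add_monom1 by (simp add: lookup_add)
      have td: "tdeg k = Suc (tdeg n)"
        by (simp add: n tdeg_add)
      have "(\<Sum>i<r. coef (Const (of_int (B i $ j)) * (Var j * coef (Var i * ?X) m)) k)
        = (\<Sum>i<r. of_int (B i $ j) * coef (coef (Var i * ?X) m) n)"
        using False by (simp add: coef_Var_mult[of j] n)
      also have "\<dots> = (if tdeg n = t then fact t / mfact n *
            (\<Sum>i<r. of_int (B i $ j) * coef (Var i * mon (ell r B) n) m) else 0)"
      proof -
        have "coef (coef (Var i * ?X) m) n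
          = (if tdeg n = t then fact t / mfact n * coef (Var i * mon (ell r B) n) m else 0)" for i
          by (simp add: coef_Var_mult Suc.IH)
        then show ?thesis
          by (simp add: sum_distrib_left mult.left_commute)
      qed
      also have "(\<Sum>i<r. of_int (B i $ j) * coef (Var i * mon (ell r B) n) m) = coef (mon (ell r B) k) m"
        by (simp add: n mon_add ell_def sum_distrib_right lookup_sum mult.assoc)
      finally show ?thesis
        using False by (simp add: td mf)
    qed (simp add: coef_Var_mult)
  qed
  also have "\<dots> = (if tdeg k = Suc t then
      (\<Sum>j\<in>UNIV. of_nat (coef k j)) * (fact t / mfact k * coef (mon (ell r B) k) m) else 0)"
    unfolding sum_distrib_right by (cases "tdeg k = Suc t") (auto intro!: sum.cong sum.neutral)
  \<comment> \<open>Removing one factor y_j from y^k contributes the weight k_j; the weights add up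
    to the degree t + 1 and complete the factorial.\<close>
  also have "(\<Sum>j\<in>UNIV. of_nat (coef k j)) = (of_nat (tdeg k) :: complex)"
    by (simp add: tdeg_superset[of UNIV])
  finally show ?case by simp
qed

text \<open>Only the power \<open>t = tdeg k\<close> contributes to y^k. The truncation at
  \<open>tdeg m\<close> loses nothing, since the substituted monomial is homogeneous of degree
  \<open>tdeg k\<close> and its coefficient at \<open>m\<close> vanishes unless the degrees
  agree.\<close>

lemma coef_exp_series: "coef (exp_series r B m) k = coef (mon (ell r B) k) m / mfact k"
proof -
  have "coef (exp_series r B m) k = (\<Sum>t\<le>tdeg m. 1 / fact t * coef (coef (log_form r B ^ t) m) k)"
    by (simp add: exp_series_def lookup_sum)
  also have "\<dots> = (\<Sum>t\<le>tdeg m. if t = tdeg k then coef (mon (ell r B) k) m / mfact k else 0)"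
    by (rule sum.cong) (auto simp: coef_log_form_power)
  also have "\<dots> = coef (mon (ell r B) k) m / mfact k"
  proof (cases "coef (mon (ell r B) k) m = 0")
    case False
    then have "tdeg m = tdeg k" by (rule homogD[OF homog_mon[OF linear_forms_ell]])
    then show ?thesis by (simp add: sum.delta)
  qed (simp add: sum.neutral)
  finally show ?thesis .
qed

lemma coef_at_zero: "coef (at_zero q \<Phi>) k = (\<Sum>m\<in>supp q. coef q m * mfact m * coef (\<Phi> m) k)"
  by (simp add: at_zero_def lookup_sum mfact_def)

text \<open>The exponential is the sum of ell^k y^k / k! over all \<open>k\<close>, so applying
  \<open>q\<close> at s = 0 leaves the pairing of ell^k with \<open>q\<close>, divided by k!, as the
  coefficient of y^k.\<close>

lemma log_poly_eq_adjm: "log_poly r B q = adjm (ell r B) q"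
  by (rule poly_mapping_eqI)
    (simp add: log_poly_def coef_at_zero coef_exp_series coef_adjm[OF linear_forms_ell] pairing_eq
      sum_divide_distrib)

lemma prod_fun_exp_series:
  "coef (prod_fun (\<lambda>m. Const (coef g m)) (exp_series r B) m) k = coef (g * mon (ell r B) k) m / mfact k"
proof -
  have fin: "finite {l. Const (coef g l) * (\<Sum>q. (exp_series r B q when m = l + q)) \<noteq> 0}"
    by (rule finite_subset[OF _ finite_keys[of g]]) (auto simp: in_keys_iff)
  have inner: "coef (\<Sum>q. (exp_series r B q when m = l + q)) k
      = (\<Sum>q. (coef (mon (ell r B) k) q when m = l + q)) / mfact k" for l
  proof (cases "\<exists>q. m = l + q")
    case True
    then obtain p where "m = l + p" by blast
    then show ?thesis by (simp add: coef_exp_series)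
  next
    case False
    then show ?thesis by (simp add: when_def)
  qed
  have "coef (prod_fun (\<lambda>m. Const (coef g m)) (exp_series r B) m) k
    = coef (\<Sum>l\<in>supp g. Const (coef g l) * (\<Sum>q. (exp_series r B q when m = l + q))) k"
    unfolding prod_fun_def
    by (subst Sum_any.expand_superset[of "supp g"]) (auto simp: in_keys_iff)
  also have "\<dots> = (\<Sum>l\<in>supp g. coef g l * (\<Sum>q. (coef (mon (ell r B) k) q when m = l + q))) / mfact k"
    by (simp add: lookup_sum inner sum_divide_distrib)
  also have "(\<Sum>l\<in>supp g. coef g l * (\<Sum>q. (coef (mon (ell r B) k) q when m = l + q)))
    = coef (g * mon (ell r B) k) m"
    unfolding lookup_mult
    by (subst Sum_any.expand_superset[of "supp g"]) (auto simp: in_keys_iff)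
  finally show ?thesis .
qed

text \<open>At u = 0 both falling factorials are 1, so the coefficient of x^v in Psi is ell^E times
  the exponential. Multiplying by ell^E before applying \<open>q\<close> at s = 0 has the same
  effect as letting ell^E differentiate \<open>q\<close>.\<close>

lemma intrinsic_series_0:
  assumes "nsupp v \<in> N"
  shows "intrinsic_series A r B v N q 0 = log_poly r B (diff_op (ellp r B (Eset v N)) q)"
proof -
  let ?g = "ellp r B (Eset v N)"
  have pp: "pos_part (0 :: int ^ 'a) = 0" "neg_part (0 :: int ^ 'a) = 0"
    by (simp_all add: pos_part_def neg_part_def)
  have s0: "shift v 0 = v" by (simp add: shift_def vec_eq_iff)
  have one: "prod_fun (coef 1) c = c" for c :: "nat mono \<Rightarrow> complex"
  proof
    fix m
    have "prod_fun (coef 1) c m = (\<Sum>l\<in>{0}. coef 1 l * (\<Sum>q. (c q when m = l + q)))"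
      unfolding prod_fun_def
      by (rule Sum_any.expand_superset) (auto simp: lookup_one when_def)
    then show "prod_fun (coef 1) c m = c m" by simp
  qed
  have "ma_series r B v N 0 = coef ?g"
    by (simp add: ma_series_def shifted_bracket_def pp bracket_def one)
  then have Psi: "Psi A r B v N 0 = prod_fun (\<lambda>m. Const (coef ?g m)) (exp_series r B)"
    using assms by (simp add: Psi_def s0 ker_lattice_def)
  show ?thesis
  proof (rule poly_mapping_eqI)
    fix k
    have "coef (intrinsic_series A r B v N q 0) k = pairing (?g * mon (ell r B) k) q / mfact k"
      by (simp add: intrinsic_series_def coef_at_zero Psi prod_fun_exp_series pairing_eq sum_divide_distrib)
    also have "\<dots> = coef (log_poly r B (diff_op ?g q)) k"
      by (simp add: log_poly_eq_adjm coef_adjm[OF linear_forms_ell] pairing_diff_op mult.commute)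
    finally show "coef (intrinsic_series A r B v N q 0) k = coef (log_poly r B (diff_op ?g q)) k" .
  qed
qed


section \<open>Gale duality\<close>

lemma common_denominator:
  fixes x :: "'i \<Rightarrow> rat"
  assumes "finite S"
  shows "\<exists>d z. d \<noteq> 0 \<and> (\<forall>k\<in>S. of_int d * x k = of_int (z k))"
  using assms
proof (induction S rule: finite_induct)
  case empty
  then show ?case by (auto intro: exI[of _ 1])
next
  case (insert a S)
  then obtain d z where d: "d \<noteq> 0" "\<And>k. k \<in> S \<Longrightarrow> of_int d * x k = of_int (z k)" by blast
  obtain p q where pq: "x a = of_int p / of_int q" "q > 0"
    by (metis Fract_of_int_quotient Rat_cases)
  have "of_int (d * q) * x k = of_int (((\<lambda>k. q * z k)(a := d * p)) k)" if "k \<in> insert a S" for k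
    using that d(2)[of k] pq by (cases "k = a") (auto simp: field_simps)
  moreover have "d * q \<noteq> 0" using d(1) pq(2) by simp
  ultimately show ?case by blast
qed

lemma module_int_vec: "module ((*s) :: int \<Rightarrow> int ^ 'n \<Rightarrow> int ^ 'n)"
  by unfold_locales (simp_all add: vec_eq_iff algebra_simps)

lemma gale_dualD:
  assumes "gale_dual A r B"
  shows "inj_on B {..<r}" "\<not> module.dependent (*s) (B ` {..<r})"
    "module.span (*s) (B ` {..<r}) = ker_lattice A"
  using assms unfolding gale_dual_def by blast+

lemma gale_dual_mem:
  assumes "gale_dual A r B" "k < r"
  shows "B k \<in> ker_lattice A"
  using assms module.span_base[OF module_int_vec, of "B k" "B ` {..<r}"] by (auto simp: gale_dualD(3))

lemma gale_dual_sum: "(\<Sum>v\<in>B ` {..<r}. u v *s v) = (\<Sum>k<r. u (B k) *s B k)" if "gale_dual A r B"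
  by (simp add: sum.reindex[OF gale_dualD(1)[OF that]])

lemma gale_dual_span:
  assumes "gale_dual A r B" "u \<in> ker_lattice A"
  shows "\<exists>z. u = (\<Sum>k<r. z k *s B k)"
proof -
  have "ker_lattice A = range (\<lambda>u. \<Sum>v\<in>B ` {..<r}. u v *s v)"
    using module.span_finite[OF module_int_vec, of "B ` {..<r}"] by (simp add: gale_dualD(3)[OF assms(1)])
  then obtain f where "u = (\<Sum>v\<in>B ` {..<r}. f v *s v)" using assms(2) by blast
  then show ?thesis using gale_dual_sum[OF assms(1)] by auto
qed

lemma gale_dual_indep:
  assumes "gale_dual A r B" "(\<Sum>k<r. z k *s B k) = 0" "k < r"
  shows "z k = 0"
proof (rule ccontr)
  assume z: "z k \<noteq> 0"
  let ?u = "\<lambda>v. z (inv_into {..<r} B v)"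
  note inj = gale_dualD(1)[OF assms(1)]
  have "(\<Sum>v\<in>B ` {..<r}. ?u v *s v) = (\<Sum>k<r. z k *s B k)"
    unfolding gale_dual_sum[OF assms(1)] using inj by (intro sum.cong) simp_all
  moreover have "?u (B k) \<noteq> 0" using z inj assms(3) by simp
  ultimately have "module.dependent (*s) (B ` {..<r})"
    unfolding module.dependent_finite[OF module_int_vec finite_imageI[OF finite_lessThan]]
    using assms(2,3) by auto
  then show False using gale_dualD(2)[OF assms(1)] by blast
qed

text \<open>Clearing denominators turns the \<open>\<int>\<close>-basis property into rational matrices \<open>R\<close>, \<open>D\<close>
  with \<open>R B = 1\<close> and \<open>B R + D A = 1\<close>.\<close>

lemma gale_dual_left_inverse:
  fixes A :: "int ^ 'n ^ 'd"
  assumes "gale_dual A r B"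
  shows "\<exists>R :: nat \<Rightarrow> 'n \<Rightarrow> rat. \<forall>k<r. \<forall>l<r. (\<Sum>j\<in>UNIV. R k j * of_int (B l $ j)) = (if k = l then 1 else 0)"
proof -
  \<comment> \<open>The coordinate x_k must be a combination of the coordinates of B x. It suffices
    that B x = 0 forces x_k = 0, and after clearing denominators this is integral independence of
    the columns.\<close>
  have "\<exists>c :: 'n \<Rightarrow> rat. \<forall>x\<in>UNIV. x k = (\<Sum>j\<in>UNIV. c j * (\<Sum>l<r. of_int (B l $ j) * x l))" if k: "k < r" for k
  proof (rule functional_in_span[where add = "\<lambda>x y i. x i + y i" and scl = "\<lambda>c x i. c * x i"
        and coord = "\<lambda>j x. \<Sum>l<r. of_int (B l $ j) * x l"])
    fix x :: "nat \<Rightarrow> rat"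
    assume x: "\<And>j. j \<in> UNIV \<Longrightarrow> (\<Sum>l<r. of_int (B l $ j) * x l) = 0"
    obtain d z where d: "d \<noteq> 0" "\<forall>k\<in>{..<r}. of_int d * x k = of_int (z k)"
      using common_denominator[of "{..<r}" x] by auto
    have "(\<Sum>l<r. z l *s B l) = 0"
    proof (subst vec_eq_iff, rule allI)
      fix j
      have "rat_of_int ((\<Sum>l<r. z l *s B l) $ j) = (\<Sum>l<r. of_int d * x l * of_int (B l $ j))"
        using d(2) by simp
      also have "\<dots> = of_int d * (\<Sum>l<r. of_int (B l $ j) * x l)"
        by (simp add: sum_distrib_left mult_ac)
      finally have "rat_of_int ((\<Sum>l<r. z l *s B l) $ j) = 0" using x by simp
      then show "(\<Sum>l<r. z l *s B l) $ j = 0 $ j" by (simp only: of_int_eq_0_iff zero_index)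
    qed
    then have "z k = 0" by (rule gale_dual_indep[OF assms _ k])
    then have "rat_of_int d * x k = 0" using d k by simp
    then show "x k = 0" using d(1) by simp
  qed (simp_all add: sum.distrib algebra_simps sum_distrib_left)
  then have "\<forall>k. \<exists>c :: 'n \<Rightarrow> rat. k < r \<longrightarrow> (\<forall>x. x k = (\<Sum>j\<in>UNIV. c j * (\<Sum>l<r. of_int (B l $ j) * x l)))"
    by auto
  from choice[OF this] obtain R :: "nat \<Rightarrow> 'n \<Rightarrow> rat" where
    R: "\<And>k x. k < r \<Longrightarrow> x k = (\<Sum>j\<in>UNIV. R k j * (\<Sum>l<r. of_int (B l $ j) * x l))"
    by blast
  have "(\<Sum>j\<in>UNIV. R k j * of_int (B l $ j)) = (if k = l then 1 else 0)" if "k < r" "l < r" for k l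
  proof -
    have "(\<Sum>m<r. of_int (B m $ j) * (if m = l then 1 else 0)) = (of_int (B l $ j) :: rat)" for j
      using that by (simp add: if_distrib sum.delta cong: if_cong)
    then show ?thesis
      using R[OF that(1), of "\<lambda>m. if m = l then 1 else 0"] by simp
  qed
  then show ?thesis by blast
qed

text \<open>The rows of \<open>A\<close> and of \<open>R\<close> together separate rational vectors:
  if A x = 0, a multiple of \<open>x\<close> lies in the lattice and equals B t, and R x = 0 with R
  B = 1 gives t = 0. So every coordinate is a combination of these rows. Evaluating on the columns
  of \<open>B\<close>, where \<open>A\<close> vanishes, shows that the coefficients of the rows of
  \<open>R\<close> are the entries of \<open>B\<close>.\<close>

lemma gale_dual_complement:
  fixes A :: "int ^ 'n ^ 'd" and R :: "nat \<Rightarrow> 'n \<Rightarrow> rat"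
  assumes "gale_dual A r B"
    and R: "\<And>k l. k < r \<Longrightarrow> l < r \<Longrightarrow> (\<Sum>j\<in>UNIV. R k j * of_int (B l $ j)) = (if k = l then 1 else 0)"
  shows "\<exists>D :: 'n \<Rightarrow> 'd \<Rightarrow> rat. \<forall>j j'. (\<Sum>k<r. of_int (B k $ j) * R k j') + (\<Sum>i\<in>UNIV. D j i * of_int (A $ i $ j'))
      = (if j = j' then 1 else 0)"
proof -
  define co :: "'d + nat \<Rightarrow> ('n \<Rightarrow> rat) \<Rightarrow> rat" where
    "co e x = (case e of Inl i \<Rightarrow> \<Sum>j\<in>UNIV. of_int (A $ i $ j) * x j | Inr k \<Rightarrow> \<Sum>j\<in>UNIV. R k j * x j)" for e x
  let ?I = "(UNIV :: 'd set) <+> {..<r}"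
  have "\<exists>c. \<forall>x\<in>UNIV. x j = (\<Sum>e\<in>?I. c e * co e x)" for j
  proof (rule functional_in_span[where add = "\<lambda>x y i. x i + y i" and scl = "\<lambda>c x i. c * x i"])
    fix x :: "'n \<Rightarrow> rat"
    assume x: "\<And>e. e \<in> ?I \<Longrightarrow> co e x = 0"
    have Ax: "(\<Sum>j\<in>UNIV. of_int (A $ i $ j) * x j) = 0" for i
      using x[OF InlI[OF UNIV_I], of i] by (simp add: co_def)
    have Rx: "(\<Sum>j\<in>UNIV. R k j * x j) = 0" if "k < r" for k
      using x[OF InrI, of k] that by (simp add: co_def)
    obtain d z where d: "d \<noteq> 0" "\<And>k. of_int d * x k = of_int (z k)"
      using common_denominator[of "UNIV" x] by auto
    have "(\<chi> j. z j) \<in> ker_lattice A"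
    proof -
      have "rat_of_int (\<Sum>j\<in>UNIV. A $ i $ j * z j) = of_int d * (\<Sum>j\<in>UNIV. of_int (A $ i $ j) * x j)" for i
        by (simp add: d(2)[symmetric] sum_distrib_left mult_ac)
      then have "(\<Sum>j\<in>UNIV. A $ i $ j * z j) = 0" for i
        by (simp only: Ax mult_zero_right of_int_eq_0_iff)
      then show ?thesis
        by (simp add: ker_lattice_def vec_eq_iff matrix_vector_mult_def)
    qed
    then obtain t where t: "(\<chi> j. z j) = (\<Sum>k<r. t k *s B k)"
      using gale_dual_span[OF assms(1)] by blast
    have zj: "z j = (\<Sum>k<r. t k * B k $ j)" for j
      using arg_cong[OF t, of "\<lambda>v. v $ j"] by simp
    have "t l = 0" if "l < r" for l
    proof -
      have "0 = of_int d * (\<Sum>j\<in>UNIV. R l j * x j)" using Rx[OF that] by simp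
      also have "\<dots> = (\<Sum>j\<in>UNIV. R l j * of_int (z j))"
        by (simp add: d(2)[symmetric] sum_distrib_left mult_ac)
      also have "\<dots> = (\<Sum>k<r. of_int (t k) * (\<Sum>j\<in>UNIV. R l j * of_int (B k $ j)))"
        unfolding zj by (simp add: sum_distrib_left mult_ac) (rule sum.swap)
      also have "\<dots> = (\<Sum>k<r. if k = l then of_int (t k) else 0)"
        using R[OF that] by (intro sum.cong) auto
      also have "\<dots> = of_int (t l)" using that by (simp add: sum.delta)
      finally show ?thesis by simp
    qed
    then have "z j = 0" by (simp add: zj)
    then have "of_int d * x j = 0" using d(2)[of j] by simp
    then show "x j = 0" using d(1) by simp
  qed (auto simp: co_def sum.distrib algebra_simps sum_distrib_left split: sum.split)
  then have "\<forall>j. \<exists>c. \<forall>x. x j = (\<Sum>e\<in>?I. c e * co e x)" by blast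
  from choice[OF this] obtain c where c: "\<And>j x. x j = (\<Sum>e\<in>?I. c j e * co e x)"
    by blast
  have c': "x j = (\<Sum>i\<in>UNIV. c j (Inl i) * (\<Sum>j\<in>UNIV. of_int (A $ i $ j) * x j))
      + (\<Sum>k<r. c j (Inr k) * (\<Sum>j\<in>UNIV. R k j * x j))" for j x
    using c[of x j] by (simp add: sum.Plus co_def)
  have cB: "c j (Inr l) = of_int (B l $ j)" if l: "l < r" for j l
  proof -
    have "A *v B l = 0"
      using gale_dual_mem[OF assms(1) l] by (simp add: ker_lattice_def)
    then have "(\<Sum>j\<in>UNIV. A $ i $ j * B l $ j) = 0" for i
      by (simp add: vec_eq_iff matrix_vector_mult_def)
    then have AB: "(\<Sum>j\<in>UNIV. rat_of_int (A $ i $ j) * of_int (B l $ j)) = 0" for i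
      by (metis (mono_tags, lifting) of_int_0 of_int_mult of_int_sum sum.cong)
    have "rat_of_int (B l $ j) = (\<Sum>k<r. c j (Inr k) * (if k = l then 1 else 0))"
      using c'[of "\<lambda>j. of_int (B l $ j)" j] R[OF _ l] by (simp add: AB)
    also have "\<dots> = c j (Inr l)" using l by (simp add: if_distrib sum.delta cong: if_cong)
    finally show ?thesis by simp
  qed
  have "(\<Sum>k<r. of_int (B k $ j) * R k j') + (\<Sum>i\<in>UNIV. c j (Inl i) * of_int (A $ i $ j'))
      = (if j = j' then 1 else 0)" for j j'
  proof -
    have d: "(\<Sum>i\<in>UNIV. f i * (if i = j' then 1 else 0)) = f j'" for f :: "'n \<Rightarrow> rat"
      by (simp add: if_distrib sum.delta cong: if_cong)
    show ?thesis
      using c'[of "\<lambda>i. if i = j' then 1 else 0" j] cB by (simp add: d)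
  qed
  then show ?thesis by (intro exI[of _ "\<lambda>j i. c j (Inl i)"]) blast
qed

definition euler_form :: "int ^ 'n ^ 'd \<Rightarrow> 'd \<Rightarrow> 'n cpoly"
  where "euler_form A i = (\<Sum>j\<in>UNIV. Const (of_int (A $ i $ j)) * Var j)"

definition euler_kernel :: "int ^ 'n ^ 'd \<Rightarrow> 'n cpoly set"
  where "euler_kernel A = {p. \<forall>i. diff_op (euler_form A i) p = 0}"

lemma diff_op_euler_kernel: "p \<in> euler_kernel A \<Longrightarrow> diff_op q p \<in> euler_kernel A"
  by (simp add: euler_kernel_def diff_op_commute[of _ q])

text \<open>The forms \<open>\<rho>\<close> are the rows of \<open>R\<close>. Substituting ell into
  them returns s_k because R B = 1, so one composite of the transposes is the identity. Substituting
  \<open>\<rho>\<close> into ell_j returns y_j minus a combination of Euler forms because B R = 1 -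
  D A, so the other composite is the identity on polynomials killed by the Euler forms.\<close>

lemma log_poly_coordinates:
  fixes A :: "int ^ 'n ^ 'd"
  assumes B: "gale_dual A r B"
  obtains \<rho> :: "nat \<Rightarrow> 'n cpoly" where "linear_forms \<rho>"
    "\<And>q. q \<in> Sring r \<Longrightarrow> adjm \<rho> (log_poly r B q) = q"
    "\<And>p. p \<in> euler_kernel A \<Longrightarrow> log_poly r B (adjm \<rho> p) = p"
    "\<And>p. adjm \<rho> p \<in> Sring r"
proof -
  obtain R where R: "\<And>k l. k < r \<Longrightarrow> l < r \<Longrightarrow> (\<Sum>j\<in>UNIV. R k j * of_int (B l $ j)) = (if k = l then 1 else 0 :: rat)"
    using gale_dual_left_inverse[OF B] by blast
  obtain D where D: "\<And>j j'. (\<Sum>k<r. of_int (B k $ j) * R k j') + (\<Sum>i\<in>UNIV. D j i * of_int (A $ i $ j'))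
      = (if j = j' then 1 else 0)"
    using gale_dual_complement[OF B R] by blast
  \<comment> \<open>Padding by 0 from index \<open>r\<close> on keeps finitely many nonzero forms
    and forces the image of the transpose into \<open>Sring r\<close>.\<close>
  define \<rho> :: "nat \<Rightarrow> 'n cpoly" where "\<rho> k = (if k < r then \<Sum>j\<in>UNIV. Const (of_rat (R k j)) * Var j else 0)" for k
  have \<rho>: "linear_forms \<rho>"
  proof -
    have "{j. \<rho> j \<noteq> 0} \<subseteq> {..<r}" by (auto simp: \<rho>_def)
    then have "finite {j. \<rho> j \<noteq> 0}" by (rule finite_subset) simp
    then show ?thesis by (auto simp: linear_forms_def \<rho>_def intro!: homog_sum homog_Const_mult)
  qed
  have Rl: "(\<Sum>j\<in>UNIV. Const (of_rat (R k j)) * ell r B j) = Var k" if k: "k < r" for k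
  proof -
    have "(\<Sum>j\<in>UNIV. Const (of_rat (R k j)) * ell r B j)
      = (\<Sum>l<r. Const (\<Sum>j\<in>UNIV. of_rat (R k j) * of_int (B l $ j)) * Var l)"
      by (simp add: ell_def sum_distrib_left sum_distrib_right Const_sum Const_mult mult.assoc) (rule sum.swap)
    also have "\<dots> = (\<Sum>l<r. if l = k then Var l else 0)"
    proof (rule sum.cong[OF refl])
      fix l assume "l \<in> {..<r}"
      then have "(\<Sum>j\<in>UNIV. of_rat (R k j) * of_int (B l $ j)) = (if k = l then 1 else 0 :: complex)"
        using arg_cong[OF R[OF k, of l], of "of_rat :: rat \<Rightarrow> complex"] by (simp add: of_rat_sum of_rat_mult)
      then show "Const (\<Sum>j\<in>UNIV. of_rat (R k j) * of_int (B l $ j)) * Var l = (if l = k then Var l else (0 :: nat cpoly))"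
        by simp
    qed
    finally show ?thesis using k by (simp add: sum.delta)
  qed
  have l\<rho>: "(\<Sum>k<r. Const (of_int (B k $ j)) * \<rho> k)
      = Var j - (\<Sum>i\<in>UNIV. Const (of_rat (D j i)) * euler_form A i)" for j
  proof -
    have 1: "(\<Sum>k<r. Const (of_int (B k $ j)) * \<rho> k)
        = (\<Sum>j'\<in>UNIV. (\<Sum>k<r. Const (of_int (B k $ j) * of_rat (R k j')) * Var j'))"
      by (simp add: \<rho>_def sum_distrib_left Const_mult mult.assoc) (rule sum.swap)
    have 2: "(\<Sum>i\<in>UNIV. Const (of_rat (D j i)) * euler_form A i)
        = (\<Sum>j'\<in>UNIV. (\<Sum>i\<in>UNIV. Const (of_rat (D j i) * of_int (A $ i $ j')) * Var j'))"
      by (simp add: euler_form_def sum_distrib_left Const_mult mult.assoc) (rule sum.swap)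
    have "(\<Sum>k<r. Const (of_int (B k $ j)) * \<rho> k) + (\<Sum>i\<in>UNIV. Const (of_rat (D j i)) * euler_form A i)
      = (\<Sum>j'\<in>UNIV. (\<Sum>k<r. Const (of_int (B k $ j) * of_rat (R k j')) * Var j'))
        + (\<Sum>j'\<in>UNIV. (\<Sum>i\<in>UNIV. Const (of_rat (D j i) * of_int (A $ i $ j')) * Var j'))"
      by (simp only: 1 2)
    also have "\<dots> = (\<Sum>j'\<in>UNIV. Const ((\<Sum>k<r. of_int (B k $ j) * of_rat (R k j')) + (\<Sum>i\<in>UNIV. of_rat (D j i) * of_int (A $ i $ j'))) * Var j')"
      by (simp add: sum.distrib sum_distrib_right Const_sum Const_add distrib_right)
    also have "\<dots> = (\<Sum>j'\<in>UNIV. if j' = j then Var j' else 0)"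
    proof (rule sum.cong[OF refl])
      fix j'
      have "(\<Sum>k<r. of_int (B k $ j) * of_rat (R k j')) + (\<Sum>i\<in>UNIV. of_rat (D j i) * of_int (A $ i $ j')) = (if j = j' then 1 else 0 :: complex)"
        using arg_cong[OF D[of j j'], of "of_rat :: rat \<Rightarrow> complex"] by (simp add: of_rat_sum of_rat_mult of_rat_add)
      then show "Const ((\<Sum>k<r. of_int (B k $ j) * of_rat (R k j')) + (\<Sum>i\<in>UNIV. of_rat (D j i) * of_int (A $ i $ j'))) * Var j' = (if j' = j then Var j' else (0 :: 'n cpoly))"
        by simp
    qed
    finally show ?thesis by (simp add: sum.delta algebra_simps)
  qed
  note \<ell> = linear_forms_ell[of r B]
  have "adjm \<rho> (log_poly r B q) = q" if "q \<in> Sring r" for q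
  proof (rule eq_if_commutes_with_derivatives[where Q = "Sring r", OF that])
    fix k and q :: "nat cpoly" assume q: "q \<in> Sring r"
    show "diff_op (Var k) (adjm \<rho> (log_poly r B q)) = adjm \<rho> (log_poly r B (diff_op (Var k) q))"
    proof (cases "k < r")
      case True
      then show ?thesis
        by (simp add: diff_op_Var_adjm[OF \<rho>] log_poly_eq_adjm)
          (simp add: \<rho>_def diff_op_linear_adjm[OF \<ell>] Rl)
    next
      case False
      have "diff_op (Var k) q = 0"
      proof (rule poly_mapping_eqI)
        fix m
        have "k \<in> supp (m + monom1 k (Suc 0))" by (simp add: supp_add_mono)
        then have "coef q (m + monom1 k (Suc 0)) = 0" using False Sring_coef[OF q] by fastforce
        then show "coef (diff_op (Var k) q) m = coef 0 m" by (simp add: coef_diff_op Var_def)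
      qed
      moreover have "\<rho> k = 0" using False by (simp add: \<rho>_def)
      ultimately show ?thesis
        by (simp add: diff_op_Var_adjm[OF \<rho>] \<rho> \<ell> log_poly_eq_adjm)
    qed
  qed (auto simp: Sring_diff_op log_poly_eq_adjm coef_adjm_0[OF \<rho>] coef_adjm_0[OF \<ell>])
  moreover have "log_poly r B (adjm \<rho> p) = p" if "p \<in> euler_kernel A" for p
  proof (rule eq_if_commutes_with_derivatives[where Q = "euler_kernel A", OF that])
    fix j and p :: "'n cpoly" assume p: "p \<in> euler_kernel A"
    have "diff_op (Var j) (log_poly r B (adjm \<rho> p)) = log_poly r B (adjm \<rho> (diff_op (\<Sum>k<r. Const (of_int (B k $ j)) * \<rho> k) p))"
      by (simp add: log_poly_eq_adjm diff_op_Var_adjm[OF \<ell>] diff_op_linear_adjm[OF \<rho>, symmetric] ell_def)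
    also have "diff_op (\<Sum>k<r. Const (of_int (B k $ j)) * \<rho> k) p = diff_op (Var j) p"
      using p by (simp add: l\<rho> diff_op_diff_left diff_op_sum_left diff_op_mult euler_kernel_def)
    finally show "diff_op (Var j) (log_poly r B (adjm \<rho> p)) = log_poly r B (adjm \<rho> (diff_op (Var j) p))" .
  qed (auto simp: diff_op_euler_kernel log_poly_eq_adjm coef_adjm_0[OF \<rho>] coef_adjm_0[OF \<ell>])
  moreover have "adjm \<rho> p \<in> Sring r" for p
  proof (rule SringI, rule subsetI)
    fix m k assume m: "coef (adjm \<rho> p) m \<noteq> 0" and k: "k \<in> supp m"
    show "k \<in> {..<r}"
    proof (rule ccontr)
      assume "k \<notin> {..<r}"
      then have "\<rho> k = 0" by (simp add: \<rho>_def)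
      then have "mon \<rho> m = 0" unfolding mon_def using k
        by (intro prod_zero bexI[of _ k]) (simp_all add: in_keys_iff zero_power)
      then show False using m by (simp add: coef_adjm[OF \<rho>])
    qed
  qed
  ultimately show ?thesis using that \<rho> by blast
qed

text \<open>Transposed, an Euler form becomes the combination of the ell_j with the entries of a row
  of \<open>A\<close>, which vanishes because A B = 0.\<close>

lemma log_poly_euler_kernel:
  fixes A :: "int ^ 'n ^ 'd"
  assumes "gale_dual A r B"
  shows "log_poly r B q \<in> euler_kernel A"
proof -
  have "(\<Sum>j\<in>UNIV. Const (of_int (A $ i $ j)) * ell r B j) = 0" for i
  proof -
    have "(\<Sum>j\<in>UNIV. Const (of_int (A $ i $ j)) * ell r B j)
      = (\<Sum>k<r. Const (of_int (\<Sum>j\<in>UNIV. A $ i $ j * B k $ j)) * Var k)"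
      by (simp add: ell_def sum_distrib_left sum_distrib_right Const_sum Const_mult mult.assoc) (rule sum.swap)
    also have "\<dots> = 0"
    proof (rule sum.neutral, rule ballI)
      fix k assume "k \<in> {..<r}"
      then have "A *v B k = 0"
        using gale_dual_mem[OF assms] by (simp add: ker_lattice_def)
      then have "(\<Sum>j\<in>UNIV. A $ i $ j * B k $ j) = 0"
        by (simp add: vec_eq_iff matrix_vector_mult_def)
      then show "Const (of_int (\<Sum>j\<in>UNIV. A $ i $ j * B k $ j)) * Var k = (0 :: nat cpoly)"
        by simp
    qed
    finally show ?thesis .
  qed
  then show ?thesis
    by (simp add: euler_kernel_def euler_form_def log_poly_eq_adjm diff_op_linear_adjm[OF linear_forms_ell]
        linear_forms_ell)
qed


section \<open>Graded duality for submodules\<close>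

lemma generated_by_submodule: "is_submodule R scl (generated_by R scl G)"
  unfolding generated_by_def
  by (rule hull_in) (auto simp: is_submodule_def)

lemma generated_by_superset: "G \<subseteq> generated_by R scl G"
  unfolding generated_by_def by (rule hull_subset)

lemma generated_by_minimal: "G \<subseteq> M \<Longrightarrow> is_submodule R scl M \<Longrightarrow> generated_by R scl G \<subseteq> M"
  unfolding generated_by_def by (rule hull_minimal)

lemma is_submoduleD:
  assumes "is_submodule R scl M"
  shows "0 \<in> M" "x \<in> M \<Longrightarrow> y \<in> M \<Longrightarrow> x + y \<in> M" "a \<in> R \<Longrightarrow> x \<in> M \<Longrightarrow> scl a x \<in> M"
  using assms by (auto simp: is_submodule_def)

lemma coef_free_scale [simp]: "coef (free_scale f x) G = f * coef x G"
  by (auto simp: free_scale_def Poly_Mapping.map.rep_eq when_def)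

lemma free_scale_add_left: "free_scale (f + g) x = free_scale f x + free_scale g x"
  by (rule poly_mapping_eqI) (simp add: lookup_add distrib_right)

lemma free_scale_mult: "free_scale (f * g) x = free_scale f (free_scale g x)"
  by (rule poly_mapping_eqI) (simp add: mult.assoc)

lemma free_scale_0 [simp]: "free_scale 0 x = 0" and free_scale_0_right [simp]: "free_scale f 0 = 0"
  by (rule poly_mapping_eqI, simp)+

lemma free_scale_eta [simp]: "free_scale f (eta G p) = eta G (f * p)"
  by (rule poly_mapping_eqI) (simp add: lookup_single when_def)

text \<open>Homogeneity in the graded free module in which the basis vector of \<open>G\<close> has
  degree \<open>sh G\<close>.\<close>

definition homF :: "('n::finite set \<Rightarrow> nat) \<Rightarrow> nat \<Rightarrow> ('n set \<Rightarrow>\<^sub>0 nat cpoly) \<Rightarrow> bool"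
  where "homF sh d x \<longleftrightarrow> (\<forall>G m. coef (coef x G) m \<noteq> 0 \<longrightarrow> tdeg m + sh G = d)"

text \<open>The component of degree \<open>d\<close> in the grading of \<open>homF\<close>. The test
  \<open>sh G \<le> d\<close> is needed since the truncated \<open>d - sh G\<close> would otherwise
  select constant terms.\<close>

definition compF :: "('n::finite set \<Rightarrow> nat) \<Rightarrow> nat \<Rightarrow> ('n set \<Rightarrow>\<^sub>0 nat cpoly) \<Rightarrow> ('n set \<Rightarrow>\<^sub>0 nat cpoly)"
  where "compF sh d x = Abs_poly_mapping (\<lambda>G. if sh G \<le> d then hcomp (d - sh G) (coef x G) else 0)"

lemma coef_compF: "coef (coef (compF sh d x) G) m = (if tdeg m + sh G = d then coef (coef x G) m else 0)"
  by (auto simp: compF_def coef_hcomp)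

lemma free_eqI: "(\<And>G m. coef (coef x G) m = coef (coef y G) m) \<Longrightarrow> x = y"
  by (intro poly_mapping_eqI) blast

lemma compF_add: "compF sh d (x + y) = compF sh d x + compF sh d y"
  by (rule free_eqI) (simp add: coef_compF lookup_add)

lemma compF_0 [simp]: "compF sh d 0 = 0"
  by (rule free_eqI) (simp add: coef_compF)

lemma compF_homF: "homF sh d' x \<Longrightarrow> compF sh d x = (if d = d' then x else 0)"
  by (rule free_eqI) (auto simp: coef_compF homF_def)

lemma compF_scale_monom1:
  "compF sh d (free_scale (monom1 m c) x) = (if tdeg m \<le> d then free_scale (monom1 m c) (compF sh (d - tdeg m) x) else 0)"
proof (rule free_eqI)
  fix G n
  show "coef (coef (compF sh d (free_scale (monom1 m c) x)) G) n
    = coef (coef (if tdeg m \<le> d then free_scale (monom1 m c) (compF sh (d - tdeg m) x) else 0) G) n"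
  proof (cases "\<exists>k. n = m + k")
    case True
    then obtain k where "n = m + k" by blast
    then show ?thesis by (auto simp: coef_compF coef_monom1_mult_add tdeg_add)
  next
    case False
    then show ?thesis by (simp add: coef_compF coef_monom1_mult_outside)
  qed
qed

lemma free_scale_expand: "free_scale a x = (\<Sum>m\<in>supp a. free_scale (monom1 m (coef a m)) x)"
proof (rule poly_mapping_eqI)
  fix G
  have "coef (free_scale a x) G = (\<Sum>m\<in>supp a. monom1 m (coef a m)) * coef x G"
    by (simp add: poly_eq_sum_monom1[symmetric])
  then show "coef (free_scale a x) G = coef (\<Sum>m\<in>supp a. free_scale (monom1 m (coef a m)) x) G"
    by (simp add: lookup_sum sum_distrib_right)
qed

lemma compF_sum: "compF sh d (sum f S) = (\<Sum>x\<in>S. compF sh d (f x))"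
  by (induction S rule: infinite_finite_induct) (simp_all add: compF_add)

lemma submodule_sum:
  "is_submodule R scl M \<Longrightarrow> (\<And>x. x \<in> S \<Longrightarrow> f x \<in> M) \<Longrightarrow> sum f S \<in> M"
  by (induction S rule: infinite_finite_induct) (auto simp: is_submodule_def)

lemma Sring_term: "a \<in> Sring r \<Longrightarrow> m \<in> supp a \<Longrightarrow> monom1 m c \<in> Sring r"
  by (rule Sring_monom1) (simp add: Sring_def)

text \<open>The elements all of whose components stay in the submodule form a submodule containing
  the generators: multiplication by a monomial only shifts components, and every scalar is a sum of
  monomials.\<close>

lemma generated_by_homogeneous_graded:
  assumes gen: "\<And>x. x \<in> Gen \<Longrightarrow> \<exists>d. homF sh d x"
    and z: "z \<in> generated_by (Sring r) free_scale Gen"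
  shows "compF sh d z \<in> generated_by (Sring r) free_scale Gen"
proof -
  let ?Z = "generated_by (Sring r) free_scale Gen"
  note Z = is_submoduleD[OF generated_by_submodule[of "Sring r" free_scale Gen]]
  have "?Z \<subseteq> {z \<in> ?Z. \<forall>d. compF sh d z \<in> ?Z}"
  proof (rule generated_by_minimal)
    show "Gen \<subseteq> {z \<in> ?Z. \<forall>d. compF sh d z \<in> ?Z}"
    proof
      fix x assume x: "x \<in> Gen"
      then obtain d' where "homF sh d' x" using gen by blast
      then show "x \<in> {z \<in> ?Z. \<forall>d. compF sh d z \<in> ?Z}"
        using x generated_by_superset[of Gen "Sring r" free_scale] Z(1) by (auto simp: compF_homF)
    qed
    show "is_submodule (Sring r) free_scale {z \<in> ?Z. \<forall>d. compF sh d z \<in> ?Z}"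
      unfolding is_submodule_def
    proof (intro conjI ballI)
      fix a x assume a: "a \<in> Sring r" and x: "x \<in> {z \<in> ?Z. \<forall>d. compF sh d z \<in> ?Z}"
      have "compF sh d (free_scale a x) \<in> ?Z" for d
        unfolding free_scale_expand[of a] compF_sum
        using Z x by (intro submodule_sum[OF generated_by_submodule])
          (auto simp: compF_scale_monom1 intro!: Z(3) Sring_term[OF a])
      then show "free_scale a x \<in> {z \<in> ?Z. \<forall>d. compF sh d z \<in> ?Z}"
        using Z(3)[OF a] x by blast
    qed (auto simp: Z compF_add)
  qed
  then show ?thesis using z by blast
qed

text \<open>Matlis duality for graded pieces, in elementary form: a form \<open>q\<close> orthogonal to the
  annihilator of the class of \<open>e\<close> extends to a homomorphism from the quotient module to the
  injective hull of \<open>\<complex>\<close>, which is the polynomial ring with the action of \<open>diff_op\<close>.\<close>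

lemma graded_duality:
  fixes sh :: "'n::finite set \<Rightarrow> nat"
  assumes gen: "\<And>x. x \<in> Gen \<Longrightarrow> \<exists>d. homF sh d x"
    and genS: "\<And>x G. x \<in> Gen \<Longrightarrow> coef x G \<in> Sring r"
    and e: "homF sh \<delta> e" and eS: "\<And>G. coef e G \<in> Sring r"
    and q: "q \<in> forms r i"
    and perp: "\<And>h. h \<in> forms r i \<Longrightarrow> free_scale h e \<in> generated_by (Sring r) free_scale Gen \<Longrightarrow> pairing h q = 0"
  shows "\<exists>g. (\<forall>G. g G \<in> Sring r) \<and> (\<forall>x\<in>Gen. (\<Sum>G\<in>UNIV. diff_op (coef x G) (g G)) = 0) \<and>
    (\<Sum>G\<in>UNIV. diff_op (coef e G) (g G)) = q"
proof -
  let ?Z = "generated_by (Sring r) free_scale Gen"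
  note Z = is_submoduleD[OF generated_by_submodule[of "Sring r" free_scale Gen]]
  have ZS: "coef z G \<in> Sring r" if "z \<in> ?Z" for z G
  proof -
    have "?Z \<subseteq> {z. \<forall>G. coef z G \<in> Sring r}"
      by (rule generated_by_minimal)
        (auto simp: is_submodule_def genS lookup_add intro: Sring_add Sring_mult)
    then show ?thesis using that by blast
  qed
  \<comment> \<open>A form of degree \<open>i\<close> multiplies \<open>e\<close> into this degree,
    the only one in which coordinates are needed.\<close>
  define d where "d = i + \<delta>"
  define M where "M G = {m :: nat mono. supp m \<subseteq> {..<r} \<and> tdeg m + sh G = d}" for G
  have finM: "finite (M G)" for G
    by (rule finite_subset[OF _ finite_bounded_monos[of "{..<r}" d]]) (auto simp: M_def)
  let ?I = "SIGMA G:UNIV. M G"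
  \<comment> \<open>A pair (z, h) stands for z + h e. If this sum vanishes in degree
    \<open>d\<close>, then the degree \<open>i\<close> part of \<open>h\<close> carries
    \<open>e\<close> into \<open>?Z\<close>, so the pairing of \<open>h\<close> with
    \<open>q\<close> is 0. Hence that pairing is a combination of finitely many coordinates of z + h
    e.\<close>
  have "\<exists>c. \<forall>y\<in>?Z \<times> Sring r. pairing (snd y) q = (\<Sum>j\<in>?I. c j * coef (coef (fst y + free_scale (snd y) e) (fst j)) (snd j))"
  proof (rule functional_in_span[where add = "(+)" and scl = "\<lambda>c y. (free_scale (Const c) (fst y), Const c * snd y)"
        and coord = "\<lambda>j y. coef (coef (fst y + free_scale (snd y) e) (fst j)) (snd j)"])
    fix y assume y: "y \<in> ?Z \<times> Sring r"
      and zero: "\<And>j. j \<in> ?I \<Longrightarrow> coef (coef (fst y + free_scale (snd y) e) (fst j)) (snd j) = 0"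
    obtain z h where zh: "y = (z, h)" "z \<in> ?Z" "h \<in> Sring r" using y by auto
    have "compF sh d (z + free_scale h e) = 0"
    proof (rule free_eqI)
      fix G m
      have S: "coef (z + free_scale h e) G \<in> Sring r"
        using zh ZS eS by (simp add: lookup_add Sring_add Sring_mult)
      show "coef (coef (compF sh d (z + free_scale h e)) G) m = coef (coef 0 G) m"
      proof (cases "(G, m) \<in> ?I")
        case True
        then show ?thesis using zero[OF True] by (simp add: coef_compF zh)
      next
        case False
        then show ?thesis using Sring_coef[OF S, of m] by (auto simp: coef_compF M_def)
      qed
    qed
    moreover have "compF sh d (free_scale h e) = free_scale (hcomp i h) e"
    proof -
      have "compF sh d (free_scale h e) = (\<Sum>m\<in>supp h. if tdeg m = i then free_scale (monom1 m (coef h m)) e else 0)"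
        unfolding free_scale_expand[of h] compF_sum
        by (rule sum.cong) (auto simp: compF_scale_monom1 compF_homF[OF e] d_def)
      also have "\<dots> = (\<Sum>m\<in>{m \<in> supp h. tdeg m = i}. free_scale (monom1 m (coef h m)) e)"
        by (simp add: sum.inter_filter)
      also have "\<dots> = free_scale (hcomp i h) e"
        by (rule poly_mapping_eqI) (simp add: hcomp_def lookup_sum sum_distrib_right)
      finally show ?thesis .
    qed
    ultimately have "free_scale (hcomp i h) e = - compF sh d z"
      by (simp add: compF_add eq_neg_iff_add_eq_0 add.commute)
    also have "\<dots> = free_scale (Const (-1)) (compF sh d z)"
      by (rule poly_mapping_eqI) (simp add: Const_uminus)
    also have "\<dots> \<in> ?Z"
      using generated_by_homogeneous_graded[OF gen zh(2)] by (intro Z(3)) auto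
    finally have "pairing (hcomp i h) q = 0"
      using Sring_hcomp[OF zh(3)] by (intro perp) (auto simp: degree_part_def)
    then show "pairing (snd y) q = 0"
      using q by (simp add: zh pairing_hcomp_left degree_part_def)
  next
    fix y y' assume "y \<in> ?Z \<times> Sring r" "y' \<in> ?Z \<times> Sring r"
    then show "y + y' \<in> ?Z \<times> Sring r"
      by (auto simp: mem_Times_iff intro: Z Sring_add)
  next
    fix c y assume "y \<in> ?Z \<times> Sring r"
    then show "(free_scale (Const c) (fst y), Const c * snd y) \<in> ?Z \<times> Sring r"
      by (auto intro: Z Sring_mult)
  qed (auto simp: finM lookup_add free_scale_add_left distrib_left distrib_right pairing_add_left
      pairing_Const_left mult.assoc)
  then obtain c where c: "\<And>z h. z \<in> ?Z \<Longrightarrow> h \<in> Sring r \<Longrightarrow>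
      pairing h q = (\<Sum>j\<in>?I. c j * coef (coef (z + free_scale h e) (fst j)) (snd j))"
    by force
  \<comment> \<open>Dividing by \<open>mfact m\<close> compensates the weights of the pairing;
    pairing with \<open>g G\<close> is then the part of the functional that belongs to the basis
    vector of \<open>G\<close>.\<close>
  define g where "g G = (\<Sum>m\<in>M G. monom1 m (c (G, m) / mfact m))" for G
  have gS: "g G \<in> Sring r" for G
    unfolding g_def by (intro Sring_sum Sring_monom1) (simp add: M_def)
  have pg: "pairing p (g G) = (\<Sum>m\<in>M G. c (G, m) * coef p m)" for p G
    unfolding g_def pairing_sum_right
    by (rule sum.cong) (simp_all add: pairing_commute[of p] pairing_monom1_left)
  have key: "(\<Sum>G\<in>UNIV. pairing (coef (z + free_scale h e) G) (g G)) = pairing h q"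
    if "z \<in> ?Z" "h \<in> Sring r" for z h
    unfolding c[OF that] pg
    by (subst sum.Sigma) (auto simp: finM split_beta)
  \<comment> \<open>All multiples of a generator lie in \<open>?Z\<close>, so \<open>key\<close>
    with second argument 0 shows that the sum pairs to 0 with every element of
    \<open>Sring r\<close>.\<close>
  have "(\<Sum>G\<in>UNIV. diff_op (coef x G) (g G)) = 0" if x: "x \<in> Gen" for x
  proof (rule Sring_eqI[of _ r])
    fix h assume h: "h \<in> Sring r"
    have "free_scale h x \<in> ?Z"
      using x generated_by_superset[of Gen] by (intro Z(3)[OF h]) blast
    from key[OF this Sring_0]
    show "pairing h (\<Sum>G\<in>UNIV. diff_op (coef x G) (g G)) = pairing h 0"
      by (simp add: pairing_sum_right pairing_diff_op)
  qed (auto intro: Sring_sum Sring_diff_op gS)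
  moreover have "(\<Sum>G\<in>UNIV. diff_op (coef e G) (g G)) = q"
  proof (rule Sring_eqI[of _ r])
    fix h assume h: "h \<in> Sring r"
    from key[OF Z(1) h]
    show "pairing h (\<Sum>G\<in>UNIV. diff_op (coef e G) (g G)) = pairing h q"
      by (simp add: pairing_sum_right pairing_diff_op)
  qed (use q in \<open>auto intro: Sring_sum Sring_diff_op gS simp: degree_part_def\<close>)
  ultimately show ?thesis using gS by blast
qed

lemma homF_eta: "homog d p \<Longrightarrow> homF sh (d + sh G) (eta G p)"
  by (auto simp: homF_def lookup_single when_def dest: homogD)

lemma homF_diff: "homF sh d x \<Longrightarrow> homF sh d y \<Longrightarrow> homF sh d (x - y)"
  unfolding homF_def
proof (intro allI impI)
  fix G m
  assume *: "\<forall>G m. coef (coef x G) m \<noteq> 0 \<longrightarrow> tdeg m + sh G = d"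
    "\<forall>G m. coef (coef y G) m \<noteq> 0 \<longrightarrow> tdeg m + sh G = d" "coef (coef (x - y) G) m \<noteq> 0"
  then have "coef (coef x G) m \<noteq> 0 \<or> coef (coef y G) m \<noteq> 0"
    by (auto simp: lookup_minus)
  with * show "tdeg m + sh G = d" by blast
qed

lemma sum_diff_op_eta: "(\<Sum>G'\<in>UNIV. diff_op (coef (eta G p) G') (g G')) = diff_op p (g G)"
  for G :: "'n::finite set"
proof -
  have "(\<Sum>G'\<in>UNIV. diff_op (coef (eta G p) G') (g G')) = (\<Sum>G'\<in>UNIV. if G' = G then diff_op p (g G) else 0)"
    by (rule sum.cong) (auto simp: lookup_single when_def)
  then show ?thesis by (simp add: sum.delta)
qed

lemma sum_diff_op_minus:
  "(\<Sum>G\<in>UNIV. diff_op (coef (x - y) G) (g G)) = (\<Sum>G\<in>UNIV. diff_op (coef x G) (g G)) - (\<Sum>G\<in>UNIV. diff_op (coef y G) (g G))"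
  for g :: "'n::finite set \<Rightarrow> nat cpoly"
  by (simp add: lookup_minus diff_op_diff_left sum_subtractf)

lemma sum_diff_op_generated:
  fixes g :: "'n::finite set \<Rightarrow> nat cpoly"
  assumes "\<And>x. x \<in> Gen \<Longrightarrow> (\<Sum>G\<in>UNIV. diff_op (coef x G) (g G)) = 0"
    and "z \<in> generated_by R free_scale Gen"
  shows "(\<Sum>G\<in>UNIV. diff_op (coef z G) (g G)) = 0"
proof -
  have "generated_by R free_scale Gen \<subseteq> {z. (\<Sum>G\<in>UNIV. diff_op (coef z G) (g G)) = 0}"
    by (rule generated_by_minimal)
      (auto simp: assms(1) is_submodule_def lookup_add diff_op_add_left sum.distrib diff_op_mult
        diff_op_sum_right[symmetric])
  then show ?thesis using assms(2) by blast
qed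


section \<open>The two ideals and their inverse systems\<close>

lemma pairing_alt: "pairing f q = coef (diff_op f q) 0"
  by (subst pairing_commute) (rule pairing_def)

lemma lin_subspace_J_intr: "lin_subspace (J_intr A r B v N)"
  unfolding lin_subspace_def J_intr_def ellH_ideal_def
  using is_submoduleD[OF generated_by_submodule[of "Sring r" "(*)" "ellp r B ` Hsets A v N"]]
  by (auto simp: distrib_right mult.assoc intro: Sring_add Sring_mult)

lemma lin_subspace_J_amb: "lin_subspace (J_amb A r B v N \<iota> G)"
  unfolding lin_subspace_def J_amb_def Zmod_def
  by (auto simp del: free_scale_eta simp: free_scale_add_left free_scale_mult
      intro: Sring_add Sring_mult is_submoduleD[OF generated_by_submodule])

lemma ellp_split: "Y \<subseteq> X \<Longrightarrow> ellp r B X = ellp r B (X - Y) * ellp r B Y" for X :: "'n::finite set"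
  unfolding ellp_def by (rule prod.subset_diff) auto

lemma ellp_Un: "X \<inter> Y = {} \<Longrightarrow> ellp r B (X \<union> Y) = ellp r B X * ellp r B Y" for X :: "'n::finite set"
  unfolding ellp_def by (rule prod.union_disjoint) auto

lemma minimal_member_below:
  fixes F :: "'n::finite set set"
  assumes "X \<in> F"
  shows "\<exists>Y\<in>minimal_members F. Y \<subseteq> X"
proof -
  obtain Y where "Y \<in> F" "Y \<subseteq> X" "\<And>Z. Z \<in> F \<Longrightarrow> Z \<subseteq> Y \<Longrightarrow> Y = Z"
    using finite_has_minimal2[OF finite assms] by auto
  then show ?thesis unfolding minimal_members_def by blast
qed

text \<open>The toric equations after removal of the units and passage to the variables
  \<open>s\<close>. For \<open>I\<close> in \<open>N\<close> and \<open>J\<close> outside, the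
  left-hand side is 0 and the relation says that ell^(J - I) kills \<open>q I\<close>.\<close>

definition solution_family ::
    "int ^ 'n ^ 'd \<Rightarrow> nat \<Rightarrow> (nat \<Rightarrow> int ^ 'n) \<Rightarrow> complex ^ 'n \<Rightarrow> 'n set set \<Rightarrow> ('n set \<Rightarrow> nat cpoly) \<Rightarrow> bool"
  where "solution_family A r B v N q \<longleftrightarrow> (\<forall>I. q I \<in> Sring r) \<and> (\<forall>I. I \<notin> N \<longrightarrow> q I = 0) \<and>
    (\<forall>I\<in>nsupps A v. \<forall>J\<in>nsupps A v. diff_op (ellp r B (I - J)) (q J) = diff_op (ellp r B (J - I)) (q I))"

section \<open>Inclusion of the ideals and descriptions of the two orthogonal spaces\<close>

context
  fixes A :: "int ^ 'n ^ 'd" and w :: "real ^ 'n" and v :: "complex ^ 'n" and N :: "'n set set"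
    and r :: nat and B :: "nat \<Rightarrow> int ^ 'n" and \<iota> :: "'n set \<Rightarrow> 'n set" and G0 :: "'n set"
  assumes N: "negative_support_family A w v N"
    and \<iota>: "\<forall>H \<in> Hsets A v N. \<iota> H \<in> Gsets N \<and> \<iota> H \<subseteq> H"
    and G0: "G0 \<in> Gsets N" "G0 \<subseteq> Eset v N"
begin

lemma nsupp_in_N: "nsupp v \<in> N"
  using N by (simp add: negative_support_family_def)

lemma N_subset: "N \<subseteq> nsupps A v"
  using N by (auto simp: negative_support_family_def nonneg_nsupps_def)

lemma Gsets_member:
  assumes "G \<in> Gsets N"
  shows "G \<union> \<Inter>N \<in> N" "G \<inter> \<Inter>N = {}"
proof -
  obtain I where I: "I \<in> N" "G = I - \<Inter>N" using assms by (auto simp: Gsets_def minimal_members_def)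
  then have "G \<union> \<Inter>N = I" by blast
  then show "G \<union> \<Inter>N \<in> N" "G \<inter> \<Inter>N = {}" using I by auto
qed

lemma Gsets_below: "I \<in> N \<Longrightarrow> \<exists>G\<in>Gsets N. G \<subseteq> I - \<Inter>N"
  unfolding Gsets_def by (rule minimal_member_below) blast

lemma J_amb_subset_J_intr: "J_amb A r B v N \<iota> G0 \<subseteq> J_intr A r B v N"
proof
  fix f assume f: "f \<in> J_amb A r B v N \<iota> G0"
  let ?H = "ellH_ideal A r B v N"
  let ?\<phi> = "\<lambda>x :: 'n set \<Rightarrow>\<^sub>0 nat cpoly. \<Sum>G\<in>UNIV. coef x G * ellp r B G"
  have eta: "?\<phi> (eta G p) = p * ellp r B G" for G p
  proof -
    have "?\<phi> (eta G p) = (\<Sum>G'\<in>UNIV. if G' = G then p * ellp r B G else 0)"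
      by (rule sum.cong) (auto simp: lookup_single when_def)
    then show ?thesis by (simp add: sum.delta)
  qed
  note H = is_submoduleD[OF generated_by_submodule[of "Sring r" "(*)" "ellp r B ` Hsets A v N"],
      folded ellH_ideal_def]
  have "Zmod A r B v N \<iota> \<subseteq> {x. ?\<phi> x \<in> ?H}"
    unfolding Zmod_def
  proof (rule generated_by_minimal)
    show "is_submodule (Sring r) free_scale {x. ?\<phi> x \<in> ?H}"
      using H by (auto simp: is_submodule_def lookup_add distrib_right sum.distrib mult.assoc
          sum_distrib_left[symmetric])
    have "?\<phi> (eta G (ellp r B (G' - G)) - eta G' (ellp r B (G - G'))) \<in> ?H" for G G'
    proof -
      have *: "ellp r B (X - Y) * ellp r B Y = ellp r B ((X - Y) \<union> Y)" for X Y :: "'n set"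
        by (rule ellp_Un[symmetric]) blast
      have "?\<phi> (eta G (ellp r B (G' - G)) - eta G' (ellp r B (G - G')))
          = ellp r B ((G' - G) \<union> G) - ellp r B ((G - G') \<union> G')"
        by (simp only: lookup_minus left_diff_distrib sum_subtractf eta *)
      \<comment> \<open>Both terms of a syzygy map to ell^(G \<union> G'), so its image is
        0.\<close>
      also have "(G' - G) \<union> G = (G - G') \<union> G'" by blast
      finally show ?thesis using H(1) by simp
    qed
    moreover have "?\<phi> (eta (\<iota> H) (ellp r B (H - \<iota> H))) \<in> ?H" if "H \<in> Hsets A v N" for H
    proof -
      have "ellp r B (H - \<iota> H) * ellp r B (\<iota> H) = ellp r B H"
        using \<iota> that by (intro ellp_split[symmetric]) blast
      then show ?thesis
        using that generated_by_superset[of "ellp r B ` Hsets A v N" "Sring r" "(*)"]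
        by (auto simp: eta ellH_ideal_def)
    qed
    ultimately show "{eta G (ellp r B (G' - G)) - eta G' (ellp r B (G - G')) | G G'. G \<in> Gsets N \<and> G' \<in> Gsets N} \<union>
     {eta (\<iota> H) (ellp r B (H - \<iota> H)) | H. H \<in> Hsets A v N} \<subseteq> {x. ?\<phi> x \<in> ?H}"
      by blast
  qed
  then have "?\<phi> (free_scale f (eta G0 (ellp r B (Eset v N - G0)))) \<in> ?H"
    using f by (auto simp: J_amb_def)
  then have "f * ellp r B (Eset v N) \<in> ?H"
    using ellp_split[OF G0(2)] by (simp add: eta mult.assoc)
  then show "f \<in> J_intr A r B v N" using f by (simp add: J_intr_def J_amb_def)
qed

text \<open>\<open>J_intr\<close> is the annihilator of the class of ell^E modulo the ideal of the
  ell^H. By duality a form orthogonal to it is the value at ell^E of a homomorphism out of the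
  quotient ring, and such a homomorphism is given by an element \<open>p\<close> of the inverse
  system. The converse is transposition.\<close>

lemma V_intr_iff:
  "q \<in> V_intr A r B v N i \<longleftrightarrow> q \<in> forms r i \<and>
    (\<exists>p\<in>perp r (ellH_ideal A r B v N). diff_op (ellp r B (Eset v N)) p = q)"
proof safe
  assume q: "q \<in> V_intr A r B v N i"
  then show qf: "q \<in> forms r i" by (simp add: V_intr_def perp_deg_def)
  \<comment> \<open>The quotient ring is treated as a quotient of a free module of rank one, carried
    by the basis vector of the empty set in degree 0.\<close>
  let ?E = "ellp r B (Eset v N)" and ?Gen = "eta ({} :: 'n set) ` ellp r B ` Hsets A v N"
  have sub: "generated_by (Sring r) free_scale ?Gen \<subseteq> {x. coef x {} \<in> ellH_ideal A r B v N}"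
    using is_submoduleD[OF generated_by_submodule[of "Sring r" "(*)" "ellp r B ` Hsets A v N"]]
      generated_by_superset[of "ellp r B ` Hsets A v N" "Sring r" "(*)"]
    by (intro generated_by_minimal) (auto simp: is_submodule_def ellH_ideal_def lookup_add)
  have "\<exists>g. (\<forall>G. g G \<in> Sring r) \<and> (\<forall>x\<in>?Gen. (\<Sum>G\<in>UNIV. diff_op (coef x G) (g G)) = 0) \<and>
    (\<Sum>G\<in>UNIV. diff_op (coef (eta {} ?E) G) (g G)) = q"
  proof (rule graded_duality)
    show "homF (\<lambda>_. 0) (card (Eset v N)) (eta {} ?E)"
      using homF_eta[OF homog_ellp, of "\<lambda>_. 0"] by simp
    show "\<exists>d. homF (\<lambda>_. 0) d x" if "x \<in> ?Gen" for x
      using that homF_eta[OF homog_ellp] by blast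
    show "q \<in> forms r i" by (rule qf)
    fix h assume h: "h \<in> forms r i" "free_scale h (eta {} ?E) \<in> generated_by (Sring r) free_scale ?Gen"
    then have "h * ?E \<in> ellH_ideal A r B v N" using sub by fastforce
    then have "h \<in> degree_part i (J_intr A r B v N)"
      using h(1) by (simp add: J_intr_def degree_part_def)
    then show "pairing h q = 0" using q by (simp add: V_intr_def perp_deg_def)
  qed (auto simp: lookup_single when_def ellp_Sring)
  then obtain g where g: "\<And>G. g G \<in> Sring r" "\<And>x. x \<in> ?Gen \<Longrightarrow> (\<Sum>G\<in>UNIV. diff_op (coef x G) (g G)) = 0"
    "(\<Sum>G\<in>UNIV. diff_op (coef (eta {} ?E) G) (g G)) = q"
    by blast
  have "diff_op (ellp r B H) (g {}) = 0" if "H \<in> Hsets A v N" for H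
    using g(2)[of "eta {} (ellp r B H)"] that by (simp add: sum_diff_op_eta)
  note gH = this
  have "diff_op f (g {}) = 0" if f: "f \<in> ellH_ideal A r B v N" for f
  proof -
    have "ellH_ideal A r B v N \<subseteq> {f. diff_op f (g {}) = 0}"
      unfolding ellH_ideal_def
      by (intro generated_by_minimal) (auto simp: is_submodule_def diff_op_add_left diff_op_mult gH)
    then show ?thesis using f by blast
  qed
  then have "g {} \<in> perp r (ellH_ideal A r B v N)"
    using g(1) by (simp add: perp_def pairing_alt)
  moreover have "diff_op ?E (g {}) = q" using g(3) by (simp add: sum_diff_op_eta)
  ultimately show "\<exists>p\<in>perp r (ellH_ideal A r B v N). diff_op ?E p = q" by blast
next
  fix p assume p: "p \<in> perp r (ellH_ideal A r B v N)" and f: "diff_op (ellp r B (Eset v N)) p \<in> forms r i"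
  then show "diff_op (ellp r B (Eset v N)) p \<in> V_intr A r B v N i"
    by (auto simp: V_intr_def perp_deg_def perp_def J_intr_def degree_part_def pairing_diff_op)
qed

text \<open>The set \<iota>(H) need not lie below the \<open>I\<close> from which \<open>H\<close>
  was formed. The relation between \<open>I'\<close> and \<open>I\<close> moves the statement from
  \<open>q I'\<close> to \<open>q I\<close>, where the vanishing of \<open>q J\<close>
  applies.\<close>

lemma solution_family_outside:
  assumes q: "solution_family A r B v N q" and I: "I \<in> N" "I' \<in> N" and J: "J \<in> nsupps A v" "J \<notin> N" "I' \<subseteq> I \<union> J"
  shows "diff_op (ellp r B ((I \<union> J) - I')) (q I') = 0"
proof -
  let ?d = "\<lambda>Y. diff_op (ellp r B Y)"
  have rel: "?d (X - Y) (q Y) = ?d (Y - X) (q X)" if "X \<in> nsupps A v" "Y \<in> nsupps A v" for X Y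
    using q that unfolding solution_family_def by blast
  have "(I \<union> J) - I' = ((I \<union> J) - (I \<union> I')) \<union> (I - I')" by blast
  then have "?d ((I \<union> J) - I') (q I') = ?d ((I \<union> J) - (I \<union> I')) (?d (I - I') (q I'))"
    by (subst (1) \<open>(I \<union> J) - I' = _\<close>) (subst ellp_Un, auto simp: diff_op_mult)
  also have "\<dots> = ?d ((I \<union> J) - (I \<union> I')) (?d (I' - I) (q I))"
    using I N_subset by (subst rel) auto
  also have "\<dots> = ?d (((I \<union> J) - (I \<union> I')) \<union> (I' - I)) (q I)"
    by (subst ellp_Un) (auto simp: diff_op_mult)
  also have "((I \<union> J) - (I \<union> I')) \<union> (I' - I) = J - I" using J(3) by blast
  also have "?d (J - I) (q I) = ?d (I - J) (q J)"
    using I J N_subset by (subst rel) auto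
  also have "q J = 0" using q J(2) by (simp add: solution_family_def)
  finally show ?thesis by simp
qed

abbreviation ambient_generators :: "('n set \<Rightarrow>\<^sub>0 nat cpoly) set"
  where "ambient_generators \<equiv>
    {eta G (ellp r B (G' - G)) - eta G' (ellp r B (G - G')) | G G'. G \<in> Gsets N \<and> G' \<in> Gsets N} \<union>
     {eta (\<iota> H) (ellp r B (H - \<iota> H)) | H. H \<in> Hsets A v N}"

text \<open>The values at the supports \<open>G \<union> \<Inter>N\<close> define a homomorphism on
  the presented module that sends the class of epsilon to \<open>q (nsupp v)\<close>. The
  annihilator of that class therefore kills \<open>q (nsupp v)\<close>.\<close>

lemma solution_family_V_amb:
  assumes q: "solution_family A r B v N q" and f: "q (nsupp v) \<in> forms r i"
  shows "q (nsupp v) \<in> V_amb A r B v N \<iota> G0 i"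
proof -
  let ?d = "\<lambda>Y. diff_op (ellp r B Y)" and ?K = "\<Inter>N"
  have rel: "?d (X - Y) (q Y) = ?d (Y - X) (q X)" if "X \<in> N" "Y \<in> N" for X Y
    using q that N_subset unfolding solution_family_def by blast
  define g where "g G = q (G \<union> ?K)" for G
  have gen: "(\<Sum>G\<in>UNIV. diff_op (coef x G) (g G)) = 0" if x: "x \<in> ambient_generators" for x
    using x
  proof (elim UnE CollectE exE conjE)
    fix G G' assume x: "x = eta G (ellp r B (G' - G)) - eta G' (ellp r B (G - G'))" "G \<in> Gsets N" "G' \<in> Gsets N"
    have "(G' \<union> ?K) - (G \<union> ?K) = G' - G" "(G \<union> ?K) - (G' \<union> ?K) = G - G'"
      using Gsets_member(2)[OF x(2)] Gsets_member(2)[OF x(3)] by blast+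
    then show ?thesis
      using rel[OF Gsets_member(1)[OF x(3)] Gsets_member(1)[OF x(2)]]
      by (simp add: x(1) sum_diff_op_minus sum_diff_op_eta g_def)
  next
    fix H assume x: "x = eta (\<iota> H) (ellp r B (H - \<iota> H))" "H \<in> Hsets A v N"
    then obtain I J where IJ: "I \<in> N" "J \<in> nsupps A v" "J \<notin> N" "H = (I \<union> J) - ?K"
      by (auto simp: Hsets_def minimal_members_def)
    have \<iota>H: "\<iota> H \<in> Gsets N" "\<iota> H \<subseteq> H" using \<iota> x(2) by auto
    have "H - \<iota> H = (I \<union> J) - (\<iota> H \<union> ?K)" using IJ by blast
    moreover have "\<iota> H \<union> ?K \<subseteq> I \<union> J" using \<iota>H IJ by blast
    ultimately show ?thesis
      using solution_family_outside[OF q IJ(1) Gsets_member(1)[OF \<iota>H(1)] IJ(2,3)]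
      by (simp add: x(1) sum_diff_op_eta g_def)
  qed
  have "diff_op h (q (nsupp v)) = 0" if h: "h \<in> J_amb A r B v N \<iota> G0" for h
  proof -
    have "free_scale h (eta G0 (ellp r B (Eset v N - G0))) \<in> generated_by (Sring r) free_scale ambient_generators"
      using h by (simp add: J_amb_def Zmod_def)
    from sum_diff_op_generated[where g = g, OF gen this]
    have "diff_op h (?d (Eset v N - G0) (q (G0 \<union> ?K))) = 0"
      by (simp add: sum_diff_op_eta g_def diff_op_mult)
    moreover have "Eset v N - G0 = nsupp v - (G0 \<union> ?K)" by (auto simp: Eset_def)
    \<comment> \<open>One side of the relation between \<open>nsupp v\<close> and
      \<open>G0 \<union> ?K\<close> carries an empty product, so it expresses
      \<open>q (nsupp v)\<close> through the value at \<open>G0\<close>.\<close>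
    moreover have "(G0 \<union> ?K) - nsupp v = {}" using G0(2) nsupp_in_N by (auto simp: Eset_def)
    then have "?d ((G0 \<union> ?K) - nsupp v) (q (nsupp v)) = q (nsupp v)"
      by (simp only: ellp_def prod.empty diff_op_1)
    ultimately show ?thesis
      using rel[OF nsupp_in_N Gsets_member(1)[OF G0(1)]] by simp
  qed
  then show ?thesis
    using f by (auto simp: V_amb_def perp_deg_def degree_part_def pairing_alt)
qed

text \<open>Duality yields values \<open>g G\<close> only for the basis vectors. A support
  \<open>I\<close> in \<open>N\<close> receives the value obtained by applying ell^(I - K - G) to
  \<open>g G\<close> for some \<open>G\<close> below it; the syzygies make this independent of the
  choice of \<open>G\<close>.\<close>

lemma V_amb_solution_family:
  assumes q: "q \<in> V_amb A r B v N \<iota> G0 i"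
  shows "\<exists>p. solution_family A r B v N p \<and> p (nsupp v) = q"
proof -
  let ?d = "\<lambda>Y. diff_op (ellp r B Y)" and ?K = "\<Inter>N"
  have "\<exists>g. (\<forall>G. g G \<in> Sring r) \<and> (\<forall>x\<in>ambient_generators. (\<Sum>G\<in>UNIV. diff_op (coef x G) (g G)) = 0) \<and>
    (\<Sum>G\<in>UNIV. diff_op (coef (eta G0 (ellp r B (Eset v N - G0))) G) (g G)) = q"
  proof (rule graded_duality)
    show "homF card (card (Eset v N - G0) + card G0) (eta G0 (ellp r B (Eset v N - G0)))"
      by (rule homF_eta[OF homog_ellp])
    show "\<exists>d. homF card d x" if "x \<in> ambient_generators" for x
      using that
    proof (elim UnE CollectE exE conjE)
      fix G G' assume x: "x = eta G (ellp r B (G' - G)) - eta G' (ellp r B (G - G'))"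
      \<comment> \<open>Both sides count \<open>G \<union> G'\<close>; this is why cardinalities are
        the right degree shifts.\<close>
      have "card (G' - G) + card G = card (G - G') + card G'"
        by (metis Un_Diff_cancel2 Un_commute card_Un_disjoint Diff_disjoint finite inf_commute)
      then have "homF card (card (G' - G) + card G) x"
        unfolding x using homF_eta[OF homog_ellp[of "G' - G" r B], of card G] homF_eta[OF homog_ellp[of "G - G'" r B], of card G']
        by (intro homF_diff) simp_all
      then show ?thesis by blast
    qed (use homF_eta[OF homog_ellp] in blast)
    show "q \<in> forms r i" using q by (simp add: V_amb_def perp_deg_def)
    fix h assume "h \<in> forms r i"
      "free_scale h (eta G0 (ellp r B (Eset v N - G0))) \<in> generated_by (Sring r) free_scale ambient_generators"
    then have "h \<in> degree_part i (J_amb A r B v N \<iota> G0)"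
      by (simp add: J_amb_def Zmod_def degree_part_def)
    then show "pairing h q = 0" using q by (simp add: V_amb_def perp_deg_def)
  next
    fix x G assume "x \<in> ambient_generators"
    then show "coef x G \<in> Sring r"
      using lin_subspaceD(1,4)[OF lin_subspace_Sring]
      by (auto simp: lookup_minus lookup_single when_def ellp_Sring)
  next
    fix G show "coef (eta G0 (ellp r B (Eset v N - G0))) G \<in> Sring r"
      by (simp add: lookup_single when_def ellp_Sring)
  qed
  then obtain g where gS: "\<And>G. g G \<in> Sring r"
    and gen: "\<And>x. x \<in> ambient_generators \<Longrightarrow> (\<Sum>G\<in>UNIV. diff_op (coef x G) (g G)) = 0"
    and "(\<Sum>G\<in>UNIV. diff_op (coef (eta G0 (ellp r B (Eset v N - G0))) G) (g G)) = q"
    by blast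
  then have gq: "?d (Eset v N - G0) (g G0) = q"
    by (simp only: sum_diff_op_eta)
  have rel: "?d (G' - G) (g G) = ?d (G - G') (g G')" if "G \<in> Gsets N" "G' \<in> Gsets N" for G G'
    using gen[of "eta G (ellp r B (G' - G)) - eta G' (ellp r B (G - G'))"] that
    by (fastforce simp: sum_diff_op_minus sum_diff_op_eta)
  \<comment> \<open>Inside a common superset \<open>X\<close> the syzygy of \<open>G\<close> and
    \<open>G'\<close> can be multiplied up, so the value pushed to \<open>X\<close> does not depend
    on which set it starts from.\<close>
  have relX: "?d (X - G) (g G) = ?d (X - G') (g G')" if G: "G \<in> Gsets N" "G' \<in> Gsets N" "G \<subseteq> X" "G' \<subseteq> X" for G G' X
  proof -
    have 1: "X - G = (X - (G \<union> G')) \<union> (G' - G)" and 2: "X - G' = (X - (G \<union> G')) \<union> (G - G')"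
      using G by auto
    have "?d (X - G) (g G) = ?d (X - (G \<union> G')) (?d (G' - G) (g G))"
      unfolding 1 by (subst ellp_Un) (auto simp: diff_op_mult)
    also have "\<dots> = ?d (X - (G \<union> G')) (?d (G - G') (g G'))" by (simp only: rel[OF G(1,2)])
    also have "\<dots> = ?d (X - G') (g G')"
      unfolding 2 by (subst ellp_Un) (auto simp: diff_op_mult)
    finally show ?thesis .
  qed
  define c where "c I = (SOME G. G \<in> Gsets N \<and> G \<subseteq> I - ?K)" for I
  have c: "c I \<in> Gsets N" "c I \<subseteq> I - ?K" if "I \<in> N" for I
    using someI_ex[of "\<lambda>G. G \<in> Gsets N \<and> G \<subseteq> I - ?K"] Gsets_below[OF that] unfolding c_def by blast+
  define p where "p I = (if I \<in> N then ?d (I - ?K - c I) (g (c I)) else 0)" for I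
  have shift: "?d (J - I) (p I) = ?d ((I \<union> J) - ?K - c I) (g (c I))" if I: "I \<in> N" for I J
  proof -
    have "(I \<union> J) - ?K - c I = (J - I) \<union> (I - ?K - c I)" using I c[OF I] by blast
    then show ?thesis
      using I by (simp add: p_def) (subst ellp_Un, auto simp: diff_op_mult)
  qed
  have outside: "?d (J - I) (p I) = 0" if I: "I \<in> N" and J: "J \<in> nsupps A v" "J \<notin> N" for I J
  proof -
    \<comment> \<open>Some \<open>H\<close> lies below this set. Inside it the starting set is
      changed from \<open>c I\<close> to \<iota>(H), where the generator for \<open>H\<close> gives
      0.\<close>
    let ?X = "(I \<union> J) - ?K"
    obtain H where H: "H \<in> Hsets A v N" "H \<subseteq> ?X"
      using minimal_member_below[of ?X "{(I \<union> J) - ?K | I J. I \<in> N \<and> J \<in> nsupps A v - N}"] I J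
      unfolding Hsets_def by blast
    have \<iota>H: "\<iota> H \<in> Gsets N" "\<iota> H \<subseteq> H" using \<iota> H by auto
    have 0: "?d (H - \<iota> H) (g (\<iota> H)) = 0"
      using gen[of "eta (\<iota> H) (ellp r B (H - \<iota> H))"] H by (force simp: sum_diff_op_eta)
    have X: "?X - \<iota> H = (?X - H) \<union> (H - \<iota> H)" using H \<iota>H by blast
    have "?d (J - I) (p I) = ?d (?X - c I) (g (c I))" by (rule shift[OF I])
    also have "\<dots> = ?d (?X - \<iota> H) (g (\<iota> H))"
      using c[OF I] H \<iota>H by (intro relX) auto
    also have "\<dots> = ?d (?X - H) (?d (H - \<iota> H) (g (\<iota> H)))"
      unfolding X by (subst ellp_Un) (auto simp: diff_op_mult)
    finally show ?thesis by (simp add: 0)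
  qed
  have zero: "p I = 0" if "I \<notin> N" for I using that by (simp add: p_def)
  have "solution_family A r B v N p"
    unfolding solution_family_def
  proof (intro conjI allI ballI impI)
    show "p I \<in> Sring r" for I by (simp add: p_def Sring_diff_op gS)
    show "p I = 0" if "I \<notin> N" for I using that by (rule zero)
    fix I J assume IJ: "I \<in> nsupps A v" "J \<in> nsupps A v"
    show "?d (I - J) (p J) = ?d (J - I) (p I)"
    proof (cases "I \<in> N"; cases "J \<in> N")
      assume *: "I \<in> N" "J \<in> N"
      have "?d ((J \<union> I) - ?K - c J) (g (c J)) = ?d ((J \<union> I) - ?K - c I) (g (c I))"
        using c[OF *(1)] c[OF *(2)] by (intro relX) auto
      then show ?thesis using * by (simp add: shift Un_commute)
    qed (use IJ outside zero in simp_all)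
  qed
  moreover have "p (nsupp v) = q"
  proof -
    have "p (nsupp v) = ?d (Eset v N - c (nsupp v)) (g (c (nsupp v)))"
      by (simp add: p_def nsupp_in_N Eset_def)
    also have "\<dots> = ?d (Eset v N - G0) (g G0)"
      using c[OF nsupp_in_N] G0 by (intro relX) (auto simp: Eset_def)
    finally show ?thesis by (simp add: gq)
  qed
  ultimately show ?thesis by blast
qed

lemma V_amb_iff:
  "q \<in> V_amb A r B v N \<iota> G0 i \<longleftrightarrow> q \<in> forms r i \<and> (\<exists>p. solution_family A r B v N p \<and> p (nsupp v) = q)"
  using solution_family_V_amb V_amb_solution_family by (auto simp: V_amb_def perp_deg_def)

end


section \<open>The Weyl algebra action\<close>

definition falling :: "'a::comm_ring_1 \<Rightarrow> nat \<Rightarrow> 'a"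
  where "falling x n = (\<Prod>i<n. x - of_nat i)"

lemma falling_add: "falling x (m + n) = falling x m * falling (x - of_nat m) n"
  by (induction n) (simp_all add: falling_def algebra_simps)

lemma falling_pochhammer: "falling x n = (-1) ^ n * pochhammer (- x) n"
proof -
  have "falling x n = (\<Prod>i<n. (-1) * (- x + of_nat i))"
    by (simp add: falling_def)
  also have "\<dots> = (-1) ^ n * pochhammer (- x) n"
    unfolding prod.distrib by (simp add: pochhammer_prod lessThan_atLeast0)
  finally show ?thesis .
qed

lemma falling_of_nat: "falling (of_nat m) k = of_nat (fact k * (m choose k))"
proof (cases "k \<le> m")
  case True
  have "(\<Prod>i<k. m - i) = fact k * (m choose k)" for k
  proof (induction k)
    case (Suc k)
    have "Suc k * (m choose Suc k) = (m - k) * (m choose k)"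
      by (simp only: binomial_absorption binomial_absorb_comp)
    then have "(\<Prod>i<Suc k. m - i) = fact k * (Suc k * (m choose Suc k))"
      using Suc by (simp only: prod.lessThan_Suc ac_simps)
    also have "\<dots> = fact (Suc k) * (m choose Suc k)"
      by (simp only: fact_Suc of_nat_id ac_simps)
    finally show ?case .
  qed simp
  then have "of_nat (fact k * (m choose k)) = (\<Prod>i<k. of_nat (m - i) :: 'a)"
    by (metis of_nat_prod)
  also have "\<dots> = falling (of_nat m) k"
    unfolding falling_def using True by (intro prod.cong) (auto simp: of_nat_diff)
  finally show ?thesis ..
next
  case False
  then have "falling (of_nat m) k = (0 :: 'a)"
    unfolding falling_def by (intro prod_zero bexI[of _ m]) auto
  then show ?thesis using False by (simp add: binomial_eq_0)
qed

text \<open>The binomial theorem for rising factorials, applied to x = m + (x - m) after a sign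
  change. Its coefficients are those of the normal ordering of a power of \<partial> times a power
  of x in one variable.\<close>

lemma falling_Vandermonde:
  "falling x n = (\<Sum>k\<le>min n m. of_nat (fact k * (n choose k) * (m choose k)) * falling (x - of_nat m) (n - k))"
proof -
  have "falling x n = (-1) ^ n * pochhammer (- of_nat m + - (x - of_nat m)) n"
    by (simp add: falling_pochhammer)
  also have "\<dots> = (\<Sum>k\<le>n. of_nat (n choose k) * ((-1) ^ k * pochhammer (- of_nat m) k)
      * ((-1) ^ (n - k) * pochhammer (- (x - of_nat m)) (n - k)))"
    unfolding pochhammer_binomial_sum sum_distrib_left
  proof (rule sum.cong[OF refl])
    fix k assume "k \<in> {..n}"
    then have "(-1 :: 'a) ^ n = (-1) ^ k * (-1) ^ (n - k)"
      by (simp add: power_add[symmetric])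
    then show "(-1) ^ n * (of_nat (n choose k) * pochhammer (- of_nat m) k * pochhammer (- (x - of_nat m)) (n - k))
      = of_nat (n choose k) * ((-1) ^ k * pochhammer (- of_nat m) k)
        * ((-1) ^ (n - k) * pochhammer (- (x - of_nat m)) (n - k))"
      by (simp only: ac_simps)
  qed
  also have "\<dots> = (\<Sum>k\<le>n. of_nat (fact k * (n choose k) * (m choose k)) * falling (x - of_nat m) (n - k))"
    by (simp only: falling_pochhammer[symmetric] falling_of_nat of_nat_mult ac_simps)
  also have "\<dots> = (\<Sum>k\<le>min n m. of_nat (fact k * (n choose k) * (m choose k)) * falling (x - of_nat m) (n - k))"
  proof (rule sum.mono_neutral_right, simp, force, rule ballI)
    fix k assume "k \<in> {..n} - {..min n m}"
    then show "of_nat (fact k * (n choose k) * (m choose k)) * falling (x - of_nat m) (n - k) = 0"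
      by (auto simp: binomial_eq_0)
  qed
  finally show ?thesis .
qed

lemma bracket_falling: "bracket z p = (\<Prod>j\<in>UNIV. falling (z j) (coef p j))" for z :: "'n::finite \<Rightarrow> _"
  by (simp add: bracket_superset[of UNIV] falling_def)

lemma bracket_add: "bracket z (p + q) = bracket z p * bracket (\<lambda>j. z j - of_nat (coef p j)) q"
  for z :: "'n::finite \<Rightarrow> _"
  by (simp add: bracket_falling lookup_add falling_add prod.distrib)

definition weyl_range :: "'n mono \<Rightarrow> 'n mono \<Rightarrow> 'n mono set"
  where "weyl_range b a = {k. \<forall>j. coef k j \<le> coef b j \<and> coef k j \<le> coef a j}"

definition weyl_coef :: "'n mono \<Rightarrow> 'n mono \<Rightarrow> 'n mono \<Rightarrow> nat"
  where "weyl_coef b a k = (\<Prod>j\<in>supp k. fact (coef k j) * (coef b j choose coef k j) * (coef a j choose coef k j))"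

text \<open>The one-variable identities are multiplied and the product of sums is expanded over
  exponent vectors. Index set and coefficients agree with those in \<open>weyl_mult\<close>.\<close>

lemma bracket_Vandermonde:
  fixes z :: "'n::finite \<Rightarrow> 'a::comm_ring_1"
  shows "bracket z b = (\<Sum>k\<in>weyl_range b a. of_nat (weyl_coef b a k) * bracket (\<lambda>j. z j - of_nat (coef a j)) (b - k))"
proof -
  let ?F = "\<lambda>j t. of_nat (fact t * (coef b j choose t) * (coef a j choose t)) * falling (z j - of_nat (coef a j)) (coef b j - t)"
  have bij: "bij_betw coef (weyl_range b a) (PiE UNIV (\<lambda>j. {..min (coef b j) (coef a j)}))"
  proof (rule bij_betwI[where g = Abs_poly_mapping])
    show "coef \<in> weyl_range b a \<rightarrow> PiE UNIV (\<lambda>j. {..min (coef b j) (coef a j)})"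
      by (auto simp: weyl_range_def)
    show "Abs_poly_mapping \<in> PiE UNIV (\<lambda>j. {..min (coef b j) (coef a j)}) \<rightarrow> weyl_range b a"
      by (auto simp: weyl_range_def PiE_iff)
  qed (auto simp: Poly_Mapping.lookup_inverse)
  have "bracket z b = (\<Prod>j\<in>UNIV. \<Sum>t\<le>min (coef b j) (coef a j). ?F j t)"
    unfolding bracket_falling by (rule prod.cong[OF refl]) (rule falling_Vandermonde)
  also have "\<dots> = (\<Sum>k\<in>PiE UNIV (\<lambda>j. {..min (coef b j) (coef a j)}). \<Prod>j\<in>UNIV. ?F j (k j))"
    by (rule prod_sum_PiE) auto
  also have "\<dots> = (\<Sum>k\<in>weyl_range b a. \<Prod>j\<in>UNIV. ?F j (coef k j))"
    by (rule sum.reindex_bij_betw[OF bij, symmetric])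
  also have "\<dots> = (\<Sum>k\<in>weyl_range b a. of_nat (weyl_coef b a k) * bracket (\<lambda>j. z j - of_nat (coef a j)) (b - k))"
  proof (rule sum.cong[OF refl])
    fix k
    have "weyl_coef b a k = (\<Prod>j\<in>UNIV. fact (coef k j) * (coef b j choose coef k j) * (coef a j choose coef k j))"
      unfolding weyl_coef_def by (rule prod.mono_neutral_left) (auto simp: in_keys_iff)
    then show "(\<Prod>j\<in>UNIV. ?F j (coef k j)) = of_nat (weyl_coef b a k) * bracket (\<lambda>j. z j - of_nat (coef a j)) (b - k)"
      by (simp add: bracket_falling lookup_minus prod.distrib)
  qed
  finally show ?thesis .
qed

section \<open>The module structure on logarithmic series\<close>

definition expvec :: "'n mono \<Rightarrow> int ^ 'n"
  where "expvec a = (\<chi> j. int (coef a j))"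

lemma expvec_nth [simp]: "expvec a $ j = int (coef a j)"
  by (simp add: expvec_def)

lemma expvec_0 [simp]: "expvec 0 = 0"
  by (simp add: vec_eq_iff)

definition shift_var :: "complex ^ 'n \<Rightarrow> int ^ 'n \<Rightarrow> 'n \<Rightarrow> 'n cpoly"
  where "shift_var v u j = Const (shift v u $ j) + Var j"

definition weyl_term :: "complex ^ 'n \<Rightarrow> 'n mono \<times> 'n mono \<Rightarrow> 'n log_series \<Rightarrow> 'n log_series"
  where "weyl_term v ab \<phi> u = diff_op (bracket (shift_var v (u - expvec (fst ab) + expvec (snd ab))) (snd ab))
      (\<phi> (u - expvec (fst ab) + expvec (snd ab)))"

lemma weyl_act_eq: "weyl_act v P \<phi> u = (\<Sum>ab\<in>supp P. Const (coef P ab) * weyl_term v ab \<phi> u)"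
proof -
  have "(\<chi> j. u $ j - int (coef a j) + int (coef b j)) = u - expvec a + expvec b" for a b
    by (simp add: vec_eq_iff)
  moreover have "(\<lambda>j. Const (shift v u' $ j) + Var j) = shift_var v u'" for u'
    by (simp add: shift_var_def fun_eq_iff)
  ultimately show ?thesis
    by (simp add: weyl_act_def weyl_term_def Let_def case_prod_beta)
qed

lemma weyl_act_superset:
  "finite S \<Longrightarrow> supp P \<subseteq> S \<Longrightarrow> weyl_act v P \<phi> u = (\<Sum>ab\<in>S. Const (coef P ab) * weyl_term v ab \<phi> u)"
  unfolding weyl_act_eq by (rule sum.mono_neutral_left) (auto simp: in_keys_iff)

lemma weyl_act_add: "weyl_act v (P + Q) \<phi> u = weyl_act v P \<phi> u + weyl_act v Q \<phi> u"
proof -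
  let ?S = "supp P \<union> supp Q"
  have "supp (P + Q) \<subseteq> ?S" by (rule keys_add)
  then show ?thesis
    by (simp add: weyl_act_superset[of ?S] lookup_add Const_add distrib_right sum.distrib)
qed

lemma weyl_act_0 [simp]: "weyl_act v 0 \<phi> u = 0"
  by (simp add: weyl_act_eq)

lemma weyl_act_sum: "weyl_act v (sum P S) \<phi> u = (\<Sum>x\<in>S. weyl_act v (P x) \<phi> u)"
  by (induction S rule: infinite_finite_induct) (simp_all add: weyl_act_add)

lemma weyl_act_monom1: "weyl_act v (monom1 ab c) \<phi> u = Const c * weyl_term v ab \<phi> u"
  by (simp add: weyl_act_eq)

lemma weyl_act_diff: "weyl_act v (P - Q) \<phi> u = weyl_act v P \<phi> u - weyl_act v Q \<phi> u"
  using weyl_act_add[of v "P - Q" Q \<phi> u] by (simp add: algebra_simps)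

text \<open>Every term of the normally ordered product reads the series at the same index
  \<open>u2\<close>. What remains is an identity of symbols, namely the Vandermonde expansion of the
  first bracket in the arguments shifted by a'.\<close>

lemma weyl_term_mult:
  "weyl_term v (a, b) (weyl_term v (a', b') \<phi>) u
    = (\<Sum>k\<in>weyl_range b a'. of_nat (weyl_coef b a' k) * weyl_term v (a + (a' - k), (b - k) + b') \<phi> u)"
proof -
  define u1 where "u1 = u - expvec a + expvec b"
  define u2 where "u2 = u1 - expvec a' + expvec b'"
  \<comment> \<open>Since u2 = u1 - a' + b', lowering by a' at \<open>u1\<close> agrees with
    lowering by b' at \<open>u2\<close>; thus the expanded factor joins the second bracket by
    \<open>bracket_add\<close>.\<close>
  have sv: "(\<lambda>j. shift_var v u1 j - of_nat (coef a' j)) = (\<lambda>j. shift_var v u2 j - of_nat (coef b' j))"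
    by (simp add: fun_eq_iff shift_var_def shift_def u2_def Const_add Const_diff Const_of_nat[symmetric])
  have "weyl_term v (a, b) (weyl_term v (a', b') \<phi>) u
      = diff_op (bracket (shift_var v u1) b) (diff_op (bracket (shift_var v u2) b') (\<phi> u2))"
    by (simp add: weyl_term_def u1_def u2_def)
  also have "\<dots> = (\<Sum>k\<in>weyl_range b a'. diff_op (of_nat (weyl_coef b a' k)
      * (bracket (shift_var v u2) b' * bracket (\<lambda>j. shift_var v u2 j - of_nat (coef b' j)) (b - k))) (\<phi> u2))"
    unfolding diff_op_mult[symmetric]
    by (subst bracket_Vandermonde[of _ b a']) (simp add: sv sum_distrib_left sum_distrib_right diff_op_sum_left ac_simps)
  also have "\<dots> = (\<Sum>k\<in>weyl_range b a'. of_nat (weyl_coef b a' k) * weyl_term v (a + (a' - k), (b - k) + b') \<phi> u)"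
  proof (rule sum.cong[OF refl])
    fix k assume k: "k \<in> weyl_range b a'"
    \<comment> \<open>The bounds on \<open>k\<close> make both subtractions exact, so
      \<open>k\<close> cancels.\<close>
    have "(u - expvec (a + (a' - k)) + expvec ((b - k) + b')) $ j = u2 $ j" for j
    proof -
      have "coef k j \<le> coef b j" "coef k j \<le> coef a' j" using k by (auto simp: weyl_range_def)
      then show ?thesis by (simp add: u1_def u2_def lookup_add lookup_minus)
    qed
    then have "u - expvec (a + (a' - k)) + expvec ((b - k) + b') = u2"
      by (simp add: vec_eq_iff)
    then have "weyl_term v (a + (a' - k), (b - k) + b') \<phi> u = diff_op (bracket (shift_var v u2) (b' + (b - k))) (\<phi> u2)"
      by (simp add: weyl_term_def add.commute)
    then show "diff_op (of_nat (weyl_coef b a' k)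
      * (bracket (shift_var v u2) b' * bracket (\<lambda>j. shift_var v u2 j - of_nat (coef b' j)) (b - k))) (\<phi> u2)
      = of_nat (weyl_coef b a' k) * weyl_term v (a + (a' - k), (b - k) + b') \<phi> u"
      by (simp add: bracket_add Const_of_nat[symmetric] diff_op_Const_mult_left)
  qed
  finally show ?thesis .
qed

lemma weyl_term_sum:
  "weyl_term v ab (\<lambda>u. \<Sum>x\<in>S. Const (c x) * \<psi> x u) u = (\<Sum>x\<in>S. Const (c x) * weyl_term v ab (\<psi> x) u)"
  by (simp add: weyl_term_def diff_op_sum_right diff_op_Const_mult_right)

text \<open>Because the action is multiplicative, the annihilator of a series is a left ideal, and
  only generators have to be tested.\<close>

lemma weyl_act_mult: "weyl_act v (weyl_mult P Q) \<phi> u = weyl_act v P (weyl_act v Q \<phi>) u"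
proof -
  have "weyl_act v (weyl_mult P Q) \<phi> u = (\<Sum>(a, b)\<in>supp P. \<Sum>(a', b')\<in>supp Q. \<Sum>k\<in>weyl_range b a'.
      Const (coef P (a, b) * coef Q (a', b') * of_nat (weyl_coef b a' k)) * weyl_term v (a + (a' - k), (b - k) + b') \<phi> u)"
    by (simp add: weyl_mult_def weyl_act_sum weyl_act_monom1 split_beta weyl_range_def weyl_coef_def
        cong: sum.cong)
  also have "\<dots> = (\<Sum>(a, b)\<in>supp P. \<Sum>(a', b')\<in>supp Q.
      Const (coef P (a, b) * coef Q (a', b')) * weyl_term v (a, b) (weyl_term v (a', b') \<phi>) u)"
    by (simp add: weyl_term_mult sum_distrib_left Const_mult Const_of_nat mult.assoc split_beta)
  also have "\<dots> = (\<Sum>ab\<in>supp P. Const (coef P ab) * (\<Sum>ab'\<in>supp Q. Const (coef Q ab') * weyl_term v ab (weyl_term v ab' \<phi>) u))"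
    by (simp add: split_beta Const_mult sum_distrib_left mult.assoc)
  also have "\<dots> = weyl_act v P (weyl_act v Q \<phi>) u"
    unfolding weyl_act_eq[of v P] weyl_act_eq[of v Q, abs_def] weyl_term_sum ..
  finally show ?thesis .
qed

lemma weyl_act_zero_series: "(\<And>u. \<phi> u = 0) \<Longrightarrow> weyl_act v P \<phi> u = 0"
  by (simp add: weyl_act_eq weyl_term_def)

lemma left_ideal_annihilates:
  assumes "\<And>P u. P \<in> Gen \<Longrightarrow> weyl_act v P \<phi> u = 0" and "P \<in> left_ideal_by Gen"
  shows "weyl_act v P \<phi> u = 0"
proof -
  have "left_ideal_by Gen \<subseteq> {P. \<forall>u. weyl_act v P \<phi> u = 0}"
    unfolding left_ideal_by_def
    by (rule generated_by_minimal)
      (auto simp: assms(1) is_submodule_def weyl_act_add weyl_act_mult intro: weyl_act_zero_series)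
  then show ?thesis using assms(2) by blast
qed

lemma coef_weyl_of_partial: "coef (weyl_of_partial f) (a, b) = (if a = 0 then coef f b else 0)"
proof -
  have "coef (weyl_of_partial f) (a, b) = (\<Sum>p\<in>supp f. if p = b then (if a = 0 then coef f b else 0) else 0)"
    unfolding weyl_of_partial_def lookup_sum by (rule sum.cong) (auto simp: lookup_single when_def)
  also have "\<dots> = (if b \<in> supp f then (if a = 0 then coef f b else 0) else 0)"
    by (rule sum.delta) simp
  finally show ?thesis by (auto simp: in_keys_iff)
qed

lemma weyl_of_partial_add: "weyl_of_partial (f + g) = weyl_of_partial f + weyl_of_partial g"
  by (rule poly_mapping_eqI) (auto simp: coef_weyl_of_partial lookup_add split: prod.splits)

lemma weyl_of_partial_diff: "weyl_of_partial (f - g) = weyl_of_partial f - weyl_of_partial g"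
  by (rule poly_mapping_eqI) (auto simp: coef_weyl_of_partial lookup_minus split: prod.splits)

lemma weyl_of_partial_0 [simp]: "weyl_of_partial 0 = 0"
  by (simp add: weyl_of_partial_def)

lemma weyl_of_partial_sum: "weyl_of_partial (sum f S) = (\<Sum>x\<in>S. weyl_of_partial (f x))"
  by (induction S rule: infinite_finite_induct) (simp_all add: weyl_of_partial_add)

lemma weyl_of_partial_monom1: "weyl_of_partial (monom1 p c) = monom1 (0, p) c"
  by (simp add: weyl_of_partial_def)

lemma weyl_term_partial_mult: "weyl_term v (0, p) (weyl_term v (0, q) \<phi>) u = weyl_term v (0, p + q) \<phi> u"
proof -
  have "weyl_range p (0 :: 'a mono) = {0}"
    by (auto simp: weyl_range_def intro: poly_mapping_eqI)
  then show ?thesis by (simp add: weyl_term_mult weyl_coef_def)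
qed

text \<open>The toric ideal is generated with the commutative product before it is embedded in the
  Weyl algebra, so this product needs its own compatibility with the action.\<close>

lemma weyl_act_partial_mult:
  "weyl_act v (weyl_of_partial (f * g)) \<phi> u = weyl_act v (weyl_of_partial f) (weyl_act v (weyl_of_partial g) \<phi>) u"
proof -
  have act: "weyl_act v (weyl_of_partial h) \<psi> u = (\<Sum>p\<in>supp h. Const (coef h p) * weyl_term v (0, p) \<psi> u)"
    for h :: "'a cpoly" and \<psi> u
    by (simp add: weyl_of_partial_def weyl_act_sum weyl_act_monom1)
  have "f * g = (\<Sum>p\<in>supp f. \<Sum>q\<in>supp g. monom1 (p + q) (coef f p * coef g q))"
    by (subst poly_eq_sum_monom1[of f], subst poly_eq_sum_monom1[of g])
      (simp add: sum_product mult_single)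
  then have "weyl_act v (weyl_of_partial (f * g)) \<phi> u
    = (\<Sum>p\<in>supp f. \<Sum>q\<in>supp g. Const (coef f p * coef g q) * weyl_term v (0, p + q) \<phi> u)"
    by (simp add: weyl_of_partial_sum weyl_of_partial_monom1 weyl_act_sum weyl_act_monom1)
  also have "\<dots> = (\<Sum>p\<in>supp f. Const (coef f p) * weyl_term v (0, p) (weyl_act v (weyl_of_partial g) \<phi>) u)"
    unfolding act[of g, abs_def] weyl_term_sum weyl_term_partial_mult
    by (simp add: sum_distrib_left Const_mult mult.assoc)
  finally show ?thesis by (simp add: act)
qed

lemma toric_ideal_annihilates:
  assumes bin: "\<And>u c. u \<in> ker_lattice A \<Longrightarrow> weyl_term v (0, pos_part u) \<phi> c = weyl_term v (0, neg_part u) \<phi> c"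
    and f: "f \<in> toric_ideal A"
  shows "weyl_act v (weyl_of_partial f) \<phi> c = 0"
proof -
  have "toric_ideal A \<subseteq> {f. \<forall>c. weyl_act v (weyl_of_partial f) \<phi> c = 0}"
    unfolding toric_ideal_def
    by (rule generated_by_minimal)
      (auto simp: is_submodule_def weyl_of_partial_add weyl_of_partial_diff weyl_act_add weyl_act_diff
        weyl_act_partial_mult weyl_of_partial_monom1 weyl_act_monom1 bin intro: weyl_act_zero_series)
  then show ?thesis using f by blast
qed

text \<open>On the coefficient of x^(v+u), x_j \<partial>_j acts as v_j + u_j plus the derivative in
  y_j. The scalars cancel since A v = \<beta> and A u = 0.\<close>

lemma weyl_act_euler_op:
  assumes \<beta>: "(\<Sum>j\<in>UNIV. of_int (A $ i $ j) * v $ j) = \<beta> $ i" and u: "u \<in> ker_lattice A"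
  shows "weyl_act v (euler_op A \<beta> i) \<phi> u = diff_op (euler_form A i) (\<phi> u)"
proof -
  have "(\<Sum>j\<in>UNIV. A $ i $ j * u $ j) = 0"
    using u by (simp add: ker_lattice_def vec_eq_iff matrix_vector_mult_def)
  then have Au: "(\<Sum>j\<in>UNIV. of_int (A $ i $ j) * of_int (u $ j)) = (0 :: complex)"
    by (metis (mono_tags, lifting) of_int_0 of_int_mult of_int_sum sum.cong)
  have tm: "weyl_term v (monom1 j 1, monom1 j 1) \<phi> u = diff_op (Const (v $ j + of_int (u $ j)) + Var j) (\<phi> u)" for j
    by (simp add: weyl_term_def bracket_def shift_var_def shift_def)
  have tm0: "weyl_term v (0, 0) \<phi> u = \<phi> u"
    by (simp add: weyl_term_def bracket_def)
  have "weyl_act v (euler_op A \<beta> i) \<phi> u = (\<Sum>j\<in>UNIV. Const (of_int (A $ i $ j)) * diff_op (Const (v $ j + of_int (u $ j)) + Var j) (\<phi> u))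
      - Const (\<beta> $ i) * \<phi> u"
    by (simp only: euler_op_def weyl_act_diff weyl_act_sum weyl_act_monom1 tm tm0)
  also have "\<dots> = Const (\<Sum>j\<in>UNIV. of_int (A $ i $ j) * (v $ j + of_int (u $ j))) * \<phi> u
      + diff_op (euler_form A i) (\<phi> u) - Const (\<beta> $ i) * \<phi> u"
    by (simp add: diff_op_add_left distrib_left sum.distrib euler_form_def diff_op_sum_left diff_op_Const_mult_left
        Const_sum Const_mult Const_add sum_distrib_right mult.assoc distrib_right)
  also have "(\<Sum>j\<in>UNIV. of_int (A $ i $ j) * (v $ j + of_int (u $ j))) = \<beta> $ i"
    using \<beta> Au by (simp add: distrib_left sum.distrib)
  finally show ?thesis by simp
qed

lemma coef_pos_part: "coef (pos_part u) j = nat (u $ j)" for u :: "int ^ 'n"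
  by (simp add: pos_part_def)

lemma ker_lattice_diff: "a \<in> ker_lattice A \<Longrightarrow> b \<in> ker_lattice A \<Longrightarrow> a - b \<in> ker_lattice A"
  by (simp add: ker_lattice_def matrix_vector_mult_diff_distrib)

lemma ker_lattice_add: "a \<in> ker_lattice A \<Longrightarrow> b \<in> ker_lattice A \<Longrightarrow> a + b \<in> ker_lattice A"
  by (simp add: ker_lattice_def matrix_vector_right_distrib)

lemma ker_lattice_0 [simp]: "0 \<in> ker_lattice A"
  by (simp add: ker_lattice_def)

lemma expvec_parts: "expvec (pos_part u) - expvec (neg_part u) = u" for u :: "int ^ 'n"
  by (simp add: vec_eq_iff coef_pos_part neg_part_def)

text \<open>A binomial operator evaluated at one exponent involves just two coefficients. Indexing
  these equations by the two exponents \<open>a\<close> and \<open>b\<close>, with u = b - a, gives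
  the symmetric form needed for the units.\<close>

lemma hypergeometric_annihilates_iff:
  fixes A :: "int ^ 'n ^ 'd"
  assumes \<beta>: "\<And>i. (\<Sum>j\<in>UNIV. of_int (A $ i $ j) * v $ j) = \<beta> $ i"
    and supp: "\<And>u. \<phi> u \<noteq> 0 \<Longrightarrow> u \<in> ker_lattice A"
  shows "(\<forall>P\<in>hypergeometric_ideal A \<beta>. \<forall>u. weyl_act v P \<phi> u = 0) \<longleftrightarrow>
    (\<forall>u. \<phi> u \<in> euler_kernel A) \<and>
    (\<forall>a\<in>ker_lattice A. \<forall>b\<in>ker_lattice A.
      diff_op (bracket (shift_var v b) (pos_part (b - a))) (\<phi> b)
      = diff_op (bracket (shift_var v a) (pos_part (a - b))) (\<phi> a))"
    (is "?ann \<longleftrightarrow> ?eul \<and> ?tor")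
proof
  assume ann: ?ann
  have gens: "P \<in> hypergeometric_ideal A \<beta>" if "P \<in> weyl_of_partial ` toric_ideal A \<union> Set.range (euler_op A \<beta>)" for P
    using that generated_by_superset[of "weyl_of_partial ` toric_ideal A \<union> Set.range (euler_op A \<beta>)" UNIV weyl_mult]
    unfolding hypergeometric_ideal_def left_ideal_by_def by blast
  have ?eul
  proof
    fix u
    show "\<phi> u \<in> euler_kernel A"
    proof (cases "\<phi> u = 0")
      case True
      then show ?thesis by (simp add: euler_kernel_def)
    next
      case False
      then show ?thesis
        using ann gens weyl_act_euler_op[OF \<beta> supp[OF False], of _ \<phi>] by (auto simp: euler_kernel_def)
    qed
  qed
  moreover have ?tor
  proof (intro ballI)
    fix a b assume ab: "a \<in> ker_lattice A" "b \<in> ker_lattice A"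
    let ?f = "monom1 (pos_part (b - a)) 1 - monom1 (neg_part (b - a)) 1 :: 'n cpoly"
    have "?f \<in> toric_ideal A"
      unfolding toric_ideal_def
      by (rule subsetD[OF generated_by_superset]) (use ker_lattice_diff[OF ab(2,1)] in blast)
    then have "weyl_of_partial ?f \<in> hypergeometric_ideal A \<beta>"
      by (intro gens UnI1 imageI)
    \<comment> \<open>At this exponent the two monomials of the binomial read the series exactly at
      \<open>b\<close> and at \<open>a\<close>.\<close>
    then have "weyl_act v (weyl_of_partial ?f) \<phi> (b - expvec (pos_part (b - a))) = 0"
      using ann by blast
    moreover have "b - expvec (pos_part (b - a)) + expvec (neg_part (b - a)) = a"
      using expvec_parts[of "b - a"] by (simp add: algebra_simps)
    ultimately show "diff_op (bracket (shift_var v b) (pos_part (b - a))) (\<phi> b)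
      = diff_op (bracket (shift_var v a) (pos_part (a - b))) (\<phi> a)"
      by (simp add: weyl_of_partial_diff weyl_of_partial_monom1 weyl_act_diff weyl_act_monom1 weyl_term_def
          neg_part_def)
  qed
  ultimately show "?eul \<and> ?tor" ..
next
  assume "?eul \<and> ?tor"
  then have eul: ?eul and tor: ?tor by auto
  have "weyl_term v (0, pos_part u) \<phi> c = weyl_term v (0, neg_part u) \<phi> c" if u: "u \<in> ker_lattice A" for u c
  proof -
    define a where "a = c + expvec (neg_part u)"
    define b where "b = c + expvec (pos_part u)"
    have ba: "b - a = u" using expvec_parts[of u] by (simp add: a_def b_def)
    have "diff_op (bracket (shift_var v b) (pos_part (b - a))) (\<phi> b)
      = diff_op (bracket (shift_var v a) (pos_part (a - b))) (\<phi> a)"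
    \<comment> \<open>As b - a lies in the lattice, \<open>a\<close> and \<open>b\<close> are both
      inside or both outside; outside, both coefficients are 0.\<close>
    proof (cases "a \<in> ker_lattice A")
      case True
      then have "b \<in> ker_lattice A" using ker_lattice_add[OF True u] ba by (simp add: algebra_simps)
      then show ?thesis using tor True by blast
    next
      case False
      then have "b \<notin> ker_lattice A" using ker_lattice_diff[OF _ u, of b] ba by (auto simp: algebra_simps)
      then show ?thesis using supp False by (metis diff_op_0_right)
    qed
    moreover have "a - b = - u" using ba by (simp add: algebra_simps)
    ultimately show ?thesis
      unfolding ba by (simp add: weyl_term_def a_def b_def neg_part_def)
  qed
  note bin = this
  have eulop: "weyl_act v (euler_op A \<beta> i) \<phi> u = 0" for i u
  proof (cases "u \<in> ker_lattice A")
    case True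
    then show ?thesis using eul by (simp add: weyl_act_euler_op[OF \<beta>] euler_kernel_def)
  next
    case False
    then have "\<phi> u = 0" using supp by blast
    then have t: "weyl_term v (a, a) \<phi> u = 0" for a by (simp add: weyl_term_def)
    show ?thesis
      by (simp add: euler_op_def weyl_act_diff weyl_act_sum weyl_act_monom1 t)
  qed
  show ?ann
  proof (intro ballI allI)
    fix P u assume "P \<in> hypergeometric_ideal A \<beta>"
    then show "weyl_act v P \<phi> u = 0"
      unfolding hypergeometric_ideal_def
      by (rule left_ideal_annihilates[rotated]) (auto simp: toric_ideal_annihilates[OF bin] eulop)
  qed
qed


section \<open>The ambient coefficient space\<close>

text \<open>The factor \<open>c + \<partial>\<^sub>j\<close>, with the singular value \<open>c = 0\<close> replaced by \<open>1\<close>, so that all these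
  operators are invertible on polynomials.\<close>

definition shift_factor :: "'n \<Rightarrow> complex \<Rightarrow> 'n cpoly"
  where "shift_factor j c = (if c = 0 then 1 else Const c + Var j)"

lemma Var_power: "Var j ^ n = (monom1 (monom1 j n) 1 :: 'n cpoly)"
  by (induction n) (simp_all add: Var_def mult_single single_add[symmetric])

lemma diff_op_Var_power_eq_0:
  assumes "\<And>m. m \<in> supp p \<Longrightarrow> tdeg m < n"
  shows "diff_op (Var j ^ n) p = 0"
proof (rule poly_mapping_eqI)
  fix k
  have "k + monom1 j n \<notin> supp p"
    using assms[of "k + monom1 j n"] by (auto simp: tdeg_add)
  then show "coef (diff_op (Var j ^ n) p) k = coef 0 k"
    by (simp add: Var_power coef_diff_op in_keys_iff)
qed

text \<open>For c \<noteq> 0 the factor is c (1 - x) with \<open>x\<close> a multiple of the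
  derivative. High powers of \<open>x\<close> kill \<open>p\<close>, so a truncated geometric series
  inverts the factor on \<open>p\<close>.\<close>

lemma shift_factor_inverse: "\<exists>w. diff_op (w * shift_factor j c) p = p"
proof (cases "c = 0")
  case True
  then show ?thesis by (intro exI[of _ 1]) (simp add: shift_factor_def)
next
  case False
  define n where "n = Suc (Max (insert 0 (tdeg ` supp p)))"
  define x :: "'a cpoly" where "x = Const (- 1 / c) * Var j"
  have "tdeg m < n" if "m \<in> supp p" for m
    using that by (auto simp: n_def less_Suc_eq_le)
  then have "diff_op (Var j ^ n) p = 0" by (rule diff_op_Var_power_eq_0)
  then have x0: "diff_op (x ^ n) p = 0"
    by (simp add: x_def power_mult_distrib diff_op_mult diff_op_commute[of "Const _ ^ n"])
  have "Const c * x = - Var j"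
    using False by (simp add: x_def mult.assoc[symmetric] Const_mult[symmetric] Const_uminus)
  then have "shift_factor j c = Const c * (1 - x)"
    using False by (simp add: shift_factor_def right_diff_distrib)
  then have "(Const (1 / c) * (\<Sum>i<n. x ^ i)) * shift_factor j c = (Const (1 / c) * Const c) * ((1 - x) * (\<Sum>i<n. x ^ i))"
    by (simp only: ac_simps)
  also have "\<dots> = 1 - x ^ n"
    using False by (simp add: Const_mult[symmetric] one_diff_power_eq)
  finally show ?thesis
    using x0 by (intro exI[of _ "Const (1 / c) * (\<Sum>i<n. x ^ i)"]) (simp add: diff_op_diff_left)
qed

text \<open>The inverse \<open>w\<close> may depend on \<open>p\<close>: the full geometric series
  is not a polynomial, but on each polynomial a finite part of it suffices.\<close>

definition op_unit :: "'n cpoly \<Rightarrow> bool"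
  where "op_unit f \<longleftrightarrow> (\<forall>p. \<exists>w. diff_op (w * f) p = p)"

lemma op_unit_1: "op_unit 1"
  by (auto simp: op_unit_def intro: exI[of _ 1])

lemma op_unit_mult:
  assumes "op_unit f" "op_unit g"
  shows "op_unit (f * g)"
  unfolding op_unit_def
proof
  fix p
  obtain w w' where "diff_op (w * f) p = p" "diff_op (w' * g) p = p"
    using assms unfolding op_unit_def by blast
  then have "diff_op ((w * w') * (f * g)) p = p"
    by (metis (no_types) diff_op_mult mult.assoc mult.left_commute)
  then show "\<exists>w. diff_op (w * (f * g)) p = p" by blast
qed

lemma op_unit_prod: "(\<And>x. x \<in> S \<Longrightarrow> op_unit (f x)) \<Longrightarrow> op_unit (prod f S)"
  by (induction S rule: infinite_finite_induct) (auto intro: op_unit_1 op_unit_mult)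

lemma op_unit_shift_factor: "op_unit (shift_factor j c)"
  using shift_factor_inverse by (auto simp: op_unit_def)

lemma op_unit_cancel:
  assumes "op_unit f" "diff_op f p = diff_op f q"
  shows "p = q"
proof -
  obtain w where "diff_op (w * f) (p - q) = p - q" using assms(1) unfolding op_unit_def by blast
  then have "p - q = 0" using assms(2) by (simp add: diff_op_mult diff_op_diff_right)
  then show ?thesis by simp
qed

lemma op_unit_zero: "op_unit f \<Longrightarrow> diff_op f p = 0 \<Longrightarrow> p = 0"
  using op_unit_cancel[of f p 0] by simp

lemma op_unit_surj:
  assumes "op_unit f"
  shows "\<exists>q. diff_op f q = p"
proof -
  obtain w where "diff_op (w * f) p = p" using assms unfolding op_unit_def by blast
  then have "diff_op f (diff_op w p) = p" by (simp add: diff_op_mult[symmetric] mult.commute)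
  then show ?thesis by blast
qed

text \<open>The interval is empty in coordinates that do not increase, so
  \<open>shift_unit v a b\<close> collects the increasing coordinates of the step from
  \<open>a\<close> to \<open>b\<close> and \<open>shift_unit v b a\<close> the decreasing
  ones.\<close>

definition shift_unit :: "complex ^ 'n \<Rightarrow> int ^ 'n \<Rightarrow> int ^ 'n \<Rightarrow> 'n cpoly"
  where "shift_unit v a b = (\<Prod>j\<in>UNIV. \<Prod>i\<in>{a $ j<..b $ j}. shift_factor j (v $ j + of_int i))"

lemma op_unit_shift_unit: "op_unit (shift_unit v a b)"
  unfolding shift_unit_def by (intro op_unit_prod op_unit_shift_factor)

lemma shift_unit_self [simp]: "shift_unit v a a = 1"
  by (simp add: shift_unit_def)

text \<open>The quotient of the products over the intervals from \<open>a\<close> to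
  \<open>b\<close> and from \<open>b\<close> to \<open>a\<close> is an oriented product, which is
  multiplicative along paths. The identity is its value around a triangle, cleared of
  denominators.\<close>

lemma interval_prod_cocycle:
  fixes f :: "int \<Rightarrow> 'a::comm_monoid_mult"
  shows "prod f {a<..b} * prod f {b<..c} * prod f {c<..a} = prod f {b<..a} * prod f {c<..b} * prod f {a<..c}"
proof -
  have split: "prod f {x<..z} = prod f {x<..y} * prod f {y<..z}" if "x \<le> y" "y \<le> z" for x y z
    using that by (subst prod.union_disjoint[symmetric]) (auto intro!: prod.cong)
  consider "a \<le> b" "b \<le> c" | "a \<le> c" "c \<le> b" | "b \<le> a" "a \<le> c" | "b \<le> c" "c \<le> a" | "c \<le> a" "a \<le> b" | "c \<le> b" "b \<le> a"
    by linarith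
  then show ?thesis
  proof cases
    case 1
    then show ?thesis using split[of a b c] by (simp add: mult_ac)
  next
    case 2
    then show ?thesis using split[of a c b] by (simp add: mult_ac)
  next
    case 3
    then show ?thesis using split[of b a c] by (simp add: mult_ac)
  next
    case 4
    then show ?thesis using split[of b c a] by (simp add: mult_ac)
  next
    case 5
    then show ?thesis using split[of c a b] by (simp add: mult_ac)
  next
    case 6
    then show ?thesis using split[of c b a] by (simp add: mult_ac)
  qed
qed

lemma shift_unit_cocycle:
  "shift_unit v a b * shift_unit v b c * shift_unit v c a = shift_unit v b a * shift_unit v c b * shift_unit v a c"
  unfolding shift_unit_def prod.distrib[symmetric] by (intro prod.cong refl interval_prod_cocycle)

lemma nsupp_shift_iff: "j \<in> nsupp (shift v a) \<longleftrightarrow> (\<exists>k::int. k < 0 \<and> v $ j + of_int (a $ j) = of_int k)"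
  by (simp add: nsupp_def shift_def)

text \<open>A pure derivative occurs among the factors exactly when v_j + i = 0 for some
  \<open>i\<close> with a_j < i \<le> b_j, that is, when the \<open>j\<close>-th coordinate is a
  negative integer at \<open>a\<close> and a nonnegative one at \<open>b\<close>. It occurs once;
  the other factors are units.\<close>

lemma bracket_pos_part:
  fixes v :: "complex ^ 'n"
  shows "bracket (shift_var v b) (pos_part (b - a))
    = (\<Prod>j\<in>nsupp (shift v a) - nsupp (shift v b). Var j) * shift_unit v a b"
proof -
  have coord: "(\<Prod>i<nat (b $ j - a $ j). shift_var v b j - of_nat i)
     = (if j \<in> nsupp (shift v a) - nsupp (shift v b) then Var j else 1)
       * (\<Prod>i\<in>{a $ j<..b $ j}. shift_factor j (v $ j + of_int i))" for j
  proof -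
    have bij: "bij_betw (\<lambda>i. b $ j - int i) {..<nat (b $ j - a $ j)} {a $ j<..b $ j}"
      by (rule bij_betwI[where g = "\<lambda>i. nat (b $ j - i)"]) auto
    have "(\<Prod>i<nat (b $ j - a $ j). shift_var v b j - of_nat i)
      = (\<Prod>i<nat (b $ j - a $ j). Const (v $ j + of_int (b $ j - int i)) + Var j)"
      by (rule prod.cong) (simp_all add: shift_var_def shift_def Const_add Const_diff Const_of_nat)
    also have "\<dots> = (\<Prod>i\<in>{a $ j<..b $ j}. Const (v $ j + of_int i) + Var j)"
      by (rule prod.reindex_bij_betw[OF bij, of "\<lambda>i. Const (v $ j + of_int i) + Var j"])
    also have "\<dots> = (\<Prod>i\<in>{a $ j<..b $ j}. (if v $ j + of_int i = 0 then Var j else 1) * shift_factor j (v $ j + of_int i))"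
      by (rule prod.cong) (auto simp: shift_factor_def)
    also have "\<dots> = (\<Prod>i\<in>{a $ j<..b $ j}. if v $ j + of_int i = 0 then Var j else 1)
        * (\<Prod>i\<in>{a $ j<..b $ j}. shift_factor j (v $ j + of_int i))"
      by (rule prod.distrib)
    also have "(\<Prod>i\<in>{a $ j<..b $ j}. if v $ j + of_int i = 0 then Var j else 1)
        = (if j \<in> nsupp (shift v a) - nsupp (shift v b) then Var j else (1 :: 'n cpoly))"
    proof (cases "\<exists>i\<in>{a $ j<..b $ j}. v $ j + of_int i = 0")
      case True
      then obtain i where i: "i \<in> {a $ j<..b $ j}" "v $ j = - of_int i"
        by (auto simp: eq_neg_iff_add_eq_0)
      have "(\<Prod>i'\<in>{a $ j<..b $ j}. if v $ j + of_int i' = 0 then Var j else 1)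
        = (\<Prod>i'\<in>{a $ j<..b $ j}. if i' = i then Var j else (1 :: 'n cpoly))"
        by (rule prod.cong) (auto simp: i(2))
      also have "\<dots> = Var j" using i(1) by (simp add: prod.delta)
      finally have "(\<Prod>i'\<in>{a $ j<..b $ j}. if v $ j + of_int i' = 0 then Var j else 1) = (Var j :: 'n cpoly)" .
      moreover have "j \<in> nsupp (shift v a) - nsupp (shift v b)"
      proof -
        have "v $ j + of_int (a $ j) = of_int (a $ j - i)" "v $ j + of_int (b $ j) = of_int (b $ j - i)"
          by (simp_all add: i(2))
        then show ?thesis
          using i(1) unfolding Diff_iff nsupp_shift_iff by (metis diff_less_0_iff_less greaterThanAtMost_iff leD of_int_eq_iff)
      qed
      ultimately show ?thesis by simp
    next
      case False
      have "j \<notin> nsupp (shift v a) - nsupp (shift v b)"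
      proof
        assume *: "j \<in> nsupp (shift v a) - nsupp (shift v b)"
        then obtain k where k: "k < 0" "v $ j + of_int (a $ j) = of_int k"
          unfolding nsupp_shift_iff Diff_iff by blast
        then have v: "v $ j = of_int (k - a $ j)" by (simp add: algebra_simps)
        then have "v $ j + of_int (b $ j) = of_int (k - a $ j + b $ j)" by simp
        then have "\<not> k - a $ j + b $ j < 0" using * unfolding nsupp_shift_iff Diff_iff by blast
        \<comment> \<open>This is the index at which v_j + i vanishes: \<open>k\<close> is negative
          at \<open>a\<close>, and the value at \<open>b\<close> is not.\<close>
        then have "a $ j - k \<in> {a $ j<..b $ j}" using k(1) by simp
        moreover have "v $ j + of_int (a $ j - k) = 0" by (simp add: v)
        ultimately show False using False by blast
      qed
      moreover have "(\<Prod>i\<in>{a $ j<..b $ j}. if v $ j + of_int i = 0 then Var j else (1 :: 'n cpoly)) = 1"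
        using False by (intro prod.neutral) simp
      ultimately show ?thesis by (simp only: if_False)
    qed
    finally show ?thesis .
  qed
  have "bracket (shift_var v b) (pos_part (b - a)) = (\<Prod>j\<in>UNIV. \<Prod>i<nat (b $ j - a $ j). shift_var v b j - of_nat i)"
    by (simp add: bracket_superset[of UNIV] coef_pos_part)
  also have "\<dots> = (\<Prod>j\<in>nsupp (shift v a) - nsupp (shift v b). Var j) * shift_unit v a b"
    unfolding coord prod.distrib shift_unit_def
    by (simp add: prod.inter_filter[symmetric] prod.If_cases set_diff_eq)
  finally show ?thesis .
qed

abbreviation varp :: "'n set \<Rightarrow> 'n cpoly"
  where "varp Y \<equiv> \<Prod>j\<in>Y. Var j"

text \<open>Each coefficient is transported from its exponent to the base point 0 by the two units
  between them. The cocycle identity then removes all units from the toric equations, so that only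
  negative supports remain visible.\<close>

lemma ambient_coeff_space_iff:
  fixes A :: "int ^ 'n ^ 'd" and v :: "complex ^ 'n"
  assumes \<beta>: "\<And>i. (\<Sum>j\<in>UNIV. of_int (A $ i $ j) * v $ j) = \<beta> $ i"
  shows "p \<in> ambient_coeff_space A \<beta> v N \<longleftrightarrow>
    (\<exists>f. (\<forall>I. f I \<in> euler_kernel A) \<and> (\<forall>I. I \<notin> N \<longrightarrow> f I = 0) \<and>
      (\<forall>I\<in>nsupps A v. \<forall>J\<in>nsupps A v. diff_op (varp (I - J)) (f J) = diff_op (varp (J - I)) (f I)) \<and>
      f (nsupp v) = p)"
proof
  let ?L = "ker_lattice A" and ?I = "\<lambda>u. nsupp (shift v u)" and ?U = "shift_unit v"
  have s0: "shift v 0 = v" by (simp add: shift_def vec_eq_iff)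
  {
    assume "p \<in> ambient_coeff_space A \<beta> v N"
    then obtain \<phi> where supp: "\<And>u. \<phi> u \<noteq> 0 \<Longrightarrow> u \<in> ?L \<and> ?I u \<in> N"
      and ann: "\<forall>P\<in>hypergeometric_ideal A \<beta>. \<forall>u. weyl_act v P \<phi> u = 0" and p: "p = \<phi> 0"
      unfolding ambient_coeff_space_def by blast
    have eul: "\<phi> u \<in> euler_kernel A" for u
      using hypergeometric_annihilates_iff[OF \<beta>, of \<phi>] supp ann by blast
    have tor: "diff_op (varp (?I a - ?I b) * ?U a b) (\<phi> b) = diff_op (varp (?I b - ?I a) * ?U b a) (\<phi> a)"
      if "a \<in> ?L" "b \<in> ?L" for a b
      using hypergeometric_annihilates_iff[OF \<beta>, of \<phi>] supp ann that by (simp add: bracket_pos_part)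
    \<comment> \<open>The support of \<open>v\<close> gets the representative 0, where the units are
      1 and the normalised value is the coefficient of x^v itself.\<close>
    define c where "c I = (if I = nsupp v then 0 else SOME u. u \<in> ?L \<and> ?I u = I)" for I
    have c: "c I \<in> ?L \<and> ?I (c I) = I" if I: "I \<in> nsupps A v" for I
    proof (cases "I = nsupp v")
      case False
      have "\<exists>u. u \<in> ?L \<and> ?I u = I" using I unfolding nsupps_def by blast
      from someI_ex[OF this] show ?thesis using False by (simp add: c_def)
    qed (simp add: c_def s0)
    have "\<forall>I. \<exists>g. diff_op (?U (c I) 0) g = diff_op (?U 0 (c I)) (\<phi> (c I))"
      using op_unit_surj[OF op_unit_shift_unit] by blast
    from choice[OF this] obtain g where g: "\<And>I. diff_op (?U (c I) 0) (g I) = diff_op (?U 0 (c I)) (\<phi> (c I))"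
      by blast
    define f where "f I = (if I \<in> nsupps A v then g I else 0)" for I
    have "f I \<in> euler_kernel A" for I
    \<comment> \<open>The Euler forms commute with the units and the units are injective, so the
      Euler equations survive the normalisation.\<close>
    proof -
      have "diff_op (euler_form A i) (g I) = 0" for i
      proof (rule op_unit_zero[OF op_unit_shift_unit])
        show "diff_op (?U (c I) 0) (diff_op (euler_form A i) (g I)) = 0"
          using diff_op_euler_kernel[OF eul, of "?U 0 (c I)" "c I"]
          by (simp add: diff_op_commute[of "?U (c I) 0"] g euler_kernel_def)
      qed
      then show ?thesis by (simp add: f_def euler_kernel_def)
    qed
    moreover have "f I = 0" if "I \<notin> N" for I
    proof (cases "I \<in> nsupps A v")
      case True
      then have "\<phi> (c I) = 0" using supp c[OF True] that by metis
      then have "g I = 0" using g[of I] op_unit_zero[OF op_unit_shift_unit] by simp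
      then show ?thesis by (simp add: f_def)
    qed (simp add: f_def)
    moreover have "diff_op (varp (I - J)) (f J) = diff_op (varp (J - I)) (f I)"
      if IJ: "I \<in> nsupps A v" "J \<in> nsupps A v" for I J
    proof (rule op_unit_cancel)
      let ?a = "c I" and ?b = "c J"
      show "op_unit (?U ?a ?b * (?U ?a 0 * ?U ?b 0))"
        by (intro op_unit_mult op_unit_shift_unit)
      have "diff_op (?U ?a ?b * (?U ?a 0 * ?U ?b 0)) (diff_op (varp (I - J)) (f J))
          = diff_op (?U ?a ?b * ?U ?a 0 * varp (I - J)) (diff_op (?U ?b 0) (g J))"
        using IJ by (simp add: f_def diff_op_mult[symmetric] ac_simps)
      also have "\<dots> = diff_op (?U ?a 0 * ?U 0 ?b) (diff_op (varp (I - J) * ?U ?a ?b) (\<phi> ?b))"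
        unfolding g by (simp add: diff_op_mult[symmetric] ac_simps)
      also have "\<dots> = diff_op (?U ?a 0 * ?U 0 ?b) (diff_op (varp (J - I) * ?U ?b ?a) (\<phi> ?a))"
        using tor[of ?a ?b] c[OF IJ(1)] c[OF IJ(2)] by simp
      also have "\<dots> = diff_op (varp (J - I) * (?U ?b ?a * ?U ?a 0 * ?U 0 ?b)) (\<phi> ?a)"
        by (simp add: diff_op_mult[symmetric] ac_simps)
      \<comment> \<open>The triangle with vertices \<open>c I\<close>, \<open>c J\<close> and 0: its
        three sides are reversed at once.\<close>
      also have "?U ?b ?a * ?U ?a 0 * ?U 0 ?b = ?U ?a ?b * ?U 0 ?a * ?U ?b 0"
        by (rule shift_unit_cocycle)
      also have "diff_op (varp (J - I) * (?U ?a ?b * ?U 0 ?a * ?U ?b 0)) (\<phi> ?a)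
          = diff_op (?U ?a ?b * ?U ?b 0 * varp (J - I)) (diff_op (?U 0 ?a) (\<phi> ?a))"
        by (simp add: diff_op_mult[symmetric] ac_simps)
      also have "\<dots> = diff_op (?U ?a ?b * (?U ?a 0 * ?U ?b 0)) (diff_op (varp (J - I)) (f I))"
        using IJ by (simp add: g[symmetric] f_def diff_op_mult[symmetric] ac_simps)
      finally show "diff_op (?U ?a ?b * (?U ?a 0 * ?U ?b 0)) (diff_op (varp (I - J)) (f J))
        = diff_op (?U ?a ?b * (?U ?a 0 * ?U ?b 0)) (diff_op (varp (J - I)) (f I))" .
    qed
    moreover have "f (nsupp v) = p"
    proof -
      have "nsupp v \<in> nsupps A v" unfolding nsupps_def using s0 ker_lattice_0 by (metis (mono_tags, lifting) mem_Collect_eq)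
      then show ?thesis using g[of "nsupp v"] by (simp add: f_def c_def p)
    qed
    ultimately show "\<exists>f. (\<forall>I. f I \<in> euler_kernel A) \<and> (\<forall>I. I \<notin> N \<longrightarrow> f I = 0) \<and>
      (\<forall>I\<in>nsupps A v. \<forall>J\<in>nsupps A v. diff_op (varp (I - J)) (f J) = diff_op (varp (J - I)) (f I)) \<and>
      f (nsupp v) = p"
      by blast
  next
    assume "\<exists>f. (\<forall>I. f I \<in> euler_kernel A) \<and> (\<forall>I. I \<notin> N \<longrightarrow> f I = 0) \<and>
      (\<forall>I\<in>nsupps A v. \<forall>J\<in>nsupps A v. diff_op (varp (I - J)) (f J) = diff_op (varp (J - I)) (f I)) \<and>
      f (nsupp v) = p"
    then obtain f where eul: "\<And>I. f I \<in> euler_kernel A" and out: "\<And>I. I \<notin> N \<Longrightarrow> f I = 0"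
      and rel: "\<And>I J. I \<in> nsupps A v \<Longrightarrow> J \<in> nsupps A v \<Longrightarrow> diff_op (varp (I - J)) (f J) = diff_op (varp (J - I)) (f I)"
      and p: "f (nsupp v) = p"
      by blast
    \<comment> \<open>The normalisation is read backwards, now for all integer vectors and not only
      for one representative of each support.\<close>
    have "\<forall>u. \<exists>g. diff_op (?U 0 u) g = diff_op (?U u 0) (f (?I u))"
      using op_unit_surj[OF op_unit_shift_unit] by blast
    from choice[OF this] obtain g where g: "\<And>u. diff_op (?U 0 u) (g u) = diff_op (?U u 0) (f (?I u))"
      by blast
    define \<phi> where "\<phi> u = (if u \<in> ?L then g u else 0)" for u
    have supp: "u \<in> ?L \<and> ?I u \<in> N" if "\<phi> u \<noteq> 0" for u
    proof -
      have u: "u \<in> ?L" "g u \<noteq> 0" using that by (auto simp: \<phi>_def split: if_splits)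
      have "?I u \<in> N"
      proof (rule ccontr)
        assume "?I u \<notin> N"
        then have "diff_op (?U 0 u) (g u) = 0" using g[of u] out by simp
        then show False using op_unit_zero[OF op_unit_shift_unit] u(2) by blast
      qed
      with u show ?thesis by blast
    qed
    have eul\<phi>: "\<phi> u \<in> euler_kernel A" for u
    proof -
      have "diff_op (euler_form A i) (g u) = 0" for i
      proof (rule op_unit_zero[OF op_unit_shift_unit])
        show "diff_op (?U 0 u) (diff_op (euler_form A i) (g u)) = 0"
          using diff_op_euler_kernel[OF eul, of "?U u 0" "?I u"]
          by (simp add: diff_op_commute[of "?U 0 u"] g euler_kernel_def)
      qed
      then show ?thesis by (simp add: \<phi>_def euler_kernel_def)
    qed
    have tor: "diff_op (varp (?I a - ?I b) * ?U a b) (\<phi> b) = diff_op (varp (?I b - ?I a) * ?U b a) (\<phi> a)"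
      if ab: "a \<in> ?L" "b \<in> ?L" for a b
    proof (rule op_unit_cancel)
      have IJ: "?I a \<in> nsupps A v" "?I b \<in> nsupps A v" using ab by (auto simp: nsupps_def)
      show "op_unit (?U 0 a * ?U 0 b)" by (intro op_unit_mult op_unit_shift_unit)
      have "diff_op (?U 0 a * ?U 0 b) (diff_op (varp (?I a - ?I b) * ?U a b) (\<phi> b))
          = diff_op (?U 0 a * varp (?I a - ?I b) * ?U a b) (diff_op (?U 0 b) (g b))"
        using ab by (simp add: \<phi>_def diff_op_mult[symmetric] ac_simps)
      also have "\<dots> = diff_op (?U 0 a * ?U a b * ?U b 0) (diff_op (varp (?I a - ?I b)) (f (?I b)))"
        unfolding g by (simp add: diff_op_mult[symmetric] ac_simps)
      also have "\<dots> = diff_op (?U a 0 * ?U b a * ?U 0 b) (diff_op (varp (?I b - ?I a)) (f (?I a)))"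
        by (simp only: rel[OF IJ] shift_unit_cocycle[of v 0 a b])
      also have "\<dots> = diff_op (?U b a * ?U 0 b * varp (?I b - ?I a)) (diff_op (?U a 0) (f (?I a)))"
        by (simp add: diff_op_mult[symmetric] ac_simps)
      also have "\<dots> = diff_op (?U 0 a * ?U 0 b) (diff_op (varp (?I b - ?I a) * ?U b a) (\<phi> a))"
        using ab by (simp add: g[symmetric] \<phi>_def diff_op_mult[symmetric] ac_simps)
      finally show "diff_op (?U 0 a * ?U 0 b) (diff_op (varp (?I a - ?I b) * ?U a b) (\<phi> b))
        = diff_op (?U 0 a * ?U 0 b) (diff_op (varp (?I b - ?I a) * ?U b a) (\<phi> a))" .
    qed
    have "\<forall>P\<in>hypergeometric_ideal A \<beta>. \<forall>u. weyl_act v P \<phi> u = 0"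
      using hypergeometric_annihilates_iff[OF \<beta>, of \<phi>] supp eul\<phi> tor by (simp add: bracket_pos_part)
    moreover have "\<phi> 0 = p"
      using g[of 0] by (simp add: \<phi>_def s0 p)
    ultimately show "p \<in> ambient_coeff_space A \<beta> v N"
      unfolding ambient_coeff_space_def using supp by blast
  }
qed


text \<open>\<open>log_poly\<close> identifies \<open>Sring r\<close> with the polynomials killed by
  the Euler forms and turns ell^Y into the product of the derivatives in \<open>Y\<close>, so the
  two systems of relations correspond.\<close>

lemma ambient_coeff_space_iff_solution_family:
  fixes A :: "int ^ 'n ^ 'd"
  assumes \<beta>: "\<And>i. (\<Sum>j\<in>UNIV. of_int (A $ i $ j) * v $ j) = \<beta> $ i"
    and B: "gale_dual A r B"
  shows "p \<in> ambient_coeff_space A \<beta> v N \<longleftrightarrow>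
    (\<exists>q. solution_family A r B v N q \<and> log_poly r B (q (nsupp v)) = p)"
proof -
  obtain \<rho> where \<rho>: "linear_forms \<rho>" and inv1: "\<And>q. q \<in> Sring r \<Longrightarrow> adjm \<rho> (log_poly r B q) = q"
    and inv2: "\<And>p. p \<in> euler_kernel A \<Longrightarrow> log_poly r B (adjm \<rho> p) = p"
    and in_S: "\<And>p. adjm \<rho> p \<in> Sring r"
    using log_poly_coordinates[OF B] by blast
  have varp: "diff_op (varp Y) (log_poly r B q) = log_poly r B (diff_op (ellp r B Y) q)" for Y q
    by (simp add: log_poly_eq_adjm ellp_def diff_op_prod_adjm[OF linear_forms_ell])
  have inj: "p = q" if "log_poly r B p = log_poly r B q" "p \<in> Sring r" "q \<in> Sring r" for p q
    using that inv1 by metis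
  show ?thesis
    unfolding ambient_coeff_space_iff[OF \<beta>]
  proof
    assume "\<exists>f. (\<forall>I. f I \<in> euler_kernel A) \<and> (\<forall>I. I \<notin> N \<longrightarrow> f I = 0) \<and>
      (\<forall>I\<in>nsupps A v. \<forall>J\<in>nsupps A v. diff_op (varp (I - J)) (f J) = diff_op (varp (J - I)) (f I)) \<and>
      f (nsupp v) = p"
    then obtain f where f: "\<And>I. f I \<in> euler_kernel A" "\<And>I. I \<notin> N \<Longrightarrow> f I = 0"
      "\<And>I J. I \<in> nsupps A v \<Longrightarrow> J \<in> nsupps A v \<Longrightarrow> diff_op (varp (I - J)) (f J) = diff_op (varp (J - I)) (f I)"
      "f (nsupp v) = p" by blast
    have "solution_family A r B v N (\<lambda>I. adjm \<rho> (f I))"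
      unfolding solution_family_def
    proof (intro conjI allI impI ballI)
      fix I J assume "I \<in> nsupps A v" "J \<in> nsupps A v"
      then have "log_poly r B (diff_op (ellp r B (I - J)) (adjm \<rho> (f J)))
        = log_poly r B (diff_op (ellp r B (J - I)) (adjm \<rho> (f I)))"
        by (simp add: varp[symmetric] inv2 f)
      then show "diff_op (ellp r B (I - J)) (adjm \<rho> (f J)) = diff_op (ellp r B (J - I)) (adjm \<rho> (f I))"
        by (rule inj) (simp_all add: Sring_diff_op in_S)
    qed (simp_all add: in_S f \<rho>)
    moreover have "log_poly r B (adjm \<rho> (f (nsupp v))) = p" using inv2[OF f(1)[of "nsupp v"]] by (simp add: f(4))
    ultimately show "\<exists>q. solution_family A r B v N q \<and> log_poly r B (q (nsupp v)) = p" by blast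
  next
    assume "\<exists>q. solution_family A r B v N q \<and> log_poly r B (q (nsupp v)) = p"
    then obtain q where q: "solution_family A r B v N q" "log_poly r B (q (nsupp v)) = p" by blast
    have "log_poly r B 0 = 0" by (simp add: log_poly_eq_adjm linear_forms_ell)
    then show "\<exists>f. (\<forall>I. f I \<in> euler_kernel A) \<and> (\<forall>I. I \<notin> N \<longrightarrow> f I = 0) \<and>
      (\<forall>I\<in>nsupps A v. \<forall>J\<in>nsupps A v. diff_op (varp (I - J)) (f J) = diff_op (varp (J - I)) (f I)) \<and>
      f (nsupp v) = p"
      using q unfolding solution_family_def
      by (intro exI[of _ "\<lambda>I. log_poly r B (q I)"]) (simp add: varp log_poly_euler_kernel[OF B])
  qed
qed

text \<open>The preimage supplied by \<open>sup\<close> is not known to be homogeneous. The inverse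
  transpose preserves degrees and shows that it is a form of degree \<open>i\<close>; only then does
  its membership in \<open>V\<close> become available.\<close>

lemma log_poly_bij_betw_degree_part:
  fixes A :: "int ^ 'n ^ 'd"
  assumes B: "gale_dual A r B"
    and V: "V \<subseteq> forms r i"
    and sub: "\<And>q. q \<in> V \<Longrightarrow> log_poly r B q \<in> W"
    and sup: "\<And>p. p \<in> W \<Longrightarrow> \<exists>q\<in>Sring r. log_poly r B q = p \<and> (q \<in> forms r i \<longrightarrow> q \<in> V)"
  shows "bij_betw (log_poly r B) V (degree_part i W)"
proof -
  obtain \<rho> :: "nat \<Rightarrow> 'n cpoly" where \<rho>: "linear_forms \<rho>"
    and inv1: "\<And>q. q \<in> Sring r \<Longrightarrow> adjm \<rho> (log_poly r B q) = q"
  proof (rule log_poly_coordinates[OF B])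
    fix \<rho> :: "nat \<Rightarrow> 'n cpoly"
    assume "linear_forms \<rho>" "\<And>q. q \<in> Sring r \<Longrightarrow> adjm \<rho> (log_poly r B q) = q"
    then show ?thesis by (rule that)
  qed
  have "inj_on (log_poly r B) V"
    by (rule inj_on_inverseI[of _ "adjm \<rho>"]) (use V inv1 in \<open>auto simp: degree_part_def\<close>)
  moreover have "log_poly r B ` V \<subseteq> degree_part i W"
  proof
    fix p assume "p \<in> log_poly r B ` V"
    then obtain q where q: "q \<in> V" "p = log_poly r B q" by blast
    then have "homog i q" using V by (auto simp: degree_part_def)
    then have "homog i p" by (simp add: q(2) log_poly_eq_adjm adjm_homog[OF linear_forms_ell])
    then show "p \<in> degree_part i W" using sub[OF q(1)] by (simp add: degree_part_def q(2))
  qed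
  moreover have "degree_part i W \<subseteq> log_poly r B ` V"
  proof
    fix p assume "p \<in> degree_part i W"
    then have p: "p \<in> W" "homog i p" by (auto simp: degree_part_def)
    obtain q where q: "q \<in> Sring r" "log_poly r B q = p" "q \<in> forms r i \<longrightarrow> q \<in> V"
      using sup[OF p(1)] by blast
    have "homog i q" using adjm_homog[OF \<rho> p(2)] inv1[OF q(1)] by (simp add: q(2))
    then show "p \<in> log_poly r B ` V" using q by (auto simp: degree_part_def)
  qed
  ultimately show ?thesis by (auto simp: bij_betw_def)
qed

theorem proposition3p8:
  fixes A :: "int ^ 'n ^ 'd" and \<beta> :: "complex ^ 'd" and w :: "real ^ 'n" and v :: "complex ^ 'n"
    and N :: "'n set set" and r :: nat and B :: "nat \<Rightarrow> int ^ 'n"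
    and \<iota> :: "'n set \<Rightarrow> 'n set" and G0 :: "'n set"
  assumes "homogeneous_matrix A"
    and "generic_direction A \<beta> w"
    and "fake_exponent A \<beta> w v"
    and "negative_support_family A w v N"
    and "gale_dual A r B"
    and "\<forall>H \<in> Hsets A v N. \<iota> H \<in> Gsets N \<and> \<iota> H \<subseteq> H"
    and "G0 \<in> Gsets N" and "G0 \<subseteq> Eset v N"
  shows
    "(\<forall>i. V_intr A r B v N i \<subseteq> V_amb A r B v N \<iota> G0 i \<and>
        induces_perfect_pairing pairing
          (degree_part i (J_intr A r B v N)) (degree_part i (J_amb A r B v N \<iota> G0))
          (V_amb A r B v N \<iota> G0 i) (V_intr A r B v N i) \<and>
        quotient_iso_dual
          (degree_part i (J_intr A r B v N)) (degree_part i (J_amb A r B v N \<iota> G0))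
          (V_amb A r B v N \<iota> G0 i) (V_intr A r B v N i)) \<and>
     (ordered_family A v N \<longrightarrow>
        (\<forall>i. bij_betw (log_poly r B) (V_amb A r B v N \<iota> G0 i)
               (degree_part i (ambient_coeff_space A \<beta> v N)) \<and>
             bij_betw (log_poly r B) (V_intr A r B v N i)
               (degree_part i (intrinsic_coeff_space A r B v N))))"
proof -
  note NG = assms(4,6,7,8)
  have \<beta>: "(\<Sum>j\<in>UNIV. of_int (A $ i $ j) * v $ j) = \<beta> $ i" for i
    using assms(3) by (simp add: fake_exponent_def)
  have J: "degree_part i (J_amb A r B v N \<iota> G0) \<subseteq> degree_part i (J_intr A r B v N)" for i
    using J_amb_subset_J_intr[OF NG] by (auto simp: degree_part_def)
  have Jf: "degree_part i (J_intr A r B v N) \<subseteq> forms r i" for i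
    by (auto simp: degree_part_def J_intr_def)
  have pp: "induces_perfect_pairing pairing
          (degree_part i (J_intr A r B v N)) (degree_part i (J_amb A r B v N \<iota> G0))
          (V_amb A r B v N \<iota> G0 i) (V_intr A r B v N i) \<and>
        quotient_iso_dual
          (degree_part i (J_intr A r B v N)) (degree_part i (J_amb A r B v N \<iota> G0))
          (V_amb A r B v N \<iota> G0 i) (V_intr A r B v N i)" for i
    unfolding V_amb_def V_intr_def
    by (intro perfect_pairing_perp lin_subspace_degree_part lin_subspace_J_intr lin_subspace_J_amb Jf J)
  have V: "V_intr A r B v N i \<subseteq> V_amb A r B v N \<iota> G0 i" for i
    unfolding V_amb_def V_intr_def by (rule perp_deg_antimono[OF J])
  have amb: "bij_betw (log_poly r B) (V_amb A r B v N \<iota> G0 i) (degree_part i (ambient_coeff_space A \<beta> v N))" for i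
  proof (rule log_poly_bij_betw_degree_part[OF assms(5)])
    show "V_amb A r B v N \<iota> G0 i \<subseteq> forms r i" by (auto simp: V_amb_def perp_deg_def)
    show "log_poly r B q \<in> ambient_coeff_space A \<beta> v N" if "q \<in> V_amb A r B v N \<iota> G0 i" for q
      using that unfolding ambient_coeff_space_iff_solution_family[OF \<beta> assms(5)] V_amb_iff[OF NG] by blast
    fix p assume "p \<in> ambient_coeff_space A \<beta> v N"
    then obtain q where "solution_family A r B v N q" "log_poly r B (q (nsupp v)) = p"
      unfolding ambient_coeff_space_iff_solution_family[OF \<beta> assms(5)] by blast
    then show "\<exists>q\<in>Sring r. log_poly r B q = p \<and> (q \<in> forms r i \<longrightarrow> q \<in> V_amb A r B v N \<iota> G0 i)"
      unfolding V_amb_iff[OF NG] by (intro bexI[of _ "q (nsupp v)"]) (auto simp: solution_family_def)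
  qed
  have vN: "nsupp v \<in> N" using assms(4) by (simp add: negative_support_family_def)
  have intr: "bij_betw (log_poly r B) (V_intr A r B v N i) (degree_part i (intrinsic_coeff_space A r B v N))" for i
  proof (rule log_poly_bij_betw_degree_part[OF assms(5)])
    show "V_intr A r B v N i \<subseteq> forms r i" by (auto simp: V_intr_def perp_deg_def)
    show "log_poly r B q \<in> intrinsic_coeff_space A r B v N" if "q \<in> V_intr A r B v N i" for q
      using that unfolding V_intr_iff[OF NG] intrinsic_coeff_space_def intrinsic_series_0[OF vN] by blast
    fix p assume "p \<in> intrinsic_coeff_space A r B v N"
    then obtain q where q: "q \<in> perp r (ellH_ideal A r B v N)" "log_poly r B (diff_op (ellp r B (Eset v N)) q) = p"
      unfolding intrinsic_coeff_space_def intrinsic_series_0[OF vN] by blast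
    then show "\<exists>q\<in>Sring r. log_poly r B q = p \<and> (q \<in> forms r i \<longrightarrow> q \<in> V_intr A r B v N i)"
      unfolding V_intr_iff[OF NG]
      by (intro bexI[of _ "diff_op (ellp r B (Eset v N)) q"]) (auto simp: perp_def Sring_diff_op)
  qed
  show ?thesis using V pp amb intr by blast
qed

end
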